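(* Let $V$ be a complex vector space of dimension $r$, let $G\subset \mathrm{GL}(V)$ be a complex reflection group, let $N\triangleleft G$ be a normal reflection subgroup of $G$, and let $H=G/N$, acting as a reflection group on the $r$-dimensional vector space $E=V/N$. Then the degrees $d_i^N$, $d_i^G$ (of $N$ and $G$ acting on $V$), the degrees $d_i^H$ (of $H$ acting on $E$), and the fake degrees $e_i^N(V)$, $e_i^G(V)$, $e_i^G(E)$, $e_i^H(E)$ can be simultaneously indexed by $i=1,\dots,r$ in such a way that for every $i=1,\dots,r$: \begin{align*} e_i^N(V) + e_i^G(E) &= e_i^G(V),\\ d_i^N \cdot d_i^H &= d_i^G,\\ d_i^N \cdot e_i^H(E) &= e_i^G(E). \end{align*}
   Context: A reflection is an element of $\mathrm{GL}(V)$ that fixes some hyperplane pointwise. A complex reflection group is a finite subgroup of $\mathrm{GL}(V)$ generated by reflections. A normal reflection subgroup $N$ of $G$ is a normal subgroup of $G$ that is generated by reflections. Degrees. $S(V^* )$ denotes the symmetric algebra of $V^*$ (polynomial functions on $V$), with its usual grading. For a complex reflection group $G\subset\mathrm{GL}(V)$, the invariant ring $S(V^* )^G$ is a polynomial ring generated by $r$ algebraically independent homogeneous polynomials $G_1,\dots,G_r$ (fundamental invariants); their degrees form a multiset $\{d_1^G,\dots,d_r^G\}$ depending only on $G$, called the degrees of $G$. Similarly $d_1^N,\dots,d_r^N$ are the degrees of $N$ acting on $V$. The space $E=V/N$. One can choose homogeneous algebraically independent generators $N_1,\dots,N_r$ of $S(V^* )^N$ such that $E^*:=\mathrm{span}_{\mathbb{C}}\{N_1,\dots,N_r\}$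 is $G$-stable. Then $N$ acts trivially on $E^*$, so $H=G/N$ acts on $E^*$ and on its dual $E$, and $H$ acts on $E$ as a (finite) complex reflection group. The vector space $E$ is identified with the quotient $V/N$, since $S(E^* )=\mathbb{C}[N_1,\dots,N_r]=S(V^* )^N$. The degrees $d_1^H,\dots,d_r^H$ are the degrees of $H$ as a reflection group on $E$, computed in $S(E^* )$ with the grading in which every element of $E^*$ has degree $1$. $G$ acts on $E$ through $G\to H$. Fake degrees. For a complex reflection group $G\subset\mathrm{GL}(V)$, let $\mathbb{C}[V]_G=S(V^* )/I_+$ be the coinvariant ring, where $I_+$ is the ideal generated by homogeneous $G$-invariants of positive degree, and let $\mathbb{C}[V]_G^j$ be its degree $j$ component. For an $m$-dimensional $G$-module $M$, the fake degrees $e_1^G(M),\dots,e_m^G(M)$ are the nonnegative integers (with multiplicity) defined by $\sum_j \dim\mathrm{Hom}_G(M,\mathbb{C}[V]_G^j)\,q^j=\sum_{i=1}^m q^{e_i^G(M)}$; equivalently, they are the degrees (in the $S(V^* )$ factor) of any set of homogeneous generators of $(S(V^* )\otimes M^* )^G$ as a free $S(V^* )^G$-module. The $e_i^N(V)$ are defined likewise with $N\subset \mathrm{GL}(V)$ in place of $G$, and the $e_i^H(E)$ likewise with $H$ acting on $E$ (using $S(E^* )$ with $E^*$ in degree $1$). The $e_i^G(E)$ are computed with $G\subset\mathrm{GL}(V)$ and the $G$-module $M=E$. *)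

theory Defs
  imports
    Complex_Main
    "HOL-Library.Function_Algebras"
    "HOL-Library.Multiset"
    "HOL-Library.Poly_Mapping"
    "HOL-Algebra.Coset"
    "HOL-Algebra.Generated_Groups"
begin

text \<open>
  A complex vector space is given by a scalar multiplication \<open>scale\<close> on a type together with
  a subspace \<open>W\<close> of that type as its carrier.  Functions on \<open>W\<close> are represented by functions on
  the whole type that vanish outside \<open>W\<close>.
\<close>

definition fscale :: "complex \<Rightarrow> ('x \<Rightarrow> complex) \<Rightarrow> 'x \<Rightarrow> complex" where
  "fscale c f = (\<lambda>x. c * f x)"

lemma vector_space_fscale: "vector_space (fscale :: complex \<Rightarrow> ('x \<Rightarrow> complex) \<Rightarrow> _)"
  by unfold_locales (auto simp: fscale_def fun_eq_iff algebra_simps)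

abbreviation fspan :: "('x \<Rightarrow> complex) set \<Rightarrow> ('x \<Rightarrow> complex) set" where
  "fspan \<equiv> Modules.module.span fscale"

definition dual_space ::
    "(complex \<Rightarrow> 'a::ab_group_add \<Rightarrow> 'a) \<Rightarrow> 'a set \<Rightarrow> ('a \<Rightarrow> complex) set" where
  "dual_space scale W = {l. (\<forall>x\<in>W. \<forall>y\<in>W. l (x + y) = l x + l y) \<and>
     (\<forall>c. \<forall>x\<in>W. l (scale c x) = c * l x) \<and> (\<forall>x. x \<notin> W \<longrightarrow> l x = 0)}"


section \<open>Polynomial functions\<close>

text \<open>The component of degree \<open>d\<close> of $S(W^*)$: the span of the products of \<open>d\<close> linear forms.\<close>

definition sym_power ::
    "(complex \<Rightarrow> 'a::ab_group_add \<Rightarrow> 'a) \<Rightarrow> 'a set \<Rightarrow> nat \<Rightarrow> ('a \<Rightarrow> complex) set" where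
  "sym_power scale W d = fspan {\<lambda>x. if x \<in> W then \<Prod>i<d. l i x else 0 | l :: nat \<Rightarrow> 'a \<Rightarrow> complex.
     \<forall>i<d. l i \<in> dual_space scale W}"

definition sym_algebra ::
    "(complex \<Rightarrow> 'a::ab_group_add \<Rightarrow> 'a) \<Rightarrow> 'a set \<Rightarrow> ('a \<Rightarrow> complex) set" where
  "sym_algebra scale W = fspan (\<Union>d. sym_power scale W d)"

text \<open>
  Polynomials in indeterminates indexed by natural numbers: the monomial \<open>m\<close> has exponent
  \<open>lookup m i\<close> at the indeterminate \<open>i\<close>.
\<close>

type_synonym mpoly = "(nat \<Rightarrow>\<^sub>0 nat) \<Rightarrow>\<^sub>0 complex"

definition mpolys :: "nat \<Rightarrow> mpoly set" where
  "mpolys n = {p. \<forall>m\<in>Poly_Mapping.keys p. Poly_Mapping.keys m \<subseteq> {..<n}}"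

definition poly_subst :: "'a set \<Rightarrow> ('a \<Rightarrow> complex) list \<Rightarrow> mpoly \<Rightarrow> 'a \<Rightarrow> complex" where
  "poly_subst W fs p =
     (\<lambda>x. if x \<in> W
          then \<Sum>m\<in>Poly_Mapping.keys p. Poly_Mapping.lookup p m *
                 (\<Prod>i\<in>Poly_Mapping.keys m. (fs ! i) x ^ Poly_Mapping.lookup m i)
          else 0)"

definition alg_independent :: "'a set \<Rightarrow> ('a \<Rightarrow> complex) list \<Rightarrow> bool" where
  "alg_independent W fs \<longleftrightarrow> (\<forall>p\<in>mpolys (length fs). poly_subst W fs p = 0 \<longrightarrow> p = 0)"


section \<open>Group actions and invariants\<close>

text \<open>
  The group \<open>K\<close> acts on \<open>W\<close> by \<open>act\<close>, hence on functions on \<open>W\<close> by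
  $(k \cdot f)(x) = f(k^{-1} x)$.
\<close>

definition fun_act ::
    "('g, 'b) monoid_scheme \<Rightarrow> ('g \<Rightarrow> 'a \<Rightarrow> 'a) \<Rightarrow> 'a set \<Rightarrow>
     'g \<Rightarrow> ('a \<Rightarrow> complex) \<Rightarrow> 'a \<Rightarrow> complex" where
  "fun_act K act W k f = (\<lambda>x. if x \<in> W then f (act (inv\<^bsub>K\<^esub> k) x) else 0)"

definition invariants ::
    "(complex \<Rightarrow> 'a::ab_group_add \<Rightarrow> 'a) \<Rightarrow> 'a set \<Rightarrow> ('g, 'b) monoid_scheme \<Rightarrow>
     ('g \<Rightarrow> 'a \<Rightarrow> 'a) \<Rightarrow> ('a \<Rightarrow> complex) set" where
  "invariants scale W K act =
     {f \<in> sym_algebra scale W. \<forall>k\<in>carrier K. fun_act K act W k f = f}"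

definition fundamental_invariants ::
    "(complex \<Rightarrow> 'a::ab_group_add \<Rightarrow> 'a) \<Rightarrow> 'a set \<Rightarrow> ('g, 'b) monoid_scheme \<Rightarrow>
     ('g \<Rightarrow> 'a \<Rightarrow> 'a) \<Rightarrow> ('a \<Rightarrow> complex) list \<Rightarrow> nat list \<Rightarrow> bool" where
  "fundamental_invariants scale W K act fs ds \<longleftrightarrow>
     length fs = vector_space.dim scale W \<and> length ds = length fs \<and>
     (\<forall>i<length fs. fs ! i \<in> sym_power scale W (ds ! i)) \<and>
     alg_independent W fs \<and>
     invariants scale W K act = poly_subst W fs ` mpolys (length fs)"

definition degrees ::
    "(complex \<Rightarrow> 'a::ab_group_add \<Rightarrow> 'a) \<Rightarrow> 'a set \<Rightarrow> ('g, 'b) monoid_scheme \<Rightarrow>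
     ('g \<Rightarrow> 'a \<Rightarrow> 'a) \<Rightarrow> nat multiset" where
  "degrees scale W K act =
     (THE D. \<exists>fs ds. fundamental_invariants scale W K act fs ds \<and> D = mset ds)"


section \<open>Coinvariants and fake degrees\<close>

definition coinv_ideal ::
    "(complex \<Rightarrow> 'a::ab_group_add \<Rightarrow> 'a) \<Rightarrow> 'a set \<Rightarrow> ('g, 'b) monoid_scheme \<Rightarrow>
     ('g \<Rightarrow> 'a \<Rightarrow> 'a) \<Rightarrow> ('a \<Rightarrow> complex) set" where
  "coinv_ideal scale W K act = fspan {f * h | f h d.
     f \<in> sym_algebra scale W \<and> d > 0 \<and> h \<in> invariants scale W K act \<inter> sym_power scale W d}"

text \<open>Elements of the component of degree \<open>j\<close> of $S(W^*)/I_+$ are sets of polynomial functions.\<close>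

definition coinv ::
    "(complex \<Rightarrow> 'a::ab_group_add \<Rightarrow> 'a) \<Rightarrow> 'a set \<Rightarrow> ('g, 'b) monoid_scheme \<Rightarrow>
     ('g \<Rightarrow> 'a \<Rightarrow> 'a) \<Rightarrow> nat \<Rightarrow> ('a \<Rightarrow> complex) set set" where
  "coinv scale W K act j = sym_power scale W j //
     {(f, h). f \<in> sym_power scale W j \<and> h \<in> sym_power scale W j \<and>
              h - f \<in> coinv_ideal scale W K act}"

text \<open>
  $\mathrm{Hom}_K(M, \mathbb{C}[W]_K^j)$.  The operations of the quotient are expressed on
  representatives: since distinct classes are disjoint, \<open>f + f' \<in> \<Phi> (m + m')\<close> says that the class
  \<open>\<Phi> (m + m')\<close> is the sum of the classes \<open>\<Phi> m\<close> of \<open>f\<close> and \<open>\<Phi> m'\<close> of \<open>f'\<close>, and similarly for scalar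
  multiples and for the action of \<open>K\<close>.
\<close>

definition coinv_homs ::
    "(complex \<Rightarrow> 'a::ab_group_add \<Rightarrow> 'a) \<Rightarrow> 'a set \<Rightarrow> ('g, 'b) monoid_scheme \<Rightarrow>
     ('g \<Rightarrow> 'a \<Rightarrow> 'a) \<Rightarrow> (complex \<Rightarrow> 'm::ab_group_add \<Rightarrow> 'm) \<Rightarrow> 'm set \<Rightarrow> ('g \<Rightarrow> 'm \<Rightarrow> 'm) \<Rightarrow>
     nat \<Rightarrow> ('m \<Rightarrow> ('a \<Rightarrow> complex) set) set" where
  "coinv_homs scale W K act scaleM M actM j = {\<Phi>.
     (\<forall>m\<in>M. \<Phi> m \<in> coinv scale W K act j) \<and> (\<forall>m. m \<notin> M \<longrightarrow> \<Phi> m = {}) \<and>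
     (\<forall>m\<in>M. \<forall>m'\<in>M. \<forall>f\<in>\<Phi> m. \<forall>f'\<in>\<Phi> m'. f + f' \<in> \<Phi> (m + m')) \<and>
     (\<forall>c. \<forall>m\<in>M. \<forall>f\<in>\<Phi> m. fscale c f \<in> \<Phi> (scaleM c m)) \<and>
     (\<forall>k\<in>carrier K. \<forall>m\<in>M. \<forall>f\<in>\<Phi> m. fun_act K act W k f \<in> \<Phi> (actM k m))}"

text \<open>
  \<open>\<Phi>s\<close> is a basis of that space: every \<open>\<Phi>\<close> is a linear combination of \<open>\<Phi>s\<close> with unique
  coefficients \<open>cs\<close>, the equation being again expressed on representatives.
\<close>

definition coinv_homs_basis ::
    "(complex \<Rightarrow> 'a::ab_group_add \<Rightarrow> 'a) \<Rightarrow> 'a set \<Rightarrow> ('g, 'b) monoid_scheme \<Rightarrow>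
     ('g \<Rightarrow> 'a \<Rightarrow> 'a) \<Rightarrow> (complex \<Rightarrow> 'm::ab_group_add \<Rightarrow> 'm) \<Rightarrow> 'm set \<Rightarrow> ('g \<Rightarrow> 'm \<Rightarrow> 'm) \<Rightarrow>
     nat \<Rightarrow> ('m \<Rightarrow> ('a \<Rightarrow> complex) set) list \<Rightarrow> bool" where
  "coinv_homs_basis scale W K act scaleM M actM j \<Phi>s \<longleftrightarrow>
     set \<Phi>s \<subseteq> coinv_homs scale W K act scaleM M actM j \<and>
     (\<forall>\<Phi>\<in>coinv_homs scale W K act scaleM M actM j.
        \<exists>!cs. length cs = length \<Phi>s \<and>
          (\<forall>m\<in>M. \<forall>fs. length fs = length \<Phi>s \<and> (\<forall>i<length \<Phi>s. fs ! i \<in> (\<Phi>s ! i) m) \<longrightarrow>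
             (\<Sum>i<length \<Phi>s. fscale (cs ! i) (fs ! i)) \<in> \<Phi> m))"

definition coinv_mult ::
    "(complex \<Rightarrow> 'a::ab_group_add \<Rightarrow> 'a) \<Rightarrow> 'a set \<Rightarrow> ('g, 'b) monoid_scheme \<Rightarrow>
     ('g \<Rightarrow> 'a \<Rightarrow> 'a) \<Rightarrow> (complex \<Rightarrow> 'm::ab_group_add \<Rightarrow> 'm) \<Rightarrow> 'm set \<Rightarrow> ('g \<Rightarrow> 'm \<Rightarrow> 'm) \<Rightarrow>
     nat \<Rightarrow> nat" where
  "coinv_mult scale W K act scaleM M actM j =
     (THE n. \<exists>\<Phi>s. coinv_homs_basis scale W K act scaleM M actM j \<Phi>s \<and> length \<Phi>s = n)"

definition fake_degrees ::
    "(complex \<Rightarrow> 'a::ab_group_add \<Rightarrow> 'a) \<Rightarrow> 'a set \<Rightarrow> ('g, 'b) monoid_scheme \<Rightarrow>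
     ('g \<Rightarrow> 'a \<Rightarrow> 'a) \<Rightarrow> (complex \<Rightarrow> 'm::ab_group_add \<Rightarrow> 'm) \<Rightarrow> 'm set \<Rightarrow> ('g \<Rightarrow> 'm \<Rightarrow> 'm) \<Rightarrow>
     nat multiset" where
  "fake_degrees scale W K act scaleM M actM =
     (THE D. \<forall>j. count D j = coinv_mult scale W K act scaleM M actM j)"


section \<open>Complex reflection groups\<close>

definition GL :: "(complex \<Rightarrow> 'v::ab_group_add \<Rightarrow> 'v) \<Rightarrow> ('v \<Rightarrow> 'v) monoid" where
  "GL scale = \<lparr>carrier = {g. Vector_Spaces.linear scale scale g \<and> bij g}, mult = (\<circ>), one = id\<rparr>"

abbreviation GLsub ::
    "(complex \<Rightarrow> 'v::ab_group_add \<Rightarrow> 'v) \<Rightarrow> ('v \<Rightarrow> 'v) set \<Rightarrow> ('v \<Rightarrow> 'v) monoid" where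
  "GLsub scale G \<equiv> (GL scale)\<lparr>carrier := G\<rparr>"

text \<open>The identity counts as a reflection.\<close>

definition reflections :: "(complex \<Rightarrow> 'v::ab_group_add \<Rightarrow> 'v) \<Rightarrow> ('v \<Rightarrow> 'v) set" where
  "reflections scale = {g \<in> carrier (GL scale). \<exists>U. Modules.module.subspace scale U \<and>
     vector_space.dim scale U + 1 = vector_space.dim scale (UNIV :: 'v set) \<and> (\<forall>u\<in>U. g u = u)}"

definition generated_by_reflections ::
    "(complex \<Rightarrow> 'v::ab_group_add \<Rightarrow> 'v) \<Rightarrow> ('v \<Rightarrow> 'v) set \<Rightarrow> bool" where
  "generated_by_reflections scale G \<longleftrightarrow>
     (\<exists>R\<subseteq>reflections scale. G = generate (GL scale) R)"

definition complex_reflection_group ::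
    "(complex \<Rightarrow> 'v::ab_group_add \<Rightarrow> 'v) \<Rightarrow> ('v \<Rightarrow> 'v) set \<Rightarrow> bool" where
  "complex_reflection_group scale G \<longleftrightarrow>
     subgroup G (GL scale) \<and> finite G \<and> generated_by_reflections scale G"

definition normal_reflection_subgroup ::
    "(complex \<Rightarrow> 'v::ab_group_add \<Rightarrow> 'v) \<Rightarrow> ('v \<Rightarrow> 'v) set \<Rightarrow> ('v \<Rightarrow> 'v) set \<Rightarrow> bool" where
  "normal_reflection_subgroup scale N G \<longleftrightarrow>
     N \<lhd> GLsub scale G \<and> generated_by_reflections scale N"


section \<open>The quotient space\<close>

text \<open>
  A subspace \<open>Es\<close> of $S(V^*)$ spanned by fundamental invariants of \<open>N\<close> and stable under \<open>G\<close>.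
  It plays the role of $E^*$, and \<open>E = V / N\<close> is its dual.
\<close>

definition quotient_dual ::
    "(complex \<Rightarrow> 'v::ab_group_add \<Rightarrow> 'v) \<Rightarrow> ('v \<Rightarrow> 'v) set \<Rightarrow> ('v \<Rightarrow> 'v) set \<Rightarrow>
     ('v \<Rightarrow> complex) set \<Rightarrow> bool" where
  "quotient_dual scale G N Es \<longleftrightarrow>
     (\<exists>fs ds. fundamental_invariants scale UNIV (GLsub scale N) id fs ds \<and> Es = fspan (set fs)) \<and>
     (\<forall>g\<in>G. \<forall>f\<in>Es. fun_act (GLsub scale G) id UNIV g f \<in> Es)"

text \<open>The dual of the action of \<open>G\<close> on \<open>Es\<close>.\<close>

definition act_E ::
    "(complex \<Rightarrow> 'v::ab_group_add \<Rightarrow> 'v) \<Rightarrow> ('v \<Rightarrow> 'v) set \<Rightarrow> ('v \<Rightarrow> complex) set \<Rightarrow>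
     ('v \<Rightarrow> 'v) \<Rightarrow> (('v \<Rightarrow> complex) \<Rightarrow> complex) \<Rightarrow> ('v \<Rightarrow> complex) \<Rightarrow> complex" where
  "act_E scale G Es =
     fun_act (GLsub scale G) (fun_act (GLsub scale G) id UNIV) Es"

text \<open>
  All elements of a coset \<open>C\<close> of \<open>N\<close> act in the same way on \<open>E\<close>, since \<open>N\<close> acts trivially.
\<close>

definition act_E_coset ::
    "(complex \<Rightarrow> 'v::ab_group_add \<Rightarrow> 'v) \<Rightarrow> ('v \<Rightarrow> 'v) set \<Rightarrow> ('v \<Rightarrow> complex) set \<Rightarrow>
     ('v \<Rightarrow> 'v) set \<Rightarrow> (('v \<Rightarrow> complex) \<Rightarrow> complex) \<Rightarrow> ('v \<Rightarrow> complex) \<Rightarrow> complex" where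
  "act_E_coset scale G Es C \<phi> = the_elem ((\<lambda>g. act_E scale G Es g \<phi>) ` C)"

end

theory Submission
  imports Defs "HOL-Computational_Algebra.Polynomial"
begin

text \<open>
  Write $R = S(V^*)^G$ and $I$ for the ideal of $S(V^*)$ generated by $R_+$.  If a reflection $s$ has
  root $\alpha$, then $\alpha$ divides $sP - P$; by induction on the degree and averaging, every linear
  relation with coefficients in $S(V^*)$ between elements of $R$ comes from relations over $R$.  Hence
  equivariant maps from a module $M$ to $S(V^*)$ which are independent modulo $I$ are independent over
  $R$, and there are at most $\dim M$ of them.  Differentials of homogeneous invariants that are
  independent modulo $R_+^2$ are independent modulo $I$, by Euler's formula.  So $R$ is generated by at
  most $r$ invariants, they are algebraically independent, and the fake degrees of the reflection
  representation are the degrees minus one.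

  Let $B_d$ be the degree $d$ part of $E^*$.  If a reflection $s \in G$ acted nontrivially on $B_d$ and
  on $B_{d'}$, then $S(V^*)^N$ would contain two linear forms on $E$ divisible by the root of $s$,
  against the same flatness for $N$.  So $H$ is the product of its actions on the $B_d$, and the
  invariants of $G$ are generated by elements $F_i \in S^{k_i}(B_{\delta_i})$, of degree $k_i$ for $H$
  and $\delta_i k_i$ for $G$.  Counting differentials block by block shows that the $\delta_i$ are the
  degrees of $N$.  The differentials of the $F_i$ along $E$ have degree $\delta_i (k_i - 1)$ on $V$
  and give the fake degrees of $E$.
\<close>

interpretation fv: vector_space "fscale :: complex \<Rightarrow> ('x \<Rightarrow> complex) \<Rightarrow> 'x \<Rightarrow> complex"
  by (rule vector_space_fscale)

lemma fscale_apply: "fscale c f x = c * f x"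
  by (simp add: fscale_def)

lemma sum_fun_apply: "(\<Sum>i\<in>A. f i) x = (\<Sum>i\<in>A. f i x)"
  for f :: "'i \<Rightarrow> 'x \<Rightarrow> 'c::comm_monoid_add"
  by (induction A rule: infinite_finite_induct) auto

lemma prod_fun_apply: "(\<Prod>i\<in>A. f i) x = (\<Prod>i\<in>A. f i x)"
  for f :: "'i \<Rightarrow> 'x \<Rightarrow> 'c::comm_monoid_mult"
  by (induction A rule: infinite_finite_induct) auto

lemma power_fun_apply: "(f ^ n) x = f x ^ n" for f :: "'x \<Rightarrow> 'c::monoid_mult"
  by (induction n) auto

text \<open>Method \<open>induction\<close> eta-expands functions, so that the pointwise rules must not be applied by
  default.\<close>

declare plus_fun_apply [simp del] zero_fun_apply [simp del] times_fun_apply [simp del]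
  one_fun_apply [simp del] minus_apply [simp del] uminus_apply [simp del]

lemmas fun_ops = plus_fun_apply zero_fun_apply times_fun_apply one_fun_apply minus_apply uminus_apply
  fscale_apply sum_fun_apply prod_fun_apply power_fun_apply

lemma fscale_mult: "fscale c f * g = fscale c (f * g)" "f * fscale c g = fscale c (f * g)"
  by (auto simp: fun_eq_iff fun_ops)

lemma fspan_mult_closed:
  assumes "f \<in> fspan A" "g \<in> fspan B"
    and "\<And>a b. a \<in> A \<Longrightarrow> b \<in> B \<Longrightarrow> a * b \<in> fspan C"
  shows "f * g \<in> fspan C"
  using assms(1)
proof (induction rule: fv.span_induct_alt)
  case base
  then show ?case using fv.span_zero by simp
next
  case (step c a y)
  have "a * g \<in> fspan C"
    using assms(2)
  proof (induction rule: fv.span_induct_alt)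
    case base
    then show ?case using fv.span_zero by simp
  next
    case (step c b y)
    then show ?case
      using assms(3)[OF \<open>a \<in> A\<close> step(1)]
      by (simp add: distrib_left fscale_mult fv.span_add fv.span_scale)
  qed
  then show ?case using step(2)
    by (simp add: distrib_right fscale_mult fv.span_add fv.span_scale)
qed

section \<open>Linear systems over a domain of functions\<close>

text \<open>\<open>P\<close> is a subset of the type because functions have zero divisors while
  polynomial functions have none. The elimination is free of division: if unknown \<open>i\<close>
  has a nonzero coefficient in the last equation, the other equations are cross-multiplied by it,
  and a solution of the smaller system is multiplied by \<open>A i n\<close>, which keeps it nonzero
  in a domain.\<close>

lemma underdetermined_system:
  fixes A :: "'i \<Rightarrow> nat \<Rightarrow> 'c::comm_ring_1"
  assumes ring: "1 \<in> P" "\<And>a b. a \<in> P \<Longrightarrow> b \<in> P \<Longrightarrow> a + b \<in> P" "\<And>a. a \<in> P \<Longrightarrow> - a \<in> P"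
      "\<And>a b. a \<in> P \<Longrightarrow> b \<in> P \<Longrightarrow> a * b \<in> P"
    and dom: "\<And>a b. a \<in> P \<Longrightarrow> b \<in> P \<Longrightarrow> a * b = 0 \<Longrightarrow> a = 0 \<or> b = 0"
    and "finite J" "card J > n" "\<And>j k. j \<in> J \<Longrightarrow> k < n \<Longrightarrow> A j k \<in> P"
  shows "\<exists>p. (\<forall>j\<in>J. p j \<in> P) \<and> (\<exists>j\<in>J. p j \<noteq> 0) \<and> (\<forall>k<n. (\<Sum>j\<in>J. p j * A j k) = 0)"
  using assms(6-8)
proof (induction n arbitrary: J A)
  case 0
  then have "J \<noteq> {}" by auto
  then show ?case using ring(1) by (intro exI[of _ "\<lambda>_. 1"]) auto
next
  case (Suc n)
  have zero: "0 \<in> P" using ring(1,3) ring(2)[of 1 "-1"] by simp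
  show ?case
  proof (cases "\<forall>j\<in>J. A j n = 0")
    case True
    have "\<exists>p. (\<forall>j\<in>J. p j \<in> P) \<and> (\<exists>j\<in>J. p j \<noteq> 0) \<and> (\<forall>k<n. (\<Sum>j\<in>J. p j * A j k) = 0)"
      using Suc.prems by (intro Suc.IH) auto
    then obtain p where p: "\<forall>j\<in>J. p j \<in> P" "\<exists>j\<in>J. p j \<noteq> 0" "\<forall>k<n. (\<Sum>j\<in>J. p j * A j k) = 0"
      by blast
    have "(\<Sum>j\<in>J. p j * A j k) = 0" if "k < Suc n" for k
      using p(3) True that by (cases "k = n") auto
    with p(1,2) show ?thesis by blast
  next
    case False
    then obtain i where i: "i \<in> J" "A i n \<noteq> 0" by blast
    define J' where "J' = J - {i}"
    have J': "finite J'" "card J' > n" "J = insert i J'" "i \<notin> J'"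
      using Suc.prems i by (auto simp: J'_def)
    define B where "B j k = A i n * A j k + - (A j n * A i k)" for j k
    have "\<exists>p. (\<forall>j\<in>J'. p j \<in> P) \<and> (\<exists>j\<in>J'. p j \<noteq> 0) \<and> (\<forall>k<n. (\<Sum>j\<in>J'. p j * B j k) = 0)"
    proof (intro Suc.IH)
      fix j k assume "j \<in> J'" "k < n"
      then have "A i n * A j k \<in> P" "- (A j n * A i k) \<in> P"
        using J' Suc.prems(3) i by (auto intro!: ring(3,4))
      then show "B j k \<in> P" unfolding B_def by (rule ring(2))
    qed (use J' in auto)
    then obtain p where p: "\<And>j. j \<in> J' \<Longrightarrow> p j \<in> P" "\<exists>j\<in>J'. p j \<noteq> 0"
        "\<And>k. k < n \<Longrightarrow> (\<Sum>j\<in>J'. p j * B j k) = 0"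
      by blast
    define s where "s = (\<Sum>j\<in>J'. p j * A j n)"
    have sumP: "finite F \<Longrightarrow> (\<And>j. j \<in> F \<Longrightarrow> h j \<in> P) \<Longrightarrow> sum h F \<in> P" for F and h :: "'i \<Rightarrow> 'c"
      by (induction F rule: finite_induct) (use zero ring(2) in auto)
    have sP: "s \<in> P"
      unfolding s_def using J' Suc.prems(3) ring p(1) by (intro sumP) auto
    define q where "q j = (if j = i then - s else A i n * p j)" for j
    have "(\<Sum>j\<in>J. q j * A j k) = 0" if "k < Suc n" for k
    proof -
      have "(\<Sum>j\<in>J. q j * A j k) = - s * A i k + (\<Sum>j\<in>J'. q j * A j k)"
        using J' by (simp add: q_def)
      also have "(\<Sum>j\<in>J'. q j * A j k) = (\<Sum>j\<in>J'. A i n * p j * A j k)"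
        using J' by (intro sum.cong) (auto simp: q_def)
      also have "- s * A i k + \<dots> = (\<Sum>j\<in>J'. p j * B j k)"
        by (simp add: s_def B_def sum_distrib_left sum_distrib_right sum_negf[symmetric]
            sum.distrib[symmetric] algebra_simps)
      also have "\<dots> = 0"
      proof (cases "k = n")
        case True
        then show ?thesis by (simp add: B_def mult.commute)
      next
        case False
        then show ?thesis using p(3) that by simp
      qed
      finally show ?thesis .
    qed
    moreover have "\<exists>j\<in>J. q j \<noteq> 0"
    proof -
      obtain j where "j \<in> J'" "p j \<noteq> 0" using p(2) by blast
      then have "A i n * p j \<noteq> 0" using dom[of "A i n" "p j"] i Suc.prems(3) p(1) by auto
      then show ?thesis using \<open>j \<in> J'\<close> J' by (auto simp: q_def)
    qed
    moreover have "\<forall>j\<in>J. q j \<in> P"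
      using J' sP p(1) ring i Suc.prems(3) by (auto simp: q_def)
    ultimately show ?thesis by blast
  qed
qed

section \<open>Polynomial functions\<close>

text \<open>Carrier, basis and dual coordinates are explicit so that the same results serve V, whose
  carrier is \<open>UNIV\<close>, and E^* and E, whose carriers are subspaces of function
  types.\<close>

locale polyspace = vector_space scale
  for scale :: "complex \<Rightarrow> 'a::ab_group_add \<Rightarrow> 'a" +
  fixes W :: "'a set" and r :: nat and b :: "nat \<Rightarrow> 'a" and x :: "nat \<Rightarrow> 'a \<Rightarrow> complex"
  assumes subspace_W: "subspace W"
    and b_in: "k < r \<Longrightarrow> b k \<in> W"
    and x_dual: "k < r \<Longrightarrow> x k \<in> dual_space scale W"
    and x_b: "k < r \<Longrightarrow> l < r \<Longrightarrow> x k (b l) = (if k = l then 1 else 0)"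
    and expand: "w \<in> W \<Longrightarrow> (\<Sum>k<r. scale (x k w) (b k)) = w"
begin

abbreviation "DS \<equiv> dual_space scale W"
abbreviation "Sd \<equiv> sym_power scale W"
abbreviation "S \<equiv> sym_algebra scale W"

definition cst :: "complex \<Rightarrow> 'a \<Rightarrow> complex" where
  "cst c = (\<lambda>w. if w \<in> W then c else 0)"

definition lin_prod :: "(nat \<Rightarrow> 'a \<Rightarrow> complex) \<Rightarrow> nat \<Rightarrow> 'a \<Rightarrow> complex" where
  "lin_prod l d = (\<lambda>w. if w \<in> W then \<Prod>i<d. l i w else 0)"

lemma W_zero [simp]: "0 \<in> W" and W_add: "v \<in> W \<Longrightarrow> w \<in> W \<Longrightarrow> v + w \<in> W"
  and W_scale: "w \<in> W \<Longrightarrow> scale c w \<in> W"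
  using subspace_W by (auto simp: subspace_0 subspace_add subspace_scale)

lemma DS_0 [simp]: "l \<in> DS \<Longrightarrow> l 0 = 0"
proof -
  assume "l \<in> DS"
  then have "l (scale 0 0) = 0 * l 0" unfolding dual_space_def using W_zero by blast
  then show ?thesis by simp
qed

lemma DS_add: "l \<in> DS \<Longrightarrow> v \<in> W \<Longrightarrow> w \<in> W \<Longrightarrow> l (v + w) = l v + l w"
  and DS_scale: "l \<in> DS \<Longrightarrow> w \<in> W \<Longrightarrow> l (scale c w) = c * l w"
  and DS_outside: "l \<in> DS \<Longrightarrow> w \<notin> W \<Longrightarrow> l w = 0"
  by (auto simp: dual_space_def)

lemma DS_sum: "l \<in> DS \<Longrightarrow> (\<And>i. i \<in> A \<Longrightarrow> v i \<in> W) \<Longrightarrow>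
    l (\<Sum>i\<in>A. scale (c i) (v i)) = (\<Sum>i\<in>A. c i * l (v i))"
proof (induction A rule: infinite_finite_induct)
  case (insert i A)
  have "(\<Sum>i\<in>A. scale (c i) (v i)) \<in> W"
    using insert subspace_W by (intro subspace_sum) (auto simp: subspace_scale)
  with insert show ?case by (simp add: DS_add DS_scale W_scale)
qed auto

lemma DS_expand: "l \<in> DS \<Longrightarrow> l = (\<Sum>k<r. fscale (l (b k)) (x k))"
proof
  fix w assume l: "l \<in> DS"
  show "l w = (\<Sum>k<r. fscale (l (b k)) (x k)) w"
  proof (cases "w \<in> W")
    case True
    have "l w = l (\<Sum>k<r. scale (x k w) (b k))" using expand[OF True] by simp
    also have "\<dots> = (\<Sum>k<r. x k w * l (b k))" using l b_in by (intro DS_sum) auto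
    finally show ?thesis by (simp add: fun_ops mult.commute)
  next
    case False
    then show ?thesis using l x_dual by (auto simp: fun_ops DS_outside intro!: sum.neutral[symmetric])
  qed
qed

lemma DS_subspace: "fv.subspace DS"
  by (rule fv.subspaceI) (auto simp: dual_space_def fun_ops algebra_simps)

lemma sym_power_eq: "Sd d = fspan {lin_prod l d | l. \<forall>i<d. l i \<in> DS}"
  unfolding sym_power_def lin_prod_def by metis

lemma lin_prod_0: "lin_prod l 0 = cst 1"
  by (auto simp: lin_prod_def cst_def)

lemma lin_prod_Suc: "l d \<in> DS \<Longrightarrow> lin_prod l (Suc d) = lin_prod l d * l d"
  by (auto simp: lin_prod_def fun_eq_iff fun_ops DS_outside)

lemma Sd_add: "f \<in> Sd d \<Longrightarrow> g \<in> Sd d \<Longrightarrow> f + g \<in> Sd d"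
  and Sd_scale: "f \<in> Sd d \<Longrightarrow> fscale c f \<in> Sd d"
  and Sd_zero [simp]: "0 \<in> Sd d"
  by (auto simp: sym_power_eq fv.span_add fv.span_scale fv.span_zero)

lemma Sd_subspace: "fv.subspace (Sd d)"
  by (simp add: sym_power_eq)

lemma lin_prod_in: "(\<And>i. i < d \<Longrightarrow> l i \<in> DS) \<Longrightarrow> lin_prod l d \<in> Sd d"
  unfolding sym_power_eq by (rule fv.span_base) auto

lemma cst_in: "cst c \<in> Sd 0"
proof -
  have "cst c = fscale c (lin_prod (\<lambda>_. 0) 0)" by (auto simp: lin_prod_0 cst_def fun_eq_iff fun_ops)
  then show ?thesis using lin_prod_in[of 0] Sd_scale by simp
qed

lemma Sd_mult_DS: "f \<in> Sd d \<Longrightarrow> l \<in> DS \<Longrightarrow> f * l \<in> Sd (Suc d)"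
proof -
  assume f: "f \<in> Sd d" and l: "l \<in> DS"
  show ?thesis
    unfolding sym_power_eq[of "Suc d"]
  proof (rule fspan_mult_closed[OF f[unfolded sym_power_eq] fv.span_base[of l "{l}"]])
    fix a b' assume "a \<in> {lin_prod l d |l. \<forall>i<d. l i \<in> DS}" "b' \<in> {l}"
    then obtain k where k: "a = lin_prod k d" "\<forall>i<d. k i \<in> DS" "b' = l" by auto
    define k' where "k' i = (if i < d then k i else l)" for i
    have "a * b' = lin_prod k' (Suc d)"
      using l k by (simp add: lin_prod_Suc k'_def) (simp add: lin_prod_def k'_def fun_eq_iff fun_ops)
    moreover have "lin_prod k' (Suc d) \<in> fspan {lin_prod l (Suc d) |l. \<forall>i<Suc d. l i \<in> DS}"
      by (rule fv.span_base) (use k l in \<open>auto simp: k'_def\<close>)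
    ultimately show "a * b' \<in> fspan {lin_prod l (Suc d) |l. \<forall>i<Suc d. l i \<in> DS}" by simp
  qed auto
qed

text \<open>The predicate takes the degree as an argument because multiplication by a linear form
  raises it; formulas such as Euler's are then proved one linear factor at a time.\<close>

lemma Sd_induct [consumes 1, case_names one mult add scale]:
  assumes "f \<in> Sd d"
    and one: "P 0 (cst 1)"
    and mult: "\<And>d f l. f \<in> Sd d \<Longrightarrow> P d f \<Longrightarrow> l \<in> DS \<Longrightarrow> P (Suc d) (f * l)"
    and add: "\<And>d f g. f \<in> Sd d \<Longrightarrow> g \<in> Sd d \<Longrightarrow> P d f \<Longrightarrow> P d g \<Longrightarrow> P d (f + g)"
    and scale: "\<And>d f c. f \<in> Sd d \<Longrightarrow> P d f \<Longrightarrow> P d (fscale c f)"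
  shows "P d f"
proof -
  have gen: "P d (lin_prod l d)" if "\<forall>i<d. l i \<in> DS" for l d
    using that
  proof (induction d)
    case 0
    then show ?case using one by (simp add: lin_prod_0)
  next
    case (Suc d)
    then show ?case using mult[of "lin_prod l d" d "l d"] by (simp add: lin_prod_Suc lin_prod_in)
  qed
  have zero: "P d 0"
    using scale[OF lin_prod_in gen, of d "\<lambda>_. 0" 0] DS_subspace[THEN fv.subspace_0] by simp
  from assms(1) have "f \<in> Sd d \<and> P d f"
    unfolding sym_power_eq[of d]
  proof (induction rule: fv.span_induct_alt)
    case base
    then show ?case using zero fv.span_zero by simp
  next
    case (step c f g)
    then obtain l where l: "f = lin_prod l d" "\<forall>i<d. l i \<in> DS" by auto
    then have "P d (fscale c f + g)"
      using step by (intro add scale gen) (auto simp: sym_power_eq[symmetric] Sd_scale lin_prod_in gen)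
    moreover have "fscale c f + g \<in> fspan {lin_prod l d |l. \<forall>i<d. l i \<in> DS}"
      using step by (intro fv.span_add fv.span_scale fv.span_base[of f]) auto
    ultimately show ?case by simp
  qed
  then show ?thesis by simp
qed

lemma Sd_outside: "f \<in> Sd d \<Longrightarrow> w \<notin> W \<Longrightarrow> f w = 0"
  by (induction rule: Sd_induct) (auto simp: fun_ops cst_def)

lemma cst_mult: "f \<in> Sd d \<Longrightarrow> cst c * f = fscale c f"
  using Sd_outside by (auto simp: cst_def fun_eq_iff fun_ops)

lemma Sd_homogeneous: "f \<in> Sd d \<Longrightarrow> w \<in> W \<Longrightarrow> f (scale t w) = t ^ d * f w"
  by (induction rule: Sd_induct) (auto simp: fun_ops cst_def W_scale DS_scale algebra_simps)

lemma Sd_mult: "f \<in> Sd d \<Longrightarrow> g \<in> Sd e \<Longrightarrow> f * g \<in> Sd (d + e)"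
proof -
  assume f: "f \<in> Sd d" and g: "g \<in> Sd e"
  show ?thesis using g
  proof (induction rule: Sd_induct)
    case one
    then show ?case using cst_mult[OF f] f by (simp add: mult.commute)
  next
    case (mult d f l)
    then show ?case by (simp add: mult.assoc[symmetric] Sd_mult_DS)
  qed (auto simp: distrib_left Sd_add Sd_scale fscale_mult)
qed

lemma Sd_0_iff: "f \<in> Sd 0 \<longleftrightarrow> (\<exists>c. f = cst c)"
proof
  have "f \<in> Sd d \<Longrightarrow> d = 0 \<longrightarrow> (\<exists>c. f = cst c)" for d
  proof (induction rule: Sd_induct)
    case (add d f g)
    have "cst c + cst e = cst (c + e)" for c e by (auto simp: cst_def fun_eq_iff fun_ops)
    then show ?case using add by metis
  next
    case (scale d f c)
    have "fscale c (cst e) = cst (c * e)" for c e by (auto simp: cst_def fun_eq_iff fun_ops)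
    then show ?case using scale by metis
  qed auto
  then show "f \<in> Sd 0 \<Longrightarrow> \<exists>c. f = cst c" by blast
qed (use cst_in in auto)

lemma DS_in_Sd: "l \<in> DS \<Longrightarrow> l \<in> Sd 1"
proof -
  assume l: "l \<in> DS"
  have "cst 1 * l = l" using l DS_outside by (auto simp: cst_def fun_eq_iff fun_ops)
  then show ?thesis using Sd_mult_DS[OF cst_in l, of 1] by simp
qed

subsection \<open>The algebra of polynomial functions\<close>

lemma Sd_in_S: "f \<in> Sd d \<Longrightarrow> f \<in> S"
  unfolding sym_algebra_def by (rule fv.span_base) auto

lemma S_add: "f \<in> S \<Longrightarrow> g \<in> S \<Longrightarrow> f + g \<in> S"
  and S_scale: "f \<in> S \<Longrightarrow> fscale c f \<in> S"
  and S_zero [simp]: "0 \<in> S"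
  and S_diff: "f \<in> S \<Longrightarrow> g \<in> S \<Longrightarrow> f - g \<in> S"
  and S_neg: "f \<in> S \<Longrightarrow> - f \<in> S"
  and S_subspace: "fv.subspace S"
  by (auto simp: sym_algebra_def fv.span_add fv.span_scale fv.span_zero fv.span_diff fv.span_neg)

lemma S_sum: "(\<And>i. i \<in> A \<Longrightarrow> f i \<in> S) \<Longrightarrow> (\<Sum>i\<in>A. f i) \<in> S"
  by (auto intro: fv.subspace_sum[OF S_subspace])

lemma S_induct [consumes 1, case_names Sd add]:
  assumes "f \<in> S" "\<And>d f. f \<in> Sd d \<Longrightarrow> P f"
    "\<And>f g. f \<in> S \<Longrightarrow> g \<in> S \<Longrightarrow> P f \<Longrightarrow> P g \<Longrightarrow> P (f + g)"
  shows "P f"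
proof -
  from assms(1) have "f \<in> S \<and> P f"
    unfolding sym_algebra_def
  proof (induction rule: fv.span_induct_alt)
    case base
    then show ?case using assms(2)[OF Sd_zero] fv.span_zero by auto
  next
    case (step c f g)
    then obtain d where "fscale c f \<in> Sd d" using Sd_scale by blast
    then show ?case using step assms(2,3) Sd_in_S S_add by (auto simp: sym_algebra_def[symmetric])
  qed
  then show ?thesis by simp
qed

lemma S_mult: "f \<in> S \<Longrightarrow> g \<in> S \<Longrightarrow> f * g \<in> S"
proof (induction rule: S_induct)
  case (Sd d f)
  from this(2) show ?case
  proof (induction rule: S_induct)
    case (Sd e g)
    then show ?case using Sd_mult[OF \<open>f \<in> Sd d\<close>] Sd_in_S by blast
  qed (simp add: distrib_left S_add)
qed (simp add: distrib_right S_add)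

lemma S_outside: "f \<in> S \<Longrightarrow> w \<notin> W \<Longrightarrow> f w = 0"
  by (induction rule: S_induct) (auto simp: fun_ops Sd_outside)

lemma cst_in_S: "cst c \<in> S" and DS_in_S: "l \<in> DS \<Longrightarrow> l \<in> S"
  using cst_in DS_in_Sd Sd_in_S by blast+

lemma S_cst_mult: "f \<in> S \<Longrightarrow> cst c * f = fscale c f" "f \<in> S \<Longrightarrow> f * cst c = fscale c f"
  using S_outside by (auto simp: cst_def fun_eq_iff fun_ops)

lemma S_subalgebra_induct [consumes 1, case_names cst lin add mult]:
  assumes "f \<in> S" "\<And>c. P (cst c)" "\<And>l. l \<in> DS \<Longrightarrow> P l"
    "\<And>f g. f \<in> S \<Longrightarrow> g \<in> S \<Longrightarrow> P f \<Longrightarrow> P g \<Longrightarrow> P (f + g)"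
    "\<And>f g. f \<in> S \<Longrightarrow> g \<in> S \<Longrightarrow> P f \<Longrightarrow> P g \<Longrightarrow> P (f * g)"
  shows "P f"
  using assms(1)
proof (induction rule: S_induct)
  case (Sd d f)
  then show ?case
  proof (induction rule: Sd_induct)
    case (scale d f c)
    then show ?case using assms(5)[OF cst_in_S _ assms(2), of f c] cst_mult Sd_in_S by metis
  qed (use assms Sd_in_S DS_in_S in blast)+
qed (use assms in blast)

lemma S_decomp: "f \<in> S \<Longrightarrow> \<exists>g n. (\<forall>d. g d \<in> Sd d) \<and> f = (\<Sum>d<n. g d)"
proof (induction rule: S_induct)
  case (Sd d f)
  have "(\<forall>e. (if e = d then f else 0) \<in> Sd e) \<and> f = (\<Sum>e<Suc d. (if e = d then f else 0))"
    using Sd by auto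
  then show ?case by fast
next
  case (add f f')
  then obtain g n g' n' where g: "\<forall>d. g d \<in> Sd d" "f = (\<Sum>d<n. g d)"
    and g': "\<forall>d. g' d \<in> Sd d" "f' = (\<Sum>d<n'. g' d)" by blast
  define h where "h d = (if d < n then g d else 0) + (if d < n' then g' d else 0)" for d
  have "(\<Sum>d<max n n'. (if d < n then g d else 0)) = (\<Sum>d<n. g d)"
    by (rule sum.mono_neutral_cong_right) auto
  moreover have "(\<Sum>d<max n n'. (if d < n' then g' d else 0)) = (\<Sum>d<n'. g' d)"
    by (rule sum.mono_neutral_cong_right) auto
  ultimately have "f + f' = (\<Sum>d<max n n'. h d)"
    unfolding h_def sum.distrib g(2) g'(2) by simp
  moreover have "\<forall>d. h d \<in> Sd d" using g g' by (auto simp: h_def Sd_add)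
  ultimately show ?case by blast
qed

subsection \<open>Restriction to lines, derivations and homogeneous components\<close>

text \<open>Restriction to lines reduces several variables to one: \<open>D\<close> is the linear
  coefficient of this polynomial, \<open>hc\<close> consists of its coefficients on lines through 0,
  and the absence of zero divisors is inherited from it. A complex polynomial is determined by its
  values, which justifies \<open>THE\<close>.\<close>

definition line_poly :: "('a \<Rightarrow> complex) \<Rightarrow> 'a \<Rightarrow> 'a \<Rightarrow> complex poly" where
  "line_poly f u v = (THE p. \<forall>t. poly p t = f (u + scale t v))"

lemma line_poly_eqI: "(\<And>t. poly p t = f (u + scale t v)) \<Longrightarrow> line_poly f u v = p"
  unfolding line_poly_def by (rule the_equality) (auto simp: poly_eq_poly_eq_iff[symmetric])

lemma line_poly_ex: "f \<in> S \<Longrightarrow> u \<in> W \<Longrightarrow> v \<in> W \<Longrightarrow> \<exists>p. \<forall>t. poly p t = f (u + scale t v)"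
proof (induction rule: S_subalgebra_induct)
  case (cst c)
  then show ?case by (intro exI[of _ "[:c:]"]) (auto simp: cst_def W_add W_scale)
next
  case (lin l)
  then show ?case by (intro exI[of _ "[:l u, l v:]"]) (auto simp: DS_add DS_scale W_scale)
next
  case (add f g)
  then obtain p q where "\<forall>t. poly p t = f (u + scale t v)" "\<forall>t. poly q t = g (u + scale t v)" by blast
  then show ?case by (intro exI[of _ "p + q"]) (auto simp: fun_ops)
next
  case (mult f g)
  then obtain p q where "\<forall>t. poly p t = f (u + scale t v)" "\<forall>t. poly q t = g (u + scale t v)" by blast
  then show ?case by (intro exI[of _ "p * q"]) (auto simp: fun_ops)
qed

lemma poly_line_poly: "f \<in> S \<Longrightarrow> u \<in> W \<Longrightarrow> v \<in> W \<Longrightarrow> poly (line_poly f u v) t = f (u + scale t v)"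
  using line_poly_ex[of f u v] line_poly_eqI by metis

lemma line_poly_add: "f \<in> S \<Longrightarrow> g \<in> S \<Longrightarrow> u \<in> W \<Longrightarrow> v \<in> W \<Longrightarrow>
    line_poly (f + g) u v = line_poly f u v + line_poly g u v"
  by (rule line_poly_eqI) (simp add: poly_line_poly fun_ops)

lemma line_poly_mult: "f \<in> S \<Longrightarrow> g \<in> S \<Longrightarrow> u \<in> W \<Longrightarrow> v \<in> W \<Longrightarrow>
    line_poly (f * g) u v = line_poly f u v * line_poly g u v"
  by (rule line_poly_eqI) (simp add: poly_line_poly fun_ops)

lemma line_poly_scale: "f \<in> S \<Longrightarrow> u \<in> W \<Longrightarrow> v \<in> W \<Longrightarrow>
    line_poly (fscale c f) u v = Polynomial.smult c (line_poly f u v)"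
  by (rule line_poly_eqI) (simp add: poly_line_poly fun_ops)

text \<open>On the line joining a point where \<open>f\<close> is nonzero to a point where
  \<open>g\<close> is nonzero, neither restriction is the zero polynomial.\<close>

lemma S_domain: "f \<in> S \<Longrightarrow> g \<in> S \<Longrightarrow> f * g = 0 \<Longrightarrow> f = 0 \<or> g = 0"
proof (rule ccontr)
  assume fg: "f \<in> S" "g \<in> S" "f * g = 0" "\<not> (f = 0 \<or> g = 0)"
  then obtain u v where uv: "f u \<noteq> 0" "g v \<noteq> 0" by (auto simp: fun_eq_iff fun_ops)
  then have W: "u \<in> W" "v \<in> W" using fg S_outside by blast+
  then have W': "v - u \<in> W" using subspace_W by (auto intro: subspace_diff)
  have "line_poly f u (v - u) * line_poly g u (v - u) = line_poly (f * g) u (v - u)"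
    using line_poly_mult[OF fg(1,2) W(1) W'] by simp
  also have "\<dots> = 0" using fg(3) by (intro line_poly_eqI) (simp add: fun_ops)
  finally consider "line_poly f u (v - u) = 0" | "line_poly g u (v - u) = 0" by auto
  then show False
  proof cases
    case 1
    then show False using poly_line_poly[OF fg(1) W(1) W', of 0] uv by simp
  next
    case 2
    then show False using poly_line_poly[OF fg(2) W(1) W', of 1] uv by simp
  qed
qed

lemma S_mult_cancel: "f \<in> S \<Longrightarrow> g \<in> S \<Longrightarrow> h \<in> S \<Longrightarrow> f * g = f * h \<Longrightarrow> f \<noteq> 0 \<Longrightarrow> g = h"
  using S_domain[of f "g - h"] by (auto simp: right_diff_distrib S_diff)

lemma S_prod_nonzero: 
  assumes "finite A" "\<And>i. i \<in> A \<Longrightarrow> f i \<in> S" "\<And>i. i \<in> A \<Longrightarrow> f i \<noteq> 0" "g \<in> S" "g \<noteq> 0"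
  shows "g * (\<Prod>i\<in>A. f i) \<in> S \<and> g * (\<Prod>i\<in>A. f i) \<noteq> 0"
  using assms
proof (induction A rule: finite_induct)
  case (insert i A)
  then have "f i * (g * prod f A) \<in> S" "f i * (g * prod f A) \<noteq> 0"
    using S_domain[of "f i" "g * prod f A"] S_mult by auto
  then show ?case using insert by (simp add: mult_ac)
qed auto

definition D :: "'a \<Rightarrow> ('a \<Rightarrow> complex) \<Rightarrow> 'a \<Rightarrow> complex" where
  "D v f = (\<lambda>u. if u \<in> W then poly.coeff (line_poly f u v) 1 else 0)"

lemma D_add: "f \<in> S \<Longrightarrow> g \<in> S \<Longrightarrow> v \<in> W \<Longrightarrow> D v (f + g) = D v f + D v g"
  by (auto simp: D_def line_poly_add fun_eq_iff fun_ops)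

lemma D_fscale: "f \<in> S \<Longrightarrow> v \<in> W \<Longrightarrow> D v (fscale c f) = fscale c (D v f)"
  by (auto simp: D_def line_poly_scale fun_eq_iff fun_ops)

lemma D_mult: "f \<in> S \<Longrightarrow> g \<in> S \<Longrightarrow> v \<in> W \<Longrightarrow> D v (f * g) = D v f * g + f * D v g"
proof
  fix u assume *: "f \<in> S" "g \<in> S" "v \<in> W"
  have "poly.coeff (line_poly h u v) 0 = h u" if "h \<in> S" "u \<in> W" for h
    using poly_line_poly[OF that *(3), of 0] by (simp add: poly_0_coeff_0)
  then show "D v (f * g) u = (D v f * g + f * D v g) u"
    using * by (simp add: D_def line_poly_mult coeff_mult fun_ops)
qed

lemma D_lin: "l \<in> DS \<Longrightarrow> v \<in> W \<Longrightarrow> D v l = cst (l v)"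
proof -
  assume *: "l \<in> DS" "v \<in> W"
  have "line_poly l u v = [:l u, l v:]" if "u \<in> W" for u
    using * that by (intro line_poly_eqI) (auto simp: DS_add DS_scale W_scale)
  then show ?thesis by (auto simp: D_def cst_def fun_eq_iff fun_ops)
qed

lemma D_cst: "v \<in> W \<Longrightarrow> D v (cst c) = 0"
proof -
  assume *: "v \<in> W"
  have "line_poly (cst c) u v = [:c:]" if "u \<in> W" for u
    using * that by (intro line_poly_eqI) (auto simp: cst_def W_add W_scale)
  then show ?thesis by (auto simp: D_def fun_eq_iff fun_ops)
qed

lemma D_zero: "v \<in> W \<Longrightarrow> D v 0 = 0"
  using D_fscale[of 0 v 0] by simp

lemma D_sum: "finite A \<Longrightarrow> (\<And>i. i \<in> A \<Longrightarrow> f i \<in> S) \<Longrightarrow> v \<in> W \<Longrightarrow> D v (\<Sum>i\<in>A. f i) = (\<Sum>i\<in>A. D v (f i))"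
  by (induction A rule: finite_induct) (auto simp: D_zero D_add S_sum)

lemma D_Sd: "f \<in> Sd d \<Longrightarrow> v \<in> W \<Longrightarrow> (d = 0 \<longrightarrow> D v f = 0) \<and> D v f \<in> Sd (d - 1)"
proof (induction rule: Sd_induct)
  case one
  then show ?case by (simp add: D_cst)
next
  case (mult d f l)
  have "D v (f * l) = D v f * l + fscale (l v) f"
    using mult by (simp add: D_mult Sd_in_S DS_in_S D_lin S_cst_mult)
  moreover have "D v f * l \<in> Sd d"
  proof (cases d)
    case 0
    then show ?thesis using mult by simp
  next
    case (Suc n)
    then show ?thesis using mult Sd_mult_DS by auto
  qed
  ultimately show ?case using mult Sd_add Sd_scale by auto
next
  case (add d f g)
  then show ?case by (auto simp: D_add Sd_in_S Sd_add)
next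
  case (scale d f c)
  then show ?case by (auto simp: D_fscale Sd_in_S Sd_scale)
qed

lemma D_in_S: "f \<in> S \<Longrightarrow> v \<in> W \<Longrightarrow> D v f \<in> S"
proof (induction rule: S_induct)
  case (Sd d f)
  then show ?case using D_Sd Sd_in_S by blast
qed (auto simp: D_add S_add)

lemma D_dir_add: "f \<in> S \<Longrightarrow> v \<in> W \<Longrightarrow> w \<in> W \<Longrightarrow> D (v + w) f = D v f + D w f"
proof (induction rule: S_subalgebra_induct)
  case (lin l)
  then show ?case by (auto simp: D_lin W_add DS_add cst_def fun_eq_iff fun_ops)
next
  case (mult f g)
  then show ?case by (simp add: D_mult W_add algebra_simps)
qed (auto simp: D_cst D_add W_add algebra_simps)

lemma D_dir_scale: "f \<in> S \<Longrightarrow> v \<in> W \<Longrightarrow> D (scale c v) f = fscale c (D v f)"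
proof (induction rule: S_subalgebra_induct)
  case (lin l)
  then show ?case by (auto simp: D_lin W_scale DS_scale cst_def fun_eq_iff fun_ops)
next
  case (mult f g)
  then show ?case by (simp add: D_mult W_scale fscale_mult fv.scale_right_distrib)
qed (auto simp: D_cst D_add W_scale fv.scale_right_distrib)

lemma euler: "f \<in> Sd d \<Longrightarrow> (\<Sum>k<r. x k * D (b k) f) = fscale (of_nat d) f"
proof (induction rule: Sd_induct)
  case one
  then show ?case by (simp add: D_cst b_in)
next
  case (mult d f l)
  have "(\<Sum>k<r. x k * D (b k) (f * l)) = (\<Sum>k<r. (x k * D (b k) f) * l + f * fscale (l (b k)) (x k))"
  proof (rule sum.cong[OF refl])
    fix k assume "k \<in> {..<r}"
    then have k: "b k \<in> W" "x k \<in> S" using b_in x_dual DS_in_S by auto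
    then have "D (b k) (f * l) = D (b k) f * l + fscale (l (b k)) f"
      using mult by (simp add: D_mult Sd_in_S DS_in_S D_lin S_cst_mult)
    then show "x k * D (b k) (f * l) = (x k * D (b k) f) * l + f * fscale (l (b k)) (x k)"
      by (simp add: fun_eq_iff fun_ops algebra_simps)
  qed
  also have "\<dots> = fscale (of_nat d) f * l + f * l"
    using DS_expand[OF \<open>l \<in> DS\<close>] mult by (simp add: sum.distrib sum_distrib_left[symmetric] sum_distrib_right[symmetric])
  also have "\<dots> = fscale (of_nat (Suc d)) (f * l)" by (simp add: fun_eq_iff fun_ops algebra_simps)
  finally show ?case .
next
  case (add d f g)
  have "(\<Sum>k<r. x k * D (b k) (f + g)) = (\<Sum>k<r. x k * D (b k) f) + (\<Sum>k<r. x k * D (b k) g)"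
    unfolding sum.distrib[symmetric] using add b_in
    by (intro sum.cong) (auto simp: D_add Sd_in_S distrib_left)
  then show ?case using add by (simp add: fv.scale_right_distrib)
next
  case (scale d f c)
  have "(\<Sum>k<r. x k * D (b k) (fscale c f)) = fscale c (\<Sum>k<r. x k * D (b k) f)"
    unfolding fv.scale_sum_right using scale b_in
    by (intro sum.cong) (auto simp: D_fscale Sd_in_S fscale_mult)
  then show ?case using scale by (simp add: mult.commute)
qed

definition hc :: "nat \<Rightarrow> ('a \<Rightarrow> complex) \<Rightarrow> 'a \<Rightarrow> complex" where
  "hc j f = (\<lambda>w. if w \<in> W then poly.coeff (line_poly f 0 w) j else 0)"

lemma hc_add: "f \<in> S \<Longrightarrow> g \<in> S \<Longrightarrow> hc j (f + g) = hc j f + hc j g"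
  by (auto simp: hc_def line_poly_add fun_eq_iff fun_ops)

lemma hc_scale: "f \<in> S \<Longrightarrow> hc j (fscale c f) = fscale c (hc j f)"
  by (auto simp: hc_def line_poly_scale fun_eq_iff fun_ops)

lemma hc_Sd: "f \<in> Sd d \<Longrightarrow> hc j f = (if j = d then f else 0)"
proof -
  assume f: "f \<in> Sd d"
  have "line_poly f 0 w = monom (f w) d" if "w \<in> W" for w
    using Sd_homogeneous[OF f that] by (intro line_poly_eqI) (auto simp: poly_monom)
  then show ?thesis using Sd_outside[OF f] by (auto simp: hc_def fun_eq_iff fun_ops)
qed

lemma hc_zero [simp]: "hc j 0 = 0"
  using hc_Sd[of 0 j j] by simp

lemma hc_sum: "finite A \<Longrightarrow> (\<And>i. i \<in> A \<Longrightarrow> f i \<in> S) \<Longrightarrow> hc j (\<Sum>i\<in>A. f i) = (\<Sum>i\<in>A. hc j (f i))"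
  by (induction A rule: finite_induct) (auto simp: hc_add S_sum)

lemma hc_in: "f \<in> S \<Longrightarrow> hc j f \<in> Sd j"
  by (induction rule: S_induct) (auto simp: hc_Sd hc_add Sd_add)

lemma hc_expand: "f \<in> S \<Longrightarrow> \<exists>n. f = (\<Sum>d<n. hc d f) \<and> (\<forall>d\<ge>n. hc d f = 0)"
proof -
  assume "f \<in> S"
  then obtain g n where g: "\<forall>d. g d \<in> Sd d" "f = (\<Sum>d<n. g d)" using S_decomp by blast
  have hcf: "hc d f = (if d < n then g d else 0)" for d
  proof -
    have "hc d f = (\<Sum>e<n. hc d (g e))" unfolding g(2) using g(1) Sd_in_S by (intro hc_sum) auto
    also have "\<dots> = (\<Sum>e<n. if e = d then g d else 0)"
      using hc_Sd[OF g(1)[rule_format], of d] by (intro sum.cong) auto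
    finally show ?thesis by simp
  qed
  then have "f = (\<Sum>d<n. hc d f)" using g(2) by simp
  then show ?thesis using hcf by (metis leD)
qed

lemma hc_mult: "f \<in> S \<Longrightarrow> h \<in> Sd d \<Longrightarrow> hc j (f * h) = (if d \<le> j then hc (j - d) f * h else 0)"
proof (induction rule: S_induct)
  case (Sd e f)
  then show ?case using Sd_mult[of f e h d] by (auto simp: hc_Sd)
next
  case (add f g)
  then show ?case by (auto simp: distrib_right hc_add S_mult Sd_in_S)
qed

lemma hc_eq_0: "f \<in> S \<Longrightarrow> (\<And>d. hc d f = 0) \<Longrightarrow> f = 0"
  using hc_expand by fastforce

lemma hc_0: "f \<in> S \<Longrightarrow> hc 0 f = cst (f 0)"
proof (induction rule: S_induct)
  case (Sd d f)
  then show ?case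
  proof (cases d)
    case 0
    then obtain c where "f = cst c" using Sd Sd_0_iff by auto
    then show ?thesis using hc_Sd[OF cst_in, of 0 c] by (simp add: cst_def)
  next
    case (Suc n)
    then show ?thesis using hc_Sd[OF Sd, of 0] Sd_homogeneous[OF Sd W_zero, of 0]
      by (auto simp: cst_def fun_eq_iff fun_ops)
  qed
next
  case (add f g)
  have "hc 0 (f + g) = cst (f 0) + cst (g 0)" using add by (simp add: hc_add)
  also have "\<dots> = cst ((f + g) 0)" by (auto simp: cst_def fun_eq_iff fun_ops)
  finally show ?case .
qed

lemma Sd_at_0: "f \<in> Sd d \<Longrightarrow> d > 0 \<Longrightarrow> f 0 = 0"
  using Sd_homogeneous[of f d 0 0] by (simp add: power_0_left)

lemma hc_0_eq_0: "f \<in> S \<Longrightarrow> f 0 = 0 \<Longrightarrow> hc 0 f = 0"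
  by (auto simp: hc_0 cst_def fun_eq_iff fun_ops)

lemma hc_prod:
  assumes "f \<in> S" "g \<in> S"
  shows "hc j (f * g) = (\<Sum>i\<le>j. hc (j - i) f * hc i g)"
proof -
  obtain n where n: "g = (\<Sum>d<n. hc d g)" "\<forall>d\<ge>n. hc d g = 0" using hc_expand[OF assms(2)] by blast
  have "hc j (f * g) = hc j (\<Sum>d<n. f * hc d g)"
    by (subst n(1)) (simp add: sum_distrib_left)
  also have "\<dots> = (\<Sum>d<n. hc j (f * hc d g))"
    using assms by (intro hc_sum S_mult Sd_in_S[OF hc_in]) auto
  also have "\<dots> = (\<Sum>d<n. if d \<le> j then hc (j - d) f * hc d g else 0)"
    using assms by (intro sum.cong) (auto simp: hc_mult hc_in)
  also have "\<dots> = (\<Sum>d\<in>{..<n} \<inter> {..j}. hc (j - d) f * hc d g)"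
    by (rule sum.mono_neutral_cong_right) auto
  also have "\<dots> = (\<Sum>i\<le>j. hc (j - i) f * hc i g)"
    using n(2) by (intro sum.mono_neutral_left) auto
  finally show ?thesis .
qed

subsection \<open>Filtration by degree and division by linear forms\<close>

text \<open>The bound is strict so that \<open>lt 0\<close> is zero, the base case of inductions on
  the degree. For quotients by a linear form a filtration is enough: what matters is that the bound
  drops by one.\<close>

definition lt :: "nat \<Rightarrow> ('a \<Rightarrow> complex) set" where
  "lt n = fspan (\<Union>d<n. Sd d)"

lemma lt_subspace: "fv.subspace (lt n)"
  by (simp add: lt_def)

lemma lt_0: "lt 0 = {0}"
  by (simp add: lt_def)

lemma lt_mono: "m \<le> n \<Longrightarrow> lt m \<subseteq> lt n"
  unfolding lt_def by (intro fv.span_mono UN_mono) auto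

lemma Sd_in_lt: "f \<in> Sd d \<Longrightarrow> d < n \<Longrightarrow> f \<in> lt n"
  unfolding lt_def by (rule fv.span_base) auto

lemma lt_in_S: "f \<in> lt n \<Longrightarrow> f \<in> S"
proof -
  have "lt n \<subseteq> S" unfolding lt_def sym_algebra_def by (rule fv.span_mono) auto
  then show "f \<in> lt n \<Longrightarrow> f \<in> S" by auto
qed

lemma S_in_lt: "f \<in> S \<Longrightarrow> \<exists>n. f \<in> lt n"
proof -
  assume "f \<in> S"
  then obtain g n where g: "\<forall>d. g d \<in> Sd d" "f = (\<Sum>d<n. g d)" using S_decomp by blast
  then have "f \<in> lt n" by (auto intro!: fv.subspace_sum[OF lt_subspace] intro: Sd_in_lt)
  then show ?thesis by blast
qed

lemma lt_mult_lin: "f \<in> lt n \<Longrightarrow> l \<in> DS \<Longrightarrow> f * l \<in> lt (Suc n)"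
  unfolding lt_def
proof (rule fspan_mult_closed[of f _ l "{l}"])
  fix a l' assume "l \<in> DS" "a \<in> (\<Union>d<n. Sd d)" "l' \<in> {l}"
  then show "a * l' \<in> fspan (\<Union>d<Suc n. Sd d)"
    using Sd_mult_DS by (intro fv.span_base) force
qed (auto intro: fv.span_base)

text \<open>\<open>\<tau>\<close> is a transvection or a reflection along \<open>u\<close>: this covers both reflections and the
  projection onto the kernel of a linear form.\<close>

lemma division_Sd:
  assumes "f \<in> Sd d" and \<tau>: "\<And>w. w \<in> W \<Longrightarrow> \<tau> w = w + scale (\<alpha> w) u" and u: "u \<in> W" and \<alpha>: "\<alpha> \<in> DS"
  shows "\<exists>q\<in>lt d. \<forall>w\<in>W. f (\<tau> w) - f w = \<alpha> w * q w"
proof -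
  have \<tau>W: "\<tau> w \<in> W" if "w \<in> W" for w using that \<tau> u by (simp add: W_add W_scale)
  from assms(1) show ?thesis
  proof (induction rule: Sd_induct)
    case one
    then show ?case using \<tau>W by (intro bexI[of _ 0]) (auto simp: cst_def lt_0 fun_ops)
  next
    case (mult d f l)
    then obtain q where q: "q \<in> lt d" "\<forall>w\<in>W. f (\<tau> w) - f w = \<alpha> w * q w" by blast
    \<comment> \<open>The quotient of (f + \<alpha> q)(l + \<alpha> l(u)) - f l by \<alpha>.\<close>
    define q' where "q' = q * l + q * fscale (l u) \<alpha> + fscale (l u) f"
    have "fscale (l u) \<alpha> \<in> DS" using DS_subspace \<alpha> fv.subspace_scale by blast
    then have "q' \<in> lt (Suc d)"
      unfolding q'_def using q(1) mult lt_subspace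
      by (intro fv.subspace_add[OF lt_subspace] lt_mult_lin fv.subspace_scale[OF lt_subspace]
          Sd_in_lt[OF \<open>f \<in> Sd d\<close>]) auto
    moreover have "(f * l) (\<tau> w) - (f * l) w = \<alpha> w * q' w" if "w \<in> W" for w
    proof -
      have 1: "f (\<tau> w) = f w + \<alpha> w * q w" using q(2) that by (metis add_diff_cancel_left' diff_add_cancel add.commute)
      have 2: "l (\<tau> w) = l w + \<alpha> w * l u"
        using \<tau>[OF that] that u mult by (simp add: DS_add DS_scale W_scale)
      show ?thesis unfolding times_fun_apply 1 2 by (simp add: q'_def fun_ops algebra_simps)
    qed
    ultimately show ?case by blast
  next
    case (add d f g)
    then obtain q q' where "q \<in> lt d" "\<forall>w\<in>W. f (\<tau> w) - f w = \<alpha> w * q w"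
      "q' \<in> lt d" "\<forall>w\<in>W. g (\<tau> w) - g w = \<alpha> w * q' w" by blast
    then show ?case
      by (intro bexI[of _ "q + q'"]) (auto simp: fun_ops algebra_simps fv.subspace_add[OF lt_subspace])
  next
    case (scale d f c)
    then obtain q where q: "q \<in> lt d" "\<forall>w\<in>W. f (\<tau> w) - f w = \<alpha> w * q w" by blast
    then show ?case
    proof (intro bexI[of _ "fscale c q"] ballI)
      fix w assume "w \<in> W"
      then have "c * (f (\<tau> w) - f w) = c * (\<alpha> w * q w)" using q by simp
      then show "fscale c f (\<tau> w) - fscale c f w = \<alpha> w * fscale c q w" by (simp add: fun_ops algebra_simps)
    qed (auto simp: fv.subspace_scale[OF lt_subspace])
  qed
qed

lemma division:
  assumes "f \<in> lt (Suc n)" and \<tau>: "\<And>w. w \<in> W \<Longrightarrow> \<tau> w = w + scale (\<alpha> w) u" and u: "u \<in> W" and \<alpha>: "\<alpha> \<in> DS"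
  shows "\<exists>q\<in>lt n. \<forall>w\<in>W. f (\<tau> w) - f w = \<alpha> w * q w"
  using assms(1) unfolding lt_def[of "Suc n"]
proof (induction rule: fv.span_induct_alt)
  case base
  then show ?case using fv.subspace_0[OF lt_subspace] by (intro bexI[of _ 0]) (auto simp: fun_ops)
next
  case (step c f g)
  then obtain d where d: "d < Suc n" "f \<in> Sd d" by auto
  obtain q where q: "q \<in> lt d" "\<forall>w\<in>W. f (\<tau> w) - f w = \<alpha> w * q w"
    using division_Sd[OF d(2) \<tau> u \<alpha>] by blast
  obtain q' where q': "q' \<in> lt n" "\<forall>w\<in>W. g (\<tau> w) - g w = \<alpha> w * q' w" using step by blast
  have "fscale c q + q' \<in> lt n"
    using q q' d lt_mono[of d n] lt_subspace by (auto intro!: fv.subspace_add fv.subspace_scale)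
  moreover have "(fscale c f + g) (\<tau> w) - (fscale c f + g) w = \<alpha> w * (fscale c q + q') w" if "w \<in> W" for w
  proof -
    have "(fscale c f + g) (\<tau> w) - (fscale c f + g) w = c * (f (\<tau> w) - f w) + (g (\<tau> w) - g w)"
      by (simp add: fun_ops algebra_simps)
    then show ?thesis using q(2) q'(2) that by (simp add: fun_ops algebra_simps)
  qed
  ultimately show ?case by blast
qed

lemma comp_Sd:
  assumes "f \<in> Sd d" and "\<And>w. w \<in> W \<Longrightarrow> \<tau> w \<in> W"
    and "\<And>v w. v \<in> W \<Longrightarrow> w \<in> W \<Longrightarrow> \<tau> (v + w) = \<tau> v + \<tau> w"
    and "\<And>c w. w \<in> W \<Longrightarrow> \<tau> (scale c w) = scale c (\<tau> w)"
  shows "(\<lambda>w. if w \<in> W then f (\<tau> w) else 0) \<in> Sd d"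
  using assms(1)
proof (induction rule: Sd_induct)
  case one
  have "(\<lambda>w. if w \<in> W then cst 1 (\<tau> w) else 0) = cst 1"
    using assms by (auto simp: cst_def fun_eq_iff fun_ops)
  then show ?case using cst_in by simp
next
  case (mult d f l)
  have "(\<lambda>w. if w \<in> W then (f * l) (\<tau> w) else 0) =
      (\<lambda>w. if w \<in> W then f (\<tau> w) else 0) * (\<lambda>w. if w \<in> W then l (\<tau> w) else 0)"
    by (auto simp: fun_eq_iff fun_ops)
  moreover have "(\<lambda>w. if w \<in> W then l (\<tau> w) else 0) \<in> DS"
    using DS_add[OF \<open>l \<in> DS\<close>] DS_scale[OF \<open>l \<in> DS\<close>] assms(2-4)
    unfolding dual_space_def by (auto simp: W_add W_scale)
  ultimately show ?case using mult Sd_mult_DS by simp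
next
  case (add d f g)
  have "(\<lambda>w. if w \<in> W then (f + g) (\<tau> w) else 0) =
      (\<lambda>w. if w \<in> W then f (\<tau> w) else 0) + (\<lambda>w. if w \<in> W then g (\<tau> w) else 0)"
    by (auto simp: fun_eq_iff fun_ops)
  then show ?case using add Sd_add by simp
next
  case (scale d f c)
  have "(\<lambda>w. if w \<in> W then (fscale c f) (\<tau> w) else 0) =
      fscale c (\<lambda>w. if w \<in> W then f (\<tau> w) else 0)"
    by (auto simp: fun_eq_iff fun_ops)
  then show ?case using scale Sd_scale by simp
qed

lemma b_inj: "inj_on b {..<r}"
proof (rule inj_onI)
  fix k l assume "k \<in> {..<r}" "l \<in> {..<r}" "b k = b l"
  then have "x k (b k) = x k (b l)" "k < r" "l < r" by auto
  then show "k = l" using x_b by (auto split: if_splits)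
qed

lemma dim_W: "dim W = r"
proof -
  note inj = b_inj
  have ind: "independent (b ` {..<r})"
    unfolding dependent_finite[OF finite_imageI[OF finite_lessThan]]
  proof (intro notI, elim exE conjE bexE)
    fix u v assume v: "v \<in> b ` {..<r}" "u v \<noteq> 0" and s: "(\<Sum>v\<in>b ` {..<r}. scale (u v) v) = 0"
    then obtain k where k: "k < r" "v = b k" by auto
    have "0 = x k (\<Sum>l<r. scale (u (b l)) (b l))"
      using s inj x_dual[OF k(1)] by (simp add: sum.reindex)
    also have "\<dots> = (\<Sum>l<r. u (b l) * x k (b l))"
      using x_dual[OF k(1)] b_in by (intro DS_sum) auto
    also have "\<dots> = (\<Sum>l<r. if l = k then u (b k) else 0)"
      using x_b[OF k(1)] by (intro sum.cong) auto
    finally show False using k v by simp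
  qed
  have "W = span (b ` {..<r})"
  proof (intro equalityI subsetI)
    fix w assume "w \<in> W"
    then have "w = (\<Sum>k<r. scale (x k w) (b k))" using expand by simp
    also have "\<dots> \<in> span (b ` {..<r})" by (intro span_sum span_scale span_base) auto
    finally show "w \<in> span (b ` {..<r})" .
  next
    fix w assume "w \<in> span (b ` {..<r})"
    then show "w \<in> W" using span_minimal[OF _ subspace_W, of "b ` {..<r}"] b_in by auto
  qed
  then have "dim W = card (b ` {..<r})" using dim_span_eq_card_independent[OF ind] by simp
  then show ?thesis using inj by (simp add: card_image)
qed

end

section \<open>Substitution into polynomials\<close>

definition subst_monom :: "'a set \<Rightarrow> ('a \<Rightarrow> complex) list \<Rightarrow> (nat \<Rightarrow>\<^sub>0 nat) \<Rightarrow> 'a \<Rightarrow> complex" where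
  "subst_monom W fs m = (\<lambda>x. if x \<in> W
     then \<Prod>i\<in>Poly_Mapping.keys m. (fs ! i) x ^ Poly_Mapping.lookup m i else 0)"

abbreviation exponents :: "nat \<Rightarrow> (nat \<Rightarrow>\<^sub>0 nat) set" where
  "exponents n \<equiv> {m. Poly_Mapping.keys m \<subseteq> {..<n}}"

lemma subst_monom_superset:
  assumes "finite A" "Poly_Mapping.keys m \<subseteq> A" "x \<in> W"
  shows "subst_monom W fs m x = (\<Prod>i\<in>A. (fs ! i) x ^ Poly_Mapping.lookup m i)"
  using assms unfolding subst_monom_def
  by (auto intro!: prod.mono_neutral_left simp: in_keys_iff)

lemma subst_monom_add: "subst_monom W fs (m + m') = subst_monom W fs m * subst_monom W fs m'"
proof
  fix x
  show "subst_monom W fs (m + m') x = (subst_monom W fs m * subst_monom W fs m') x"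
  proof (cases "x \<in> W")
    case True
    define A where "A = Poly_Mapping.keys m \<union> Poly_Mapping.keys m'"
    have "finite A" "Poly_Mapping.keys m \<subseteq> A" "Poly_Mapping.keys m' \<subseteq> A" "Poly_Mapping.keys (m + m') \<subseteq> A"
      using keys_add[of m m'] by (auto simp: A_def)
    then show ?thesis using True
      by (simp add: subst_monom_superset[of A] fun_ops prod.distrib[symmetric] lookup_add power_add)
  next
    case False
    then show ?thesis by (simp add: subst_monom_def fun_ops)
  qed
qed

lemma subst_monom_single: "subst_monom W fs (Poly_Mapping.single i 1) = (\<lambda>x. if x \<in> W then (fs ! i) x else 0)"
  by (auto simp: subst_monom_def)

lemma subst_monom_0: "subst_monom W fs 0 = (\<lambda>x. if x \<in> W then 1 else 0)"
  by (auto simp: subst_monom_def)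

lemma poly_subst_superset:
  assumes "finite A" "Poly_Mapping.keys p \<subseteq> A"
  shows "poly_subst W fs p = (\<Sum>m\<in>A. fscale (Poly_Mapping.lookup p m) (subst_monom W fs m))"
proof
  fix x
  have "poly_subst W fs p x = (\<Sum>m\<in>Poly_Mapping.keys p. fscale (Poly_Mapping.lookup p m) (subst_monom W fs m)) x"
    by (auto simp: poly_subst_def subst_monom_def fun_ops)
  also have "\<dots> = (\<Sum>m\<in>A. fscale (Poly_Mapping.lookup p m) (subst_monom W fs m)) x"
    unfolding fun_ops using assms by (intro sum.mono_neutral_left) (auto simp: in_keys_iff)
  finally show "poly_subst W fs p x = (\<Sum>m\<in>A. fscale (Poly_Mapping.lookup p m) (subst_monom W fs m)) x" .
qed

lemma poly_subst_add: "poly_subst W fs (p + q) = poly_subst W fs p + poly_subst W fs q"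
proof -
  define A where "A = Poly_Mapping.keys p \<union> Poly_Mapping.keys q"
  have "finite A" "Poly_Mapping.keys p \<subseteq> A" "Poly_Mapping.keys q \<subseteq> A" "Poly_Mapping.keys (p + q) \<subseteq> A"
    using keys_add[of p q] by (auto simp: A_def)
  then show ?thesis
    by (simp add: poly_subst_superset[of A] sum.distrib[symmetric] lookup_add fv.scale_left_distrib)
qed

lemma poly_subst_zero [simp]: "poly_subst W fs 0 = 0"
  by (auto simp: poly_subst_def fun_eq_iff fun_ops)

lemma poly_subst_sum: "poly_subst W fs (\<Sum>i\<in>A. p i) = (\<Sum>i\<in>A. poly_subst W fs (p i))"
  by (induction A rule: infinite_finite_induct) (auto simp: poly_subst_add)

lemma poly_subst_single: "poly_subst W fs (Poly_Mapping.single m c) = fscale c (subst_monom W fs m)"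
  by (subst poly_subst_superset[of "{m}"]) auto

lemma mpolys_add: "p \<in> mpolys n \<Longrightarrow> q \<in> mpolys n \<Longrightarrow> p + q \<in> mpolys n"
  unfolding mpolys_def using keys_add[of p q] by blast

lemma mpolys_zero [simp]: "0 \<in> mpolys n"
  by (simp add: mpolys_def)

lemma mpolys_single: "m \<in> exponents n \<Longrightarrow> Poly_Mapping.single m c \<in> mpolys n"
  by (auto simp: mpolys_def)

lemma mpolys_sum: "(\<And>i. i \<in> A \<Longrightarrow> p i \<in> mpolys n) \<Longrightarrow> (\<Sum>i\<in>A. p i) \<in> mpolys n"
  by (induction A rule: infinite_finite_induct) (auto simp: mpolys_add)

lemma poly_subst_image: "poly_subst W fs ` mpolys n = fspan (subst_monom W fs ` exponents n)"
proof (intro equalityI subsetI)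
  fix f assume "f \<in> poly_subst W fs ` mpolys n"
  then obtain p where p: "p \<in> mpolys n" "f = poly_subst W fs p" by auto
  have "f = (\<Sum>m\<in>Poly_Mapping.keys p. fscale (Poly_Mapping.lookup p m) (subst_monom W fs m))"
    unfolding p by (rule poly_subst_superset) auto
  also have "\<dots> \<in> fspan (subst_monom W fs ` exponents n)"
    using p by (intro fv.span_sum fv.span_scale fv.span_base) (auto simp: mpolys_def)
  finally show "f \<in> fspan (subst_monom W fs ` exponents n)" .
next
  fix f assume "f \<in> fspan (subst_monom W fs ` exponents n)"
  then show "f \<in> poly_subst W fs ` mpolys n"
  proof (induction rule: fv.span_induct_alt)
    case base
    have "0 = poly_subst W fs 0" by simp
    then show ?case using mpolys_zero by blast
  next
    case (step c f g)
    then obtain m p where m: "m \<in> exponents n" "f = subst_monom W fs m" "p \<in> mpolys n" "g = poly_subst W fs p"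
      by blast
    have "fscale c f + g = poly_subst W fs (Poly_Mapping.single m c + p)"
      by (simp add: m poly_subst_add poly_subst_single)
    moreover have "Poly_Mapping.single m c + p \<in> mpolys n" using m by (intro mpolys_add mpolys_single)
    ultimately show ?case by blast
  qed
qed

lemma subst_mult_closed:
  assumes "f \<in> poly_subst W fs ` mpolys n" "g \<in> poly_subst W fs ` mpolys n"
  shows "f * g \<in> poly_subst W fs ` mpolys n"
  using assms unfolding poly_subst_image
proof (rule fspan_mult_closed)
  fix a b assume "a \<in> subst_monom W fs ` exponents n" "b \<in> subst_monom W fs ` exponents n"
  then obtain m m' where m: "m \<in> exponents n" "m' \<in> exponents n" "a = subst_monom W fs m" "b = subst_monom W fs m'"
    by blast
  then have "m + m' \<in> exponents n" using keys_add[of m m'] by auto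
  then show "a * b \<in> fspan (subst_monom W fs ` exponents n)"
    unfolding m subst_monom_add[symmetric] by (intro fv.span_base) blast
qed

lemma subst_subspace: "fv.subspace (poly_subst W fs ` mpolys n)"
  unfolding poly_subst_image by simp

lemma nth_in_subst:
  assumes "i < n" "\<And>x. x \<notin> W \<Longrightarrow> (fs ! i) x = 0"
  shows "fs ! i \<in> poly_subst W fs ` mpolys n"
proof -
  have "fs ! i = subst_monom W fs (Poly_Mapping.single i 1)"
    unfolding subst_monom_single using assms(2) by auto
  also have "\<dots> \<in> poly_subst W fs ` mpolys n"
    unfolding poly_subst_image using assms(1) by (intro fv.span_base imageI) auto
  finally show ?thesis .
qed

lemma one_in_subst: "(\<lambda>x. if x \<in> W then c else 0) \<in> poly_subst W fs ` mpolys n"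
proof -
  have "(\<lambda>x. if x \<in> W then c else 0) = fscale c (subst_monom W fs 0)"
    by (auto simp: subst_monom_0 fun_ops)
  also have "\<dots> \<in> poly_subst W fs ` mpolys n"
    unfolding poly_subst_image by (intro fv.span_scale fv.span_base imageI) auto
  finally show ?thesis .
qed

lemma exponent_induct [case_names zero add]:
  fixes m :: "nat \<Rightarrow>\<^sub>0 nat"
  assumes "P 0" "\<And>m i. P m \<Longrightarrow> P (m + Poly_Mapping.single i 1)"
  shows "P m"
proof (induction "\<Sum>i\<in>Poly_Mapping.keys m. Poly_Mapping.lookup m i" arbitrary: m)
  case 0
  then have "m = 0" by (intro poly_mapping_eqI) (auto simp: in_keys_iff)
  then show ?case using assms(1) by simp
next
  case (Suc n)
  then obtain i where i: "i \<in> Poly_Mapping.keys m" by (metis all_not_in_conv nat.distinct(1) sum.empty)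
  define m' where "m' = m - Poly_Mapping.single i 1"
  have m: "m = m' + Poly_Mapping.single i 1"
    using i by (intro poly_mapping_eqI) (auto simp: m'_def lookup_add lookup_minus lookup_single in_keys_iff when_def)
  have keys: "Poly_Mapping.keys m' \<subseteq> Poly_Mapping.keys m"
    by (auto simp: m lookup_add in_keys_iff)
  have "(\<Sum>j\<in>Poly_Mapping.keys m. Poly_Mapping.lookup m j) =
      (\<Sum>j\<in>Poly_Mapping.keys m. Poly_Mapping.lookup m' j + (if j = i then 1 else 0))"
    by (intro sum.cong) (auto simp: m lookup_add lookup_single when_def)
  also have "\<dots> = (\<Sum>j\<in>Poly_Mapping.keys m. Poly_Mapping.lookup m' j) + 1"
    using i by (simp add: sum.distrib)
  also have "(\<Sum>j\<in>Poly_Mapping.keys m. Poly_Mapping.lookup m' j) = (\<Sum>j\<in>Poly_Mapping.keys m'. Poly_Mapping.lookup m' j)"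
    using keys by (intro sum.mono_neutral_right) (auto simp: in_keys_iff)
  finally have "P m'" using Suc by simp
  then show ?case using assms(2) m by metis
qed

lemma subst_monom_independent:
  assumes ind: "alg_independent W fs" and A: "finite A" "A \<subseteq> exponents (length fs)"
    and zero: "(\<Sum>m\<in>A. fscale (c m) (subst_monom W fs m)) = 0" and m: "m \<in> A"
  shows "c m = 0"
proof -
  define p where "p = (\<Sum>m\<in>A. Poly_Mapping.single m (c m))"
  have "p \<in> mpolys (length fs)"
    unfolding p_def using A by (intro mpolys_sum mpolys_single) auto
  moreover have "poly_subst W fs p = 0"
    using zero by (simp add: p_def poly_subst_sum poly_subst_single)
  ultimately have "p = 0" using ind by (auto simp: alg_independent_def)
  moreover have "Poly_Mapping.lookup p m = c m"
    using m A by (simp add: p_def lookup_sum lookup_single when_def)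
  ultimately show ?thesis by simp
qed

text \<open>A product of two elements vanishing at \<open>z\<close> involves only monomials
  \<open>m + m'\<close> with both exponents nonzero, never a single generator, so algebraic
  independence separates it from the linear part. Applied with \<open>z = 0\<close>, this says that
  fundamental invariants are independent modulo the square of R_+.\<close>

lemma subst_linear_part:
  assumes ind: "alg_independent W fs" and W: "z \<in> W" "\<And>i. i < length fs \<Longrightarrow> (fs ! i) z = 0"
      "\<And>i x. i < length fs \<Longrightarrow> x \<notin> W \<Longrightarrow> (fs ! i) x = 0"
    and R0: "R0 = {f \<in> poly_subst W fs ` mpolys (length fs). f z = 0}"
    and lin: "(\<Sum>i<length fs. fscale (c i) (fs ! i)) \<in> fspan {f * g |f g. f \<in> R0 \<and> g \<in> R0}"
    and i: "i < length fs"
  shows "c i = 0"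
proof -
  define n where "n = length fs"
  define M where "M = exponents n - {0}"
  define M2 where "M2 = {m + m' |m m'. m \<in> M \<and> m' \<in> M}"
  have monom_z: "subst_monom W fs m z = 0" if "m \<in> M" for m
  proof -
    have "m \<noteq> 0" using that by (simp add: M_def)
    then obtain j where "j \<in> Poly_Mapping.keys m"
      using poly_mapping_eqI[of m 0] by (force simp: in_keys_iff)
    moreover have "j < n" using calculation that by (auto simp: M_def)
    moreover have "Poly_Mapping.lookup m j \<noteq> 0" using calculation(1) by (simp add: in_keys_iff)
    ultimately show ?thesis using W(1,2) n_def
      unfolding subst_monom_def by (simp add: prod_zero_iff) (metis power_0_left)
  qed
  have R0M: "f \<in> fspan (subst_monom W fs ` M)" if "f \<in> R0" for f
  proof -
    have f: "f \<in> fspan (subst_monom W fs ` exponents n)" "f z = 0"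
      using that by (auto simp: R0 n_def poly_subst_image)
    have "subst_monom W fs ` exponents n = insert (subst_monom W fs 0) (subst_monom W fs ` M)"
      by (auto simp: M_def)
    then obtain k where k: "f - fscale k (subst_monom W fs 0) \<in> fspan (subst_monom W fs ` M)"
      using f(1) by (auto simp: fv.span_insert)
    have "g z = 0" if "g \<in> fspan (subst_monom W fs ` M)" for g
      using that
    proof (induction rule: fv.span_induct_alt)
      case (step c f g)
      then show ?case using monom_z by (auto simp: fun_ops)
    qed (simp add: fun_ops)
    from this[OF k] f(2) have "k = 0" using W(1) by (simp add: fun_ops subst_monom_0)
    then show ?thesis using k by simp
  qed
  have "{f * g |f g. f \<in> R0 \<and> g \<in> R0} \<subseteq> fspan (subst_monom W fs ` M2)"
  proof clarify
    fix f g assume "f \<in> R0" "g \<in> R0"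
    show "f * g \<in> fspan (subst_monom W fs ` M2)"
    proof (rule fspan_mult_closed[OF R0M[OF \<open>f \<in> R0\<close>] R0M[OF \<open>g \<in> R0\<close>]])
      fix a b assume "a \<in> subst_monom W fs ` M" "b \<in> subst_monom W fs ` M"
      then obtain m m' where "m \<in> M" "m' \<in> M" "a = subst_monom W fs m" "b = subst_monom W fs m'" by blast
      then show "a * b \<in> fspan (subst_monom W fs ` M2)"
        by (intro fv.span_base) (auto simp: M2_def subst_monom_add[symmetric])
    qed
  qed
  then have "fspan {f * g |f g. f \<in> R0 \<and> g \<in> R0} \<subseteq> fspan (subst_monom W fs ` M2)"
    by (intro fv.span_minimal) auto
  with lin have "(\<Sum>i<n. fscale (c i) (fs ! i)) \<in> fspan (subst_monom W fs ` M2)" by (auto simp: n_def)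
  then have "(\<Sum>i<n. fscale (c i) (fs ! i)) \<in> {\<Sum>a\<in>t. fscale (q a) a |t q. finite t \<and> t \<subseteq> subst_monom W fs ` M2}"
    by (simp only: fv.span_explicit)
  then obtain T u where T: "(\<Sum>i<n. fscale (c i) (fs ! i)) = (\<Sum>f\<in>T. fscale (u f) f)"
      "finite T" "T \<subseteq> subst_monom W fs ` M2"
    by (elim CollectE exE conjE)
  \<comment> \<open>\<open>B\<close> selects one exponent for each function in \<open>T\<close>, so
    that the sum over functions can be rewritten as a sum over exponents.\<close>
  then obtain B where B: "B \<subseteq> M2" "inj_on (subst_monom W fs) B" "T = subst_monom W fs ` B"
    by (auto simp: subset_image_inj)
  have B_fin: "finite B" using T(2) B(2,3) by (simp add: finite_image_iff)
  define e :: "nat \<Rightarrow> (nat \<Rightarrow>\<^sub>0 nat)" where "e j = Poly_Mapping.single j 1" for j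
  have e_inj: "inj_on e {..<n}"
  proof (rule inj_onI)
    fix j l assume "e j = e l"
    then have "Poly_Mapping.lookup (e j) j = Poly_Mapping.lookup (e l) j" by simp
    then show "j = l" by (simp add: e_def lookup_single when_def split: if_splits)
  qed
  have disj: "e ` {..<n} \<inter> B = {}"
  proof -
    have "e j \<noteq> m + m'" if "m \<in> M" "m' \<in> M" for j m m'
    proof
      assume eq: "e j = m + m'"
      have *: "Poly_Mapping.lookup m l + Poly_Mapping.lookup m' l = (if l = j then 1 else 0)" for l
        using arg_cong[OF eq, of "\<lambda>p. Poly_Mapping.lookup p l"]
        by (auto simp: e_def lookup_add lookup_single when_def split: if_splits)
      have "Poly_Mapping.lookup m j \<noteq> 0"
      proof
        assume "Poly_Mapping.lookup m j = 0"
        then have "m = 0" using * by (intro poly_mapping_eqI) (metis add_is_0 lookup_zero)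
        then show False using that by (simp add: M_def)
      qed
      moreover have "Poly_Mapping.lookup m' j \<noteq> 0"
      proof
        assume "Poly_Mapping.lookup m' j = 0"
        then have "m' = 0" using * by (intro poly_mapping_eqI) (metis add_is_0 lookup_zero)
        then show False using that by (simp add: M_def)
      qed
      ultimately show False using *[of j] by simp
    qed
    then show ?thesis using B(1) by (auto simp: M2_def)
  qed
  \<comment> \<open>Coefficients of the relation obtained by moving the combination of products to
    the other side: \<open>c\<close> on the unit exponents, minus \<open>u\<close> on
    \<open>B\<close>.\<close>
  define c' where "c' m = (if m \<in> B then - u (subst_monom W fs m) else c (inv_into {..<n} e m))" for m
  have "(\<Sum>m\<in>e ` {..<n} \<union> B. fscale (c' m) (subst_monom W fs m)) =
      (\<Sum>m\<in>e ` {..<n}. fscale (c' m) (subst_monom W fs m)) + (\<Sum>m\<in>B. fscale (c' m) (subst_monom W fs m))"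
    using B_fin disj by (intro sum.union_disjoint) auto
  also have "(\<Sum>m\<in>B. fscale (c' m) (subst_monom W fs m)) = - (\<Sum>f\<in>T. fscale (u f) f)"
    unfolding B(3) by (simp add: sum.reindex[OF B(2)] c'_def sum_negf)
  also have "(\<Sum>m\<in>e ` {..<n}. fscale (c' m) (subst_monom W fs m)) = (\<Sum>i<n. fscale (c i) (fs ! i))"
    unfolding sum.reindex[OF e_inj]
  proof (rule sum.cong[OF refl])
    fix j assume j: "j \<in> {..<n}"
    then have "e j \<notin> B" using disj by blast
    moreover have "subst_monom W fs (e j) = fs ! j"
      using j W(3)[of j] unfolding e_def subst_monom_single by (auto simp: n_def)
    ultimately show "((\<lambda>m. fscale (c' m) (subst_monom W fs m)) \<circ> e) j = fscale (c j) (fs ! j)"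
      using j by (simp add: c'_def inv_into_f_f[OF e_inj])
  qed
  also have "\<dots> + - (\<Sum>f\<in>T. fscale (u f) f) = 0" using T(1) by simp
  finally have zero: "(\<Sum>m\<in>e ` {..<n} \<union> B. fscale (c' m) (subst_monom W fs m)) = 0" .
  have "M2 \<subseteq> exponents n"
  proof
    fix m assume "m \<in> M2"
    then obtain a b where "m = a + b" "a \<in> exponents n" "b \<in> exponents n" by (auto simp: M2_def M_def)
    then show "m \<in> exponents n" using keys_add[of a b] by auto
  qed
  then have "c' (e i) = 0"
    using i B(1) B_fin by (intro subst_monom_independent[OF ind _ _ zero]) (auto simp: n_def e_def)
  moreover have "c' (e i) = c i"
    using i disj inv_into_f_f[OF e_inj, of i] by (auto simp: c'_def n_def)
  ultimately show ?thesis by simp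
qed

text \<open>Exponents are subtracted with truncation. Where \<open>m\<close> does not contain
  \<open>i\<close>, the exponent is off but the coefficient carries the factor 0.\<close>

definition mpderiv :: "nat \<Rightarrow> mpoly \<Rightarrow> mpoly" where
  "mpderiv i p = (\<Sum>m\<in>Poly_Mapping.keys p. Poly_Mapping.single (m - Poly_Mapping.single i 1)
      (Poly_Mapping.lookup p m * of_nat (Poly_Mapping.lookup m i)))"

lemma lookup_mpderiv:
  "Poly_Mapping.lookup (mpderiv i p) m =
    of_nat (Suc (Poly_Mapping.lookup m i)) * Poly_Mapping.lookup p (m + Poly_Mapping.single i 1)"
proof -
  let ?e = "Poly_Mapping.single i (1::nat)"
  have "Poly_Mapping.lookup (mpderiv i p) m = (\<Sum>m'\<in>Poly_Mapping.keys p.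
      (Poly_Mapping.lookup p m' * of_nat (Poly_Mapping.lookup m' i) when m' - ?e = m))"
    by (simp add: mpderiv_def lookup_sum lookup_single)
  also have "\<dots> = (\<Sum>m'\<in>Poly_Mapping.keys p. if m' = m + ?e
      then Poly_Mapping.lookup p m' * of_nat (Poly_Mapping.lookup m' i) else 0)"
  proof (rule sum.cong[OF refl])
    fix m'
    show "(Poly_Mapping.lookup p m' * of_nat (Poly_Mapping.lookup m' i) when m' - ?e = m) =
      (if m' = m + ?e then Poly_Mapping.lookup p m' * of_nat (Poly_Mapping.lookup m' i) else 0)"
    proof (cases "Poly_Mapping.lookup m' i = 0")
      case False
      then have "m' - ?e + ?e = m'"
        by (intro poly_mapping_eqI) (auto simp: lookup_add lookup_minus lookup_single when_def)
      then have "m' - ?e = m \<longleftrightarrow> m' = m + ?e" by (metis add_diff_cancel_right')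
      then show ?thesis by (simp add: when_def)
    qed (auto simp: lookup_add)
  qed
  also have "\<dots> = of_nat (Suc (Poly_Mapping.lookup m i)) * Poly_Mapping.lookup p (m + ?e)"
    by (auto simp: lookup_add in_keys_iff)
  finally show ?thesis .
qed

lemma mpderiv_mpolys: "p \<in> mpolys n \<Longrightarrow> mpderiv i p \<in> mpolys n"
  unfolding mpderiv_def
proof (intro mpolys_sum mpolys_single)
  fix m assume "p \<in> mpolys n" "m \<in> Poly_Mapping.keys p"
  moreover have "Poly_Mapping.keys (m - Poly_Mapping.single i 1) \<subseteq> Poly_Mapping.keys m"
    by (auto simp: in_keys_iff lookup_minus)
  ultimately show "m - Poly_Mapping.single i 1 \<in> exponents n" by (auto simp: mpolys_def)
qed

context polyspace
begin

lemma subst_monom_in_S: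
  assumes "m \<in> exponents (length fs)" "\<And>i. i < length fs \<Longrightarrow> fs ! i \<in> S"
  shows "subst_monom W fs m \<in> S"
proof -
  have "m \<in> exponents (length fs) \<longrightarrow> subst_monom W fs m \<in> S"
  proof (induction m rule: exponent_induct)
    case zero
    then show ?case using cst_in_S[of 1] by (simp add: subst_monom_0 cst_def)
  next
    case (add m i)
    show ?case
    proof
      assume *: "m + Poly_Mapping.single i 1 \<in> exponents (length fs)"
      have "Poly_Mapping.keys m \<subseteq> Poly_Mapping.keys (m + Poly_Mapping.single i 1)"
        "i \<in> Poly_Mapping.keys (m + Poly_Mapping.single i 1)"
        by (auto simp: in_keys_iff lookup_add)
      then have m: "m \<in> exponents (length fs)" "i < length fs" using * by auto
      then have "subst_monom W fs (Poly_Mapping.single i 1) = fs ! i"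
        using assms(2)[of i] S_outside unfolding subst_monom_single by auto
      then show "subst_monom W fs (m + Poly_Mapping.single i 1) \<in> S"
        using add m assms(2) by (simp only: subst_monom_add) (auto intro: S_mult)
    qed
  qed
  then show ?thesis using assms by blast
qed

lemma poly_subst_in_S:
  assumes "p \<in> mpolys (length fs)" "\<And>i. i < length fs \<Longrightarrow> fs ! i \<in> S"
  shows "poly_subst W fs p \<in> S"
  using assms by (subst poly_subst_superset[of "Poly_Mapping.keys p"])
    (auto intro!: S_sum S_scale subst_monom_in_S simp: mpolys_def)

lemma D_subst_monom:
  assumes "m \<in> exponents (length fs)" "\<And>i. i < length fs \<Longrightarrow> fs ! i \<in> S" "v \<in> W"
  shows "D v (subst_monom W fs m) = (\<Sum>i<length fs. fscale (of_nat (Poly_Mapping.lookup m i))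
      (subst_monom W fs (m - Poly_Mapping.single i 1) * D v (fs ! i)))"
proof -
  let ?e = "\<lambda>i. Poly_Mapping.single i (1::nat)" and ?f = "subst_monom W fs"
  have "m \<in> exponents (length fs) \<longrightarrow> D v (?f m) =
    (\<Sum>i<length fs. fscale (of_nat (Poly_Mapping.lookup m i)) (?f (m - ?e i) * D v (fs ! i)))"
  proof (induction m rule: exponent_induct)
    case zero
    have "D v (?f 0) = 0" using D_cst[OF \<open>v \<in> W\<close>, of 1] by (simp add: subst_monom_0 cst_def)
    then show ?case by simp
  next
    case (add m i)
    show ?case
    proof
      assume *: "m + ?e i \<in> exponents (length fs)"
      have "Poly_Mapping.keys m \<subseteq> Poly_Mapping.keys (m + ?e i)" "i \<in> Poly_Mapping.keys (m + ?e i)"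
        by (auto simp: in_keys_iff lookup_add)
      then have m: "m \<in> exponents (length fs)" "i < length fs" using * by auto
      then have fi: "?f (?e i) = fs ! i"
        using assms(2)[of i] S_outside unfolding subst_monom_single by auto
      have "D v (?f (m + ?e i)) = D v (?f m) * fs ! i + ?f m * D v (fs ! i)"
        unfolding subst_monom_add fi using m assms by (intro D_mult subst_monom_in_S) auto
      also have "D v (?f m) * fs ! i =
          (\<Sum>j<length fs. fscale (of_nat (Poly_Mapping.lookup m j)) (?f (m + ?e i - ?e j) * D v (fs ! j)))"
        unfolding add[rule_format, OF m(1)] sum_distrib_right
      proof (rule sum.cong[OF refl])
        fix j
        show "fscale (of_nat (Poly_Mapping.lookup m j)) (?f (m - ?e j) * D v (fs ! j)) * fs ! i =
          fscale (of_nat (Poly_Mapping.lookup m j)) (?f (m + ?e i - ?e j) * D v (fs ! j))"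
        proof (cases "Poly_Mapping.lookup m j = 0")
          case False
          then have "m + ?e i - ?e j = (m - ?e j) + ?e i"
            by (intro poly_mapping_eqI) (auto simp: lookup_add lookup_minus lookup_single when_def)
          then show ?thesis by (simp add: subst_monom_add fi fscale_mult mult_ac del: One_nat_def)
        qed simp
      qed
      also have "?f m * D v (fs ! i) =
          (\<Sum>j<length fs. fscale (of_nat (if j = i then 1 else 0)) (?f (m + ?e i - ?e j) * D v (fs ! j)))"
      proof -
        have "(\<Sum>j<length fs. fscale (of_nat (if j = i then 1 else 0)) (?f (m + ?e i - ?e j) * D v (fs ! j))) =
          (\<Sum>j<length fs. if j = i then ?f m * D v (fs ! i) else 0)"
          by (intro sum.cong) auto
        then show ?thesis using m by simp
      qed
      finally show "D v (?f (m + ?e i)) = (\<Sum>j<length fs.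
          fscale (of_nat (Poly_Mapping.lookup (m + ?e i) j)) (?f (m + ?e i - ?e j) * D v (fs ! j)))"
        by (simp add: sum.distrib[symmetric] fv.scale_left_distrib[symmetric] lookup_add lookup_single when_def
            eq_commute[of i] del: One_nat_def)
    qed
  qed
  then show ?thesis using assms(1) by blast
qed

lemma D_poly_subst:
  assumes "p \<in> mpolys (length fs)" "\<And>i. i < length fs \<Longrightarrow> fs ! i \<in> S" "v \<in> W"
  shows "D v (poly_subst W fs p) = (\<Sum>i<length fs. poly_subst W fs (mpderiv i p) * D v (fs ! i))"
proof -
  let ?K = "Poly_Mapping.keys p" and ?l = "Poly_Mapping.lookup" and ?f = "subst_monom W fs"
  let ?e = "\<lambda>i. Poly_Mapping.single i (1::nat)"
  have mono: "m \<in> ?K \<Longrightarrow> ?f m \<in> S" for m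
    using assms by (intro subst_monom_in_S) (auto simp: mpolys_def)
  have "D v (poly_subst W fs p) = D v (\<Sum>m\<in>?K. fscale (?l p m) (?f m))"
    by (subst poly_subst_superset[of ?K]) auto
  also have "\<dots> = (\<Sum>m\<in>?K. D v (fscale (?l p m) (?f m)))"
    using mono assms(3) by (intro D_sum) (auto intro: S_scale)
  also have "\<dots> = (\<Sum>m\<in>?K. \<Sum>i<length fs. fscale (?l p m * of_nat (?l m i)) (?f (m - ?e i)) * D v (fs ! i))"
  proof (rule sum.cong[OF refl])
    fix m assume m: "m \<in> ?K"
    then have "m \<in> exponents (length fs)" using assms(1) by (auto simp: mpolys_def)
    then show "D v (fscale (?l p m) (?f m)) =
      (\<Sum>i<length fs. fscale (?l p m * of_nat (?l m i)) (?f (m - ?e i)) * D v (fs ! i))"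
      using mono[OF m] assms by (simp add: D_fscale D_subst_monom fv.scale_sum_right fscale_mult)
  qed
  also have "\<dots> = (\<Sum>i<length fs. \<Sum>m\<in>?K. fscale (?l p m * of_nat (?l m i)) (?f (m - ?e i)) * D v (fs ! i))"
    by (rule sum.swap)
  also have "\<dots> = (\<Sum>i<length fs. poly_subst W fs (mpderiv i p) * D v (fs ! i))"
    by (simp add: mpderiv_def poly_subst_sum poly_subst_single sum_distrib_right)
  finally show ?thesis .
qed

text \<open>Presents the polynomial functions by coordinates, so that the pullback from E to V can
  be computed on generators.\<close>

lemma S_eq_subst: "S = poly_subst W (map x [0..<r]) ` mpolys r"
proof (intro equalityI subsetI)
  fix f assume "f \<in> S"
  then show "f \<in> poly_subst W (map x [0..<r]) ` mpolys r"
  proof (induction rule: S_subalgebra_induct)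
    case (cst c)
    then show ?case using one_in_subst by (simp add: cst_def)
  next
    case (lin l)
    have "l = (\<Sum>k<r. fscale (l (b k)) (x k))" using lin by (rule DS_expand)
    also have "\<dots> \<in> poly_subst W (map x [0..<r]) ` mpolys r"
    proof (intro fv.subspace_sum[OF subst_subspace] fv.subspace_scale[OF subst_subspace])
      fix k assume "k \<in> {..<r}"
      then show "x k \<in> poly_subst W (map x [0..<r]) ` mpolys r"
        using nth_in_subst[of k r W "map x [0..<r]"] x_dual DS_outside by simp
    qed
    finally show ?case .
  next
    case (add f g)
    then show ?case by (intro fv.subspace_add[OF subst_subspace])
  next
    case (mult f g)
    then show ?case by (intro subst_mult_closed)
  qed
next
  fix f assume "f \<in> poly_subst W (map x [0..<r]) ` mpolys r"
  then show "f \<in> S" using poly_subst_in_S[of _ "map x [0..<r]"] x_dual DS_in_S by auto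
qed

end

section \<open>Finite linear groups\<close>

text \<open>The group is abstract and its action separate: G and N acting on V, G acting on E^* and
  on E, and H, whose elements are cosets, acting on E are all instances.\<close>

locale lin_group = polyspace scale W r b x + group K
  for scale :: "complex \<Rightarrow> 'a::ab_group_add \<Rightarrow> 'a" and W r b x
    and K :: "('g, 'z) monoid_scheme" +
  fixes act :: "'g \<Rightarrow> 'a \<Rightarrow> 'a"
  assumes fin: "finite (carrier K)"
    and act_in: "k \<in> carrier K \<Longrightarrow> w \<in> W \<Longrightarrow> act k w \<in> W"
    and act_one: "w \<in> W \<Longrightarrow> act \<one>\<^bsub>K\<^esub> w = w"
    and act_mult: "k \<in> carrier K \<Longrightarrow> l \<in> carrier K \<Longrightarrow> w \<in> W \<Longrightarrow> act (k \<otimes>\<^bsub>K\<^esub> l) w = act k (act l w)"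
    and act_add: "k \<in> carrier K \<Longrightarrow> v \<in> W \<Longrightarrow> w \<in> W \<Longrightarrow> act k (v + w) = act k v + act k w"
    and act_scale: "k \<in> carrier K \<Longrightarrow> w \<in> W \<Longrightarrow> act k (scale c w) = scale c (act k w)"
begin

abbreviation "fa \<equiv> fun_act K act W"

definition "R = invariants scale W K act"

text \<open>\<open>R0\<close> is the ideal R_+ of R, expressed by vanishing at the origin, and
  \<open>Z\<close> is its square. Homogeneous invariants that are independent modulo
  \<open>Z\<close> belong to a minimal system of generators.\<close>

definition "R0 = {f \<in> R. f 0 = 0}"

definition "I = fspan {f * h |f h. f \<in> S \<and> h \<in> R0}"

definition "Z = fspan {f * h |f h. f \<in> R0 \<and> h \<in> R0}"

definition "Avg f = fscale (1 / of_nat (card (carrier K))) (\<Sum>k\<in>carrier K. fa k f)"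

lemma act_inv: "k \<in> carrier K \<Longrightarrow> w \<in> W \<Longrightarrow> act (inv\<^bsub>K\<^esub> k) (act k w) = w"
    "k \<in> carrier K \<Longrightarrow> w \<in> W \<Longrightarrow> act k (act (inv\<^bsub>K\<^esub> k) w) = w"
  using act_mult[of "inv\<^bsub>K\<^esub> k" k w] act_mult[of k "inv\<^bsub>K\<^esub> k" w] act_one[of w] by simp_all

lemma act_0: "k \<in> carrier K \<Longrightarrow> act k 0 = 0"
  using act_scale[of k 0 0] by simp

lemma fa_Sd: "k \<in> carrier K \<Longrightarrow> f \<in> Sd d \<Longrightarrow> fa k f \<in> Sd d"
  unfolding fun_act_def by (rule comp_Sd) (auto simp: act_in act_add act_scale)

lemma fa_add: "fa k (f + g) = fa k f + fa k g"
  and fa_scale: "fa k (fscale c f) = fscale c (fa k f)"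
  and fa_mult: "fa k (f * g) = fa k f * fa k g"
  and fa_zero: "fa k 0 = 0"
  and fa_diff: "fa k (f - g) = fa k f - fa k g"
  by (auto simp: fun_act_def fun_eq_iff fun_ops)

lemma fa_sum: "fa k (\<Sum>i\<in>A. f i) = (\<Sum>i\<in>A. fa k (f i))"
  by (induction A rule: infinite_finite_induct) (auto simp: fa_zero fa_add)

lemma fa_S: "f \<in> S \<Longrightarrow> k \<in> carrier K \<Longrightarrow> fa k f \<in> S"
proof (induction rule: S_induct)
  case (Sd d f)
  then show ?case using fa_Sd Sd_in_S by blast
qed (auto simp: fa_add S_add)

lemma fa_comp: "k \<in> carrier K \<Longrightarrow> l \<in> carrier K \<Longrightarrow> fa k (fa l f) = fa (k \<otimes>\<^bsub>K\<^esub> l) f"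
  by (auto simp: fun_act_def fun_eq_iff inv_mult_group act_mult act_in)

lemma fa_one: "(\<And>w. w \<notin> W \<Longrightarrow> f w = 0) \<Longrightarrow> fa \<one>\<^bsub>K\<^esub> f = f"
  by (auto simp: fun_act_def fun_eq_iff act_one)

lemma fa_at_0: "k \<in> carrier K \<Longrightarrow> fa k f 0 = f 0"
  by (simp add: fun_act_def act_0)

lemma fa_hc: "f \<in> S \<Longrightarrow> k \<in> carrier K \<Longrightarrow> hc j (fa k f) = fa k (hc j f)"
proof (induction rule: S_induct)
  case (Sd d f)
  then show ?case using hc_Sd[OF Sd(1)] hc_Sd[OF fa_Sd[OF Sd(2,1)]] by (simp add: fa_zero)
next
  case (add f g)
  then show ?case by (simp add: fa_add hc_add fa_S)
qed

lemma R_iff: "f \<in> R \<longleftrightarrow> f \<in> S \<and> (\<forall>k\<in>carrier K. fa k f = f)"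
  by (simp add: R_def invariants_def)

lemma R_in_S: "f \<in> R \<Longrightarrow> f \<in> S"
  by (simp add: R_iff)

lemma R_subspace: "fv.subspace R"
  by (rule fv.subspaceI) (auto simp: R_iff fa_zero fa_add fa_scale S_add S_scale)

lemma R_mult: "f \<in> R \<Longrightarrow> g \<in> R \<Longrightarrow> f * g \<in> R"
  by (simp add: R_iff S_mult fa_mult)

lemma R_cst: "cst c \<in> R"
  unfolding R_iff using cst_in_S by (auto simp: fun_act_def cst_def fun_eq_iff act_in)

lemma R_hc: "f \<in> R \<Longrightarrow> hc j f \<in> R"
  using fa_hc[of f _ j] by (auto simp: R_iff intro: Sd_in_S[OF hc_in])

lemma R0_subspace: "fv.subspace R0"
  unfolding R0_def by (rule fv.subspaceI) (use R_subspace in \<open>auto simp: fun_ops fv.subspace_0 fv.subspace_add fv.subspace_scale\<close>)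

lemma R0_in_R: "f \<in> R0 \<Longrightarrow> f \<in> R"
  by (simp add: R0_def)

lemma R0_mult: "f \<in> R0 \<Longrightarrow> g \<in> R \<Longrightarrow> f * g \<in> R0" "f \<in> R \<Longrightarrow> g \<in> R0 \<Longrightarrow> f * g \<in> R0"
  by (auto simp: R0_def R_mult fun_ops)

lemma R0_Sd: "f \<in> R \<Longrightarrow> f \<in> Sd d \<Longrightarrow> d > 0 \<Longrightarrow> f \<in> R0"
  by (simp add: R0_def Sd_at_0)

lemma Z_R0: "f \<in> Z \<Longrightarrow> f \<in> R0"
proof -
  have "Z \<subseteq> R0" unfolding Z_def by (rule fv.span_minimal[OF _ R0_subspace]) (auto intro: R0_mult R0_in_R)
  then show "f \<in> Z \<Longrightarrow> f \<in> R0" by auto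
qed

lemma Z_subspace: "fv.subspace Z" and I_subspace: "fv.subspace I"
  by (simp_all add: Z_def I_def)

lemma Z_base: "f \<in> R0 \<Longrightarrow> g \<in> R0 \<Longrightarrow> f * g \<in> Z"
  unfolding Z_def by (rule fv.span_base) blast

lemma I_base: "f \<in> S \<Longrightarrow> h \<in> R0 \<Longrightarrow> f * h \<in> I"
  unfolding I_def by (rule fv.span_base) blast

lemma I_induct [consumes 1, case_names zero base add]:
  assumes "f \<in> I" "P 0" "\<And>f h. f \<in> S \<Longrightarrow> h \<in> R0 \<Longrightarrow> P (f * h)"
    "\<And>f g. f \<in> I \<Longrightarrow> g \<in> I \<Longrightarrow> P f \<Longrightarrow> P g \<Longrightarrow> P (f + g)"
  shows "P f"
proof -
  have "f \<in> I \<and> P f"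
    using assms(1) unfolding I_def
  proof (induction rule: fv.span_induct_alt)
    case base
    then show ?case using assms(2) fv.span_zero by simp
  next
    case (step c f g)
    then obtain f1 h where f: "f = f1 * h" "f1 \<in> S" "h \<in> R0" by auto
    then have "fscale c f = fscale c f1 * h" by (simp add: fscale_mult)
    then have "fscale c f \<in> I" "P (fscale c f)" using f assms(3) I_base S_scale by auto
    then show ?case using step assms(4) fv.subspace_add[OF I_subspace] by (simp add: I_def[symmetric])
  qed
  then show ?thesis by simp
qed

lemma I_in_S: "f \<in> I \<Longrightarrow> f \<in> S"
  by (induction rule: I_induct) (auto simp: S_add intro: S_mult R_in_S R0_in_R)

lemma I_fa: "f \<in> I \<Longrightarrow> k \<in> carrier K \<Longrightarrow> fa k f \<in> I"
proof (induction rule: I_induct)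
  case zero
  then show ?case using fv.subspace_0[OF I_subspace] by (simp add: fa_zero)
next
  case (base f h)
  then have "fa k h = h" by (auto simp: R0_def R_iff)
  then show ?case using base I_base[of "fa k f" h] fa_S by (simp add: fa_mult)
next
  case (add f g)
  then show ?case by (simp add: fa_add fv.subspace_add[OF I_subspace])
qed

lemma R0_expand: "h \<in> R0 \<Longrightarrow> \<exists>n. h = (\<Sum>d\<in>{0<..<n}. hc d h)"
proof -
  assume h: "h \<in> R0"
  then have hS: "h \<in> S" "h 0 = 0" by (auto simp: R0_def R_iff)
  obtain n where n: "h = (\<Sum>d<n. hc d h)" using hc_expand[OF hS(1)] by blast
  have "(\<Sum>d<n. hc d h) = (\<Sum>d\<in>{0<..<n}. hc d h)"
    using hc_0_eq_0[OF hS] by (intro sum.mono_neutral_right) auto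
  then show ?thesis using n by metis
qed

text \<open>The homogeneous components of an invariant are invariant, so the homogeneous invariants
  of positive degree generate the same ideal as all invariants vanishing at 0.\<close>

lemma I_eq: "coinv_ideal scale W K act = I"
proof
  show "coinv_ideal scale W K act \<subseteq> I"
    unfolding coinv_ideal_def I_def using R0_Sd unfolding R_def by (intro fv.span_mono) blast
  show "I \<subseteq> coinv_ideal scale W K act"
    unfolding I_def
  proof (rule fv.span_minimal)
    show "fv.subspace (coinv_ideal scale W K act)" by (simp add: coinv_ideal_def)
    show "{f * h |f h. f \<in> S \<and> h \<in> R0} \<subseteq> coinv_ideal scale W K act"
    proof clarify
      fix f h assume fh: "f \<in> S" "h \<in> R0"
      then obtain n where n: "h = (\<Sum>d\<in>{0<..<n}. hc d h)" using R0_expand by blast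
      have "f * h = (\<Sum>d\<in>{0<..<n}. f * hc d h)" by (subst n) (simp add: sum_distrib_left)
      also have "\<dots> \<in> coinv_ideal scale W K act"
        unfolding coinv_ideal_def
      proof (intro fv.span_sum fv.span_base)
        fix d assume "d \<in> {0<..<n}"
        moreover have "hc d h \<in> invariants scale W K act \<inter> Sd d"
          using fh R_hc R_in_S hc_in unfolding R0_def R_def by blast
        ultimately show "f * hc d h \<in> {f * h |f h d. f \<in> S \<and> 0 < d \<and> h \<in> invariants scale W K act \<inter> Sd d}"
          using fh by auto
      qed
      finally show "f * h \<in> coinv_ideal scale W K act" .
    qed
  qed
qed

lemma I_hc: "f \<in> I \<Longrightarrow> hc j f \<in> I"
proof (induction rule: I_induct)
  case zero
  then show ?case using fv.subspace_0[OF I_subspace] by simp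
next
  case (base f h)
  then obtain n where n: "h = (\<Sum>d\<in>{0<..<n}. hc d h)" using R0_expand by blast
  have hS: "h \<in> S" using base by (auto intro: R_in_S R0_in_R)
  have "hc j (f * h) = hc j (\<Sum>d\<in>{0<..<n}. f * hc d h)"
    by (subst n) (simp add: sum_distrib_left)
  also have "\<dots> = (\<Sum>d\<in>{0<..<n}. hc j (f * hc d h))"
    using base hS by (intro hc_sum) (auto intro!: S_mult Sd_in_S[OF hc_in])
  also have "\<dots> \<in> I"
  proof (intro fv.subspace_sum[OF I_subspace])
    fix d assume d: "d \<in> {0<..<n}"
    have "hc d h \<in> R0" using d base hS R_hc[of h d] hc_in[of h d] R0_Sd R0_in_R by auto
    then show "hc j (f * hc d h) \<in> I"
      using hc_mult[OF base(1) hc_in[OF hS]] I_base[OF Sd_in_S[OF hc_in[OF base(1)]]]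
        fv.subspace_0[OF I_subspace] by auto
  qed
  finally show ?case .
next
  case (add f g)
  then show ?case by (simp add: hc_add I_in_S fv.subspace_add[OF I_subspace])
qed

lemma card_K: "card (carrier K) > 0"
  using fin by (auto simp: card_gt_0_iff)

lemma Avg_add: "Avg (f + g) = Avg f + Avg g"
  and Avg_scale: "Avg (fscale c f) = fscale c (Avg f)"
  and Avg_zero: "Avg 0 = 0"
  by (simp_all add: Avg_def fa_add fa_scale fa_zero fa_diff sum.distrib sum_subtractf fv.scale_right_distrib
      fv.scale_right_diff_distrib fv.scale_sum_right mult.commute)

lemma Avg_sum: "Avg (\<Sum>i\<in>A. f i) = (\<Sum>i\<in>A. Avg (f i))"
  by (induction A rule: infinite_finite_induct) (auto simp: Avg_zero Avg_add)

lemma Avg_S: "f \<in> S \<Longrightarrow> Avg f \<in> S"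
  unfolding Avg_def by (intro S_scale S_sum fa_S)

lemma Avg_in_R: "f \<in> S \<Longrightarrow> Avg f \<in> R"
proof -
  assume f: "f \<in> S"
  have "fa l (Avg f) = Avg f" if l: "l \<in> carrier K" for l
  proof -
    have "(\<Sum>k\<in>carrier K. fa l (fa k f)) = (\<Sum>k\<in>carrier K. fa (l \<otimes>\<^bsub>K\<^esub> k) f)"
      using l by (intro sum.cong) (auto simp: fa_comp)
    also have "\<dots> = (\<Sum>k\<in>(\<lambda>k. l \<otimes>\<^bsub>K\<^esub> k) ` carrier K. fa k f)"
      by (rule sum.reindex_cong[symmetric, OF inj_on_cmult[OF l] refl]) auto
    also have "(\<lambda>k. l \<otimes>\<^bsub>K\<^esub> k) ` carrier K = carrier K" by (rule surj_const_mult[OF l])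
    finally show ?thesis by (simp add: Avg_def fa_scale fa_sum)
  qed
  then show ?thesis using f Avg_S by (simp add: R_iff)
qed

lemma Avg_fa: "l \<in> carrier K \<Longrightarrow> Avg (fa l f) = Avg f"
proof -
  assume l: "l \<in> carrier K"
  have "(\<Sum>k\<in>carrier K. fa k (fa l f)) = (\<Sum>k\<in>carrier K. fa (k \<otimes>\<^bsub>K\<^esub> l) f)"
    using l by (intro sum.cong) (auto simp: fa_comp)
  also have "\<dots> = (\<Sum>k\<in>carrier K. fa k f)"
  proof (rule sum.reindex_bij_witness[of _ "\<lambda>k. k \<otimes>\<^bsub>K\<^esub> inv\<^bsub>K\<^esub> l" "\<lambda>k. k \<otimes>\<^bsub>K\<^esub> l"])
  qed (use l in \<open>auto simp: m_assoc\<close>)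
  finally show ?thesis by (simp add: Avg_def)
qed

lemma Avg_mult: "h \<in> R \<Longrightarrow> Avg (f * h) = Avg f * h"
  by (simp add: Avg_def fa_mult R_iff sum_distrib_right fscale_mult)

lemma sum_constant_fscale: "(\<Sum>i\<in>A. f) = fscale (of_nat (card A)) f"
  by (rule fv.sum_constant_scale)

lemma Avg_R: "h \<in> R \<Longrightarrow> Avg h = h"
  using card_K by (simp add: Avg_def R_iff sum_constant_fscale del: sum_constant)

lemma Avg_at_0: "Avg f 0 = f 0"
  using card_K by (simp add: Avg_def fun_ops fa_at_0)

text \<open>For a generator \<open>f * h\<close> of \<open>I\<close> the average of
  \<open>y * (f * h)\<close> is \<open>Avg (y * f) * h\<close>, and the first factor vanishes at 0
  because \<open>y\<close> does.\<close>

lemma Avg_I_Z: "p \<in> I \<Longrightarrow> y \<in> S \<Longrightarrow> y 0 = 0 \<Longrightarrow> Avg (y * p) \<in> Z"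
proof (induction p rule: I_induct)
  case (base f h)
  then have "Avg (y * f) \<in> R0"
    by (auto simp: R0_def Avg_in_R S_mult Avg_at_0 fun_ops)
  moreover have "Avg (y * (f * h)) = Avg (y * f) * h"
    using base by (simp add: mult.assoc[symmetric] Avg_mult R0_in_R)
  ultimately show ?case using base Z_base by simp
qed (auto simp: Avg_zero distrib_left Avg_add fv.subspace_0[OF Z_subspace] fv.subspace_add[OF Z_subspace])

text \<open>Contracting with the Euler vector field turns \<open>\<omega> j\<close>, the differential of \<open>G j\<close>, back into a
  multiple of \<open>G j\<close>, and averaging sends the products of \<open>y l\<close> with \<open>I\<close> into \<open>Z\<close>.\<close>

lemma euler_independent:
  assumes "finite J" "finite L" and G: "\<And>j. j \<in> J \<Longrightarrow> G j \<in> R"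
    and ind: "\<And>c. (\<Sum>j\<in>J. fscale (c j) (G j)) \<in> Z \<Longrightarrow> \<forall>j\<in>J. c j = 0"
    and y: "\<And>l. l \<in> L \<Longrightarrow> y l \<in> S" "\<And>l. l \<in> L \<Longrightarrow> y l 0 = 0"
    and eul: "\<And>j. j \<in> J \<Longrightarrow> (\<Sum>l\<in>L. y l * \<omega> j l) = fscale (\<kappa> j) (G j)" "\<And>j. j \<in> J \<Longrightarrow> \<kappa> j \<noteq> 0"
    and c: "\<And>l. l \<in> L \<Longrightarrow> (\<Sum>j\<in>J. fscale (c j) (\<omega> j l)) \<in> I"
  shows "\<forall>j\<in>J. c j = 0"
proof -
  have "(\<Sum>l\<in>L. y l * (\<Sum>j\<in>J. fscale (c j) (\<omega> j l))) = (\<Sum>j\<in>J. fscale (c j) (\<Sum>l\<in>L. y l * \<omega> j l))"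
    by (simp add: sum_distrib_left fv.scale_sum_right fscale_mult) (rule sum.swap)
  also have "\<dots> = (\<Sum>j\<in>J. fscale (c j * \<kappa> j) (G j))"
    using eul by (intro sum.cong) auto
  finally have eq: "(\<Sum>l\<in>L. y l * (\<Sum>j\<in>J. fscale (c j) (\<omega> j l))) = (\<Sum>j\<in>J. fscale (c j * \<kappa> j) (G j))" .
  have "(\<Sum>j\<in>J. fscale (c j * \<kappa> j) (G j)) \<in> R"
    using G by (intro fv.subspace_sum[OF R_subspace] fv.subspace_scale[OF R_subspace])
  then have "(\<Sum>j\<in>J. fscale (c j * \<kappa> j) (G j)) = Avg (\<Sum>l\<in>L. y l * (\<Sum>j\<in>J. fscale (c j) (\<omega> j l)))"
    by (simp add: eq Avg_R)
  also have "\<dots> \<in> Z"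
    unfolding Avg_sum using y c by (intro fv.subspace_sum[OF Z_subspace] Avg_I_Z)
  finally have "\<forall>j\<in>J. c j * \<kappa> j = 0" by (rule ind)
  then show ?thesis using eul(2) by auto
qed

text \<open>The group carries a line with direction \<open>w\<close> to a line with direction
  \<open>act k w\<close>, and an invariant has the same restriction to both.\<close>

lemma D_equivariant:
  assumes "f \<in> R" "w \<in> W" "k \<in> carrier K"
  shows "fa k (D w f) = D (act k w) f"
proof
  fix u
  show "fa k (D w f) u = D (act k w) f u"
  proof (cases "u \<in> W")
    case True
    let ?k = "inv\<^bsub>K\<^esub> k"
    have u: "act ?k u \<in> W" using True assms act_in by auto
    have "line_poly f (act ?k u) w = line_poly f u (act k w)"
    proof (rule line_poly_eqI)
      fix t
      have "poly (line_poly f u (act k w)) t = f (u + scale t (act k w))"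
        using assms True by (intro poly_line_poly) (auto simp: R_in_S act_in)
      also have "\<dots> = fa k f (u + scale t (act k w))" using assms by (simp add: R_iff)
      also have "\<dots> = f (act ?k (u + scale t (act k w)))"
        using assms True by (simp add: fun_act_def W_add W_scale act_in)
      also have "act ?k (u + scale t (act k w)) = act ?k u + scale t w"
        using assms True by (simp add: act_add act_scale act_in W_scale act_inv)
      finally show "poly (line_poly f u (act k w)) t = f (act ?k u + scale t w)" .
    qed
    then show ?thesis using True u by (simp add: D_def fun_act_def)
  next
    case False
    then show ?thesis by (simp add: D_def fun_act_def)
  qed
qed

end

section \<open>Multiplicities in the coinvariants\<close>

locale equivariant_module = lin_group scale W r b x K act + M: lin_group scaleM M n bM xM K actM
  for scale :: "complex \<Rightarrow> 'a::ab_group_add \<Rightarrow> 'a" and W r b x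
    and K :: "('g, 'z) monoid_scheme" and act
    and scaleM :: "complex \<Rightarrow> 'm::ab_group_add \<Rightarrow> 'm" and M n bM xM and actM
begin

text \<open>Genuine equivariant maps into polynomials. They stand in for the maps into classes
  modulo \<open>I\<close> that \<open>coinv_homs\<close> consists of.\<close>

definition hom_space :: "nat \<Rightarrow> ('m \<Rightarrow> 'a \<Rightarrow> complex) set" where
  "hom_space j = {\<omega>. (\<forall>m\<in>M. \<omega> m \<in> Sd j) \<and> (\<forall>m\<in>M. \<forall>m'\<in>M. \<omega> (m + m') = \<omega> m + \<omega> m') \<and>
     (\<forall>c. \<forall>m\<in>M. \<omega> (scaleM c m) = fscale c (\<omega> m)) \<and>
     (\<forall>k\<in>carrier K. \<forall>m\<in>M. fa k (\<omega> m) = \<omega> (actM k m))}"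

definition coset :: "nat \<Rightarrow> ('a \<Rightarrow> complex) \<Rightarrow> ('a \<Rightarrow> complex) set" where
  "coset j f = {h \<in> Sd j. h - f \<in> I}"

definition quot_hom :: "nat \<Rightarrow> ('m \<Rightarrow> 'a \<Rightarrow> complex) \<Rightarrow> 'm \<Rightarrow> ('a \<Rightarrow> complex) set" where
  "quot_hom j \<omega> = (\<lambda>m. if m \<in> M then coset j (\<omega> m) else {})"

definition indep :: "('m \<Rightarrow> 'a \<Rightarrow> complex) list \<Rightarrow> bool" where
  "indep \<omega>s \<longleftrightarrow> (\<forall>c. (\<forall>m\<in>M. (\<Sum>i<length \<omega>s. fscale (c i) ((\<omega>s ! i) m)) \<in> I) \<longrightarrow> (\<forall>i<length \<omega>s. c i = 0))"

abbreviation "homs \<equiv> coinv_homs scale W K act scaleM M actM"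
abbreviation "homs_basis \<equiv> coinv_homs_basis scale W K act scaleM M actM"

lemmas I_0 = fv.subspace_0[OF I_subspace]
  and I_add = fv.subspace_add[OF I_subspace]
  and I_scale = fv.subspace_scale[OF I_subspace]
  and I_diff = fv.subspace_diff[OF I_subspace]
  and I_neg = fv.subspace_neg[OF I_subspace]
  and I_sum = fv.subspace_sum[OF I_subspace]

lemma coset_self: "f \<in> Sd j \<Longrightarrow> f \<in> coset j f"
  by (simp add: coset_def I_0)

lemma coset_cong: "f \<in> coset j g \<Longrightarrow> coset j f = coset j g"
proof -
  assume f: "f \<in> coset j g"
  then have fg: "f - g \<in> I" by (simp add: coset_def)
  have "h - f \<in> I \<longleftrightarrow> h - g \<in> I" for h
    using I_add[OF _ fg, of "h - f"] I_diff[OF _ fg, of "h - g"] by auto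
  then show ?thesis by (auto simp: coset_def)
qed

lemma coinv_eq: "coinv scale W K act j = coset j ` Sd j"
  unfolding coinv_def quotient_def coset_def I_eq by auto

lemma hom_spaceD:
  assumes "\<omega> \<in> hom_space j"
  shows "m \<in> M \<Longrightarrow> \<omega> m \<in> Sd j" "m \<in> M \<Longrightarrow> m' \<in> M \<Longrightarrow> \<omega> (m + m') = \<omega> m + \<omega> m'"
    "m \<in> M \<Longrightarrow> \<omega> (scaleM c m) = fscale c (\<omega> m)"
    "k \<in> carrier K \<Longrightarrow> m \<in> M \<Longrightarrow> fa k (\<omega> m) = \<omega> (actM k m)"
  using assms by (auto simp: hom_space_def)

lemma hom_space_0: "0 \<in> hom_space j"
  by (auto simp: hom_space_def zero_fun_apply fa_zero)

lemma quot_hom_in: "\<omega> \<in> hom_space j \<Longrightarrow> quot_hom j \<omega> \<in> homs j"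
proof -
  assume \<omega>: "\<omega> \<in> hom_space j"
  note D = hom_spaceD[OF \<omega>]
  have "f + f' \<in> coset j (\<omega> (m + m'))" if "m \<in> M" "m' \<in> M" "f \<in> coset j (\<omega> m)" "f' \<in> coset j (\<omega> m')" for f f' m m'
    using that I_add[of "f - \<omega> m" "f' - \<omega> m'"] by (auto simp: coset_def Sd_add D algebra_simps)
  moreover have "fscale c f \<in> coset j (\<omega> (scaleM c m))" if "m \<in> M" "f \<in> coset j (\<omega> m)" for c f m
    using that I_scale[of "f - \<omega> m" c] by (auto simp: coset_def Sd_scale D fv.scale_right_diff_distrib)
  moreover have "fa k f \<in> coset j (\<omega> (actM k m))" if "k \<in> carrier K" "m \<in> M" "f \<in> coset j (\<omega> m)" for k f m
    using that I_fa[of "f - \<omega> m" k] by (auto simp: coset_def fa_Sd D(4)[symmetric] fa_diff)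
  ultimately show ?thesis
    using D(1) by (auto simp: coinv_homs_def coinv_eq quot_hom_def M.W_add M.W_scale M.act_in)
qed

text \<open>A linear lift \<open>\<omega>0\<close> is determined by representatives chosen on the
  basis of \<open>M\<close>, and averaging over the group makes it equivariant. Averaging stays in
  the prescribed classes because \<open>I\<close> is a stable subspace.\<close>

lemma quot_hom_ex:
  assumes \<Phi>: "\<Phi> \<in> homs j"
  shows "\<exists>\<omega>\<in>hom_space j. \<Phi> = quot_hom j \<omega>"
proof -
  have cls: "\<exists>f\<in>Sd j. \<Phi> m = coset j f" if "m \<in> M" for m
  proof -
    have "\<Phi> m \<in> coset j ` Sd j" using \<Phi> that by (simp add: coinv_homs_def coinv_eq)
    then show ?thesis by (rule imageE) blast
  qed
  have out: "m \<notin> M \<Longrightarrow> \<Phi> m = {}" for m using \<Phi> by (auto simp: coinv_homs_def)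
  have add: "m \<in> M \<Longrightarrow> m' \<in> M \<Longrightarrow> f \<in> \<Phi> m \<Longrightarrow> f' \<in> \<Phi> m' \<Longrightarrow> f + f' \<in> \<Phi> (m + m')" for f f' m m'
    using \<Phi> by (auto simp: coinv_homs_def)
  have scl: "m \<in> M \<Longrightarrow> f \<in> \<Phi> m \<Longrightarrow> fscale c f \<in> \<Phi> (scaleM c m)" for c f m
    using \<Phi> by (auto simp: coinv_homs_def)
  have eqv: "k \<in> carrier K \<Longrightarrow> m \<in> M \<Longrightarrow> f \<in> \<Phi> m \<Longrightarrow> fa k f \<in> \<Phi> (actM k m)" for k f m
    using \<Phi> by (auto simp: coinv_homs_def)
  have "\<exists>f. f \<in> \<Phi> m" if "m \<in> M" for m using cls[OF that] coset_self by auto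
  then obtain F where F: "\<And>m. m \<in> M \<Longrightarrow> F m \<in> \<Phi> m" by metis
  define \<omega>0 where "\<omega>0 m = (\<Sum>k<n. fscale (xM k m) (F (bM k)))" for m
  have "(\<Sum>k<l. fscale (c k) (F (bM k))) \<in> \<Phi> (\<Sum>k<l. scaleM (c k) (bM k)) \<and>
      (\<Sum>k<l. scaleM (c k) (bM k)) \<in> M" if "l \<le> n" for l c
    using that
  proof (induction l)
    case 0
    have "fscale 0 (F 0) \<in> \<Phi> (scaleM 0 0)" by (rule scl[OF M.W_zero F[OF M.W_zero]])
    then show ?case by simp
  next
    case (Suc l)
    then have "bM l \<in> M" using M.b_in by simp
    then show ?case using Suc by (auto intro!: add scl F M.W_add M.W_scale)
  qed
  then have \<omega>0: "\<omega>0 m \<in> \<Phi> m" if "m \<in> M" for m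
    using M.expand[OF that] unfolding \<omega>0_def by (metis order_refl)
  define \<omega> where "\<omega> m = fscale (1 / of_nat (card (carrier K))) (\<Sum>k\<in>carrier K. fa k (\<omega>0 (actM (inv\<^bsub>K\<^esub> k) m)))" for m
  have \<omega>: "\<omega> m \<in> \<Phi> m" if m: "m \<in> M" for m
  proof -
    obtain f where f: "f \<in> Sd j" "\<Phi> m = coset j f" using cls[OF m] by blast
    have t: "fa k (\<omega>0 (actM (inv\<^bsub>K\<^esub> k) m)) \<in> coset j f" if "k \<in> carrier K" for k
      using eqv[OF that _ \<omega>0, of "actM (inv\<^bsub>K\<^esub> k) m"] that m by (simp add: f M.act_in M.act_inv)
    have "\<omega> m - f = fscale (1 / of_nat (card (carrier K))) (\<Sum>k\<in>carrier K. fa k (\<omega>0 (actM (inv\<^bsub>K\<^esub> k) m)) - f)"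
      using card_K by (simp add: \<omega>_def sum_subtractf fv.scale_right_diff_distrib sum_constant_fscale del: sum_constant)
    also have "\<dots> \<in> I" using t by (intro I_scale I_sum) (auto simp: coset_def)
    finally have "\<omega> m - f \<in> I" .
    moreover have "\<omega> m \<in> Sd j" unfolding \<omega>_def using t
      by (intro Sd_scale fv.subspace_sum[OF Sd_subspace]) (auto simp: coset_def)
    ultimately show ?thesis by (simp add: f coset_def)
  qed
  have "\<omega> \<in> hom_space j"
    unfolding hom_space_def
  proof (intro CollectI conjI ballI allI)
    fix m assume m: "m \<in> M"
    show "\<omega> m \<in> Sd j" using \<omega>[OF m] cls[OF m] by (auto simp: coset_def)
    fix c
    have "\<omega>0 (scaleM c m) = fscale c (\<omega>0 m)" if "m \<in> M" for m
      using that M.x_dual by (auto simp: \<omega>0_def M.DS_scale fv.scale_sum_right intro!: sum.cong)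
    then show "\<omega> (scaleM c m) = fscale c (\<omega> m)"
      using m by (simp add: \<omega>_def M.act_scale M.act_in fa_scale fv.scale_sum_right mult.commute)
  next
    fix m m' assume m: "m \<in> M" "m' \<in> M"
    have "\<omega>0 (m + m') = \<omega>0 m + \<omega>0 m'" if "m \<in> M" "m' \<in> M" for m m'
      using that M.x_dual by (auto simp: \<omega>0_def M.DS_add sum.distrib[symmetric] fv.scale_left_distrib intro!: sum.cong)
    then show "\<omega> (m + m') = \<omega> m + \<omega> m'"
      using m by (simp add: \<omega>_def M.act_add M.act_in fa_add sum.distrib fv.scale_right_distrib)
  next
    fix l m assume l: "l \<in> carrier K" and m: "m \<in> M"
    have "(\<Sum>k\<in>carrier K. fa (l \<otimes>\<^bsub>K\<^esub> k) (\<omega>0 (actM (inv\<^bsub>K\<^esub> k) m))) =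
        (\<Sum>k\<in>carrier K. fa k (\<omega>0 (actM (inv\<^bsub>K\<^esub> k) (actM l m))))"
    proof (rule sum.reindex_bij_witness[of _ "\<lambda>k. inv\<^bsub>K\<^esub> l \<otimes>\<^bsub>K\<^esub> k" "\<lambda>k. l \<otimes>\<^bsub>K\<^esub> k"])
      fix k assume k: "k \<in> carrier K"
      show "inv\<^bsub>K\<^esub> l \<otimes>\<^bsub>K\<^esub> (l \<otimes>\<^bsub>K\<^esub> k) = k" "l \<otimes>\<^bsub>K\<^esub> (inv\<^bsub>K\<^esub> l \<otimes>\<^bsub>K\<^esub> k) = k"
        using k l by (simp_all add: m_assoc[symmetric])
      have "actM (inv\<^bsub>K\<^esub> (l \<otimes>\<^bsub>K\<^esub> k)) (actM l m) = actM (inv\<^bsub>K\<^esub> k) m"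
        using k l m by (simp add: inv_mult_group M.act_mult M.act_in M.act_inv)
      then show "fa (l \<otimes>\<^bsub>K\<^esub> k) (\<omega>0 (actM (inv\<^bsub>K\<^esub> (l \<otimes>\<^bsub>K\<^esub> k)) (actM l m))) = fa (l \<otimes>\<^bsub>K\<^esub> k) (\<omega>0 (actM (inv\<^bsub>K\<^esub> k) m))"
        by simp
    qed (use l in auto)
    then show "fa l (\<omega> m) = \<omega> (actM l m)"
      using l by (simp add: \<omega>_def fa_scale fa_sum fa_comp)
  qed
  moreover have "\<Phi> = quot_hom j \<omega>"
  proof
    fix m show "\<Phi> m = quot_hom j \<omega> m"
    proof (cases "m \<in> M")
      case True
      then show ?thesis using cls[OF True] \<omega>[OF True] coset_cong by (auto simp: quot_hom_def)
    qed (simp add: out quot_hom_def)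
  qed
  ultimately show ?thesis by blast
qed

lemma homs_eq: "homs j = quot_hom j ` hom_space j"
  using quot_hom_in quot_hom_ex by blast

definition hom_basis :: "nat \<Rightarrow> ('m \<Rightarrow> 'a \<Rightarrow> complex) list \<Rightarrow> bool" where
  "hom_basis j \<omega>s \<longleftrightarrow> (\<forall>\<omega>\<in>hom_space j. \<exists>!cs. length cs = length \<omega>s \<and>
     (\<forall>m\<in>M. (\<Sum>i<length \<omega>s. fscale (cs ! i) ((\<omega>s ! i) m)) - \<omega> m \<in> I))"

lemma homs_basis_iff:
  assumes \<omega>s: "set \<omega>s \<subseteq> hom_space j"
  shows "homs_basis j (map (quot_hom j) \<omega>s) \<longleftrightarrow> hom_basis j \<omega>s"
proof -
  have eq: "(\<forall>m\<in>M. \<forall>fs. length fs = length \<omega>s \<and> (\<forall>i<length \<omega>s. fs ! i \<in> (map (quot_hom j) \<omega>s ! i) m) \<longrightarrow>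
        (\<Sum>i<length \<omega>s. fscale (cs ! i) (fs ! i)) \<in> quot_hom j \<omega> m) \<longleftrightarrow>
      (\<forall>m\<in>M. (\<Sum>i<length \<omega>s. fscale (cs ! i) ((\<omega>s ! i) m)) - \<omega> m \<in> I)" (is "?A \<longleftrightarrow> ?B")
    if \<omega>: "\<omega> \<in> hom_space j" for \<omega> cs
  proof (intro iffI ballI allI impI; (elim conjE)?)
    fix m assume A: ?A and m: "m \<in> M"
    have "\<forall>i<length \<omega>s. map (\<lambda>\<omega>. \<omega> m) \<omega>s ! i \<in> (map (quot_hom j) \<omega>s ! i) m"
    proof (intro allI impI)
      fix i assume i: "i < length \<omega>s"
      then have "\<omega>s ! i \<in> hom_space j" using \<omega>s by auto
      from coset_self[OF hom_spaceD(1)[OF this m]]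
      show "map (\<lambda>\<omega>. \<omega> m) \<omega>s ! i \<in> (map (quot_hom j) \<omega>s ! i) m"
        using m i by (simp add: quot_hom_def)
    qed
    then have "(\<Sum>i<length \<omega>s. fscale (cs ! i) (map (\<lambda>\<omega>. \<omega> m) \<omega>s ! i)) \<in> quot_hom j \<omega> m"
      by (intro A[rule_format, OF m] conjI) simp_all
    then have "(\<Sum>i<length \<omega>s. fscale (cs ! i) (map (\<lambda>\<omega>. \<omega> m) \<omega>s ! i)) - \<omega> m \<in> I"
      using m by (simp add: quot_hom_def coset_def)
    then show "(\<Sum>i<length \<omega>s. fscale (cs ! i) ((\<omega>s ! i) m)) - \<omega> m \<in> I" by simp
  next
    fix m fs assume B: ?B and m: "m \<in> M" and fs: "length fs = length \<omega>s"
      "\<forall>i<length \<omega>s. fs ! i \<in> (map (quot_hom j) \<omega>s ! i) m"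
    have f: "fs ! i \<in> Sd j" "fs ! i - (\<omega>s ! i) m \<in> I" if "i < length \<omega>s" for i
      using fs(2) that m by (auto simp: quot_hom_def coset_def)
    have "(\<Sum>i<length \<omega>s. fscale (cs ! i) (fs ! i)) - \<omega> m =
      (\<Sum>i<length \<omega>s. fscale (cs ! i) (fs ! i - (\<omega>s ! i) m)) + ((\<Sum>i<length \<omega>s. fscale (cs ! i) ((\<omega>s ! i) m)) - \<omega> m)"
      by (simp add: fv.scale_right_diff_distrib sum_subtractf)
    also have "\<dots> \<in> I" using B m f by (intro I_add I_sum I_scale) auto
    finally show "(\<Sum>i<length \<omega>s. fscale (cs ! i) (fs ! i)) \<in> quot_hom j \<omega> m"
      using m f by (auto simp: quot_hom_def coset_def intro!: fv.subspace_sum[OF Sd_subspace] Sd_scale)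
  qed
  have "set (map (quot_hom j) \<omega>s) \<subseteq> homs j" using \<omega>s homs_eq by auto
  then have "homs_basis j (map (quot_hom j) \<omega>s) \<longleftrightarrow> (\<forall>\<omega>\<in>hom_space j. \<exists>!cs. length cs = length \<omega>s \<and>
      (\<forall>m\<in>M. \<forall>fs. length fs = length \<omega>s \<and> (\<forall>i<length \<omega>s. fs ! i \<in> (map (quot_hom j) \<omega>s ! i) m) \<longrightarrow>
        (\<Sum>i<length \<omega>s. fscale (cs ! i) (fs ! i)) \<in> quot_hom j \<omega> m))"
    by (simp only: coinv_homs_basis_def homs_eq length_map ball_simps simp_thms)
  also have "\<dots> \<longleftrightarrow> hom_basis j \<omega>s"
    unfolding hom_basis_def by (intro ball_cong refl) (simp only: eq)
  finally show ?thesis .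
qed

lemma indepD: "indep \<omega>s \<Longrightarrow> (\<And>m. m \<in> M \<Longrightarrow> (\<Sum>i<length \<omega>s. fscale (c i) ((\<omega>s ! i) m)) \<in> I) \<Longrightarrow>
    i < length \<omega>s \<Longrightarrow> c i = 0"
  unfolding indep_def by blast

text \<open>Uniqueness of the coefficients that express the zero map.\<close>

lemma hom_basis_indep: "hom_basis j \<omega>s \<Longrightarrow> indep \<omega>s"
  unfolding indep_def
proof (intro allI impI)
  fix c i assume B: "hom_basis j \<omega>s" and c: "\<forall>m\<in>M. (\<Sum>i<length \<omega>s. fscale (c i) ((\<omega>s ! i) m)) \<in> I"
    and i: "i < length \<omega>s"
  obtain cs where cs: "\<And>ds. length ds = length \<omega>s \<Longrightarrow>
      (\<forall>m\<in>M. (\<Sum>i<length \<omega>s. fscale (ds ! i) ((\<omega>s ! i) m)) - 0 m \<in> I) \<Longrightarrow> ds = cs"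
    using B hom_space_0[of j] unfolding hom_basis_def by blast
  have "map c [0..<length \<omega>s] = cs" by (rule cs) (use c in \<open>simp_all add: zero_fun_apply\<close>)
  moreover have "map (\<lambda>_. 0) [0..<length \<omega>s] = cs" by (rule cs) (simp_all add: zero_fun_apply I_0)
  ultimately have "map c [0..<length \<omega>s] = map (\<lambda>_. 0) [0..<length \<omega>s]" by (rule trans[OF _ sym])
  then show "c i = 0" using i by auto
qed

lemma indep_hom_basis:
  assumes \<omega>s: "set \<omega>s \<subseteq> hom_space j" "indep \<omega>s"
    and max: "\<And>\<psi>s. set \<psi>s \<subseteq> hom_space j \<Longrightarrow> indep \<psi>s \<Longrightarrow> length \<psi>s \<le> length \<omega>s"
  shows "hom_basis j \<omega>s"
  unfolding hom_basis_def
proof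
  fix \<omega> assume \<omega>: "\<omega> \<in> hom_space j"
  have "\<not> indep (\<omega> # \<omega>s)" using max[of "\<omega> # \<omega>s"] \<omega>s \<omega> by auto
  then obtain c i where c: "\<And>m. m \<in> M \<Longrightarrow> (\<Sum>i<Suc (length \<omega>s). fscale (c i) (((\<omega> # \<omega>s) ! i) m)) \<in> I"
      "i < Suc (length \<omega>s)" "c i \<noteq> 0"
    unfolding indep_def by auto
  have c1: "fscale (c 0) (\<omega> m) + (\<Sum>i<length \<omega>s. fscale (c (Suc i)) ((\<omega>s ! i) m)) \<in> I" if "m \<in> M" for m
    using c(1)[OF that] by (simp only: sum.lessThan_Suc_shift nth_Cons_0 nth_Cons_Suc)
  have "c 0 \<noteq> 0"
  proof
    assume "c 0 = 0"
    then have "\<And>i. i < length \<omega>s \<Longrightarrow> c (Suc i) = 0"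
      using indepD[OF \<omega>s(2), of "\<lambda>i. c (Suc i)"] c1 by simp
    then show False using c(2,3) \<open>c 0 = 0\<close> by (cases i) auto
  qed
  define ds where "ds = map (\<lambda>i. - c (Suc i) / c 0) [0..<length \<omega>s]"
  show "\<exists>!cs. length cs = length \<omega>s \<and> (\<forall>m\<in>M. (\<Sum>i<length \<omega>s. fscale (cs ! i) ((\<omega>s ! i) m)) - \<omega> m \<in> I)"
  proof (rule ex1I[of _ ds])
    show "length ds = length \<omega>s \<and> (\<forall>m\<in>M. (\<Sum>i<length \<omega>s. fscale (ds ! i) ((\<omega>s ! i) m)) - \<omega> m \<in> I)"
    proof (intro conjI ballI)
      fix m assume "m \<in> M"
      then have "fscale (- 1 / c 0) (fscale (c 0) (\<omega> m) + (\<Sum>i<length \<omega>s. fscale (c (Suc i)) ((\<omega>s ! i) m))) \<in> I"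
        by (intro I_scale c1)
      also have "fscale (- 1 / c 0) (fscale (c 0) (\<omega> m) + (\<Sum>i<length \<omega>s. fscale (c (Suc i)) ((\<omega>s ! i) m))) =
          (\<Sum>i<length \<omega>s. fscale (ds ! i) ((\<omega>s ! i) m)) - \<omega> m"
        using \<open>c 0 \<noteq> 0\<close> by (simp add: fv.scale_right_distrib fv.scale_sum_right ds_def)
      finally show "(\<Sum>i<length \<omega>s. fscale (ds ! i) ((\<omega>s ! i) m)) - \<omega> m \<in> I" .
    qed (simp add: ds_def)
    then have ds: "length ds = length \<omega>s" "\<And>m. m \<in> M \<Longrightarrow> (\<Sum>i<length \<omega>s. fscale (ds ! i) ((\<omega>s ! i) m)) - \<omega> m \<in> I"
      by auto
    fix cs assume cs: "length cs = length \<omega>s \<and> (\<forall>m\<in>M. (\<Sum>i<length \<omega>s. fscale (cs ! i) ((\<omega>s ! i) m)) - \<omega> m \<in> I)"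
    have "cs ! i - ds ! i = 0" if "i < length \<omega>s" for i
    proof (rule indepD[OF \<omega>s(2) _ that, of "\<lambda>i. cs ! i - ds ! i"])
      fix m assume m: "m \<in> M"
      show "(\<Sum>i<length \<omega>s. fscale (cs ! i - ds ! i) ((\<omega>s ! i) m)) \<in> I"
        using I_diff[OF conjunct2[OF cs, rule_format, OF m] ds(2)[OF m]]
        by (simp add: fv.scale_left_diff_distrib sum_subtractf)
    qed
    then show "cs = ds" using cs ds(1) by (intro nth_equalityI) auto
  qed
qed

text \<open>This shows that the length of a basis is well defined. By \<open>max\<close> no basis is
  longer than \<open>\<omega>s\<close>; a shorter one would express the members of
  \<open>\<omega>s\<close> through too few maps, and an underdetermined system over the complex
  numbers would give a relation among them.\<close>

lemma coinv_mult_eq: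
  assumes \<omega>s: "set \<omega>s \<subseteq> hom_space j" "indep \<omega>s"
    and max: "\<And>\<psi>s. set \<psi>s \<subseteq> hom_space j \<Longrightarrow> indep \<psi>s \<Longrightarrow> length \<psi>s \<le> length \<omega>s"
  shows "coinv_mult scale W K act scaleM M actM j = length \<omega>s"
  unfolding coinv_mult_def
proof (rule the_equality)
  have "homs_basis j (map (quot_hom j) \<omega>s)" using indep_hom_basis[OF assms] homs_basis_iff[OF \<omega>s(1)] by blast
  then show "\<exists>\<Phi>s. homs_basis j \<Phi>s \<and> length \<Phi>s = length \<omega>s" by (metis length_map)
next
  fix l assume "\<exists>\<Phi>s. homs_basis j \<Phi>s \<and> length \<Phi>s = l"
  then obtain \<Phi>s where \<Phi>s: "homs_basis j \<Phi>s" "length \<Phi>s = l" by blast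
  then have sub: "set \<Phi>s \<subseteq> quot_hom j ` hom_space j" by (simp add: coinv_homs_basis_def homs_eq)
  define \<psi>s where "\<psi>s = map (inv_into (hom_space j) (quot_hom j)) \<Phi>s"
  have \<psi>s: "\<Phi>s = map (quot_hom j) \<psi>s" "set \<psi>s \<subseteq> hom_space j"
    using sub by (auto simp: \<psi>s_def f_inv_into_f inv_into_into subset_iff intro!: map_idI[symmetric])
  then have B: "hom_basis j \<psi>s" using \<Phi>s homs_basis_iff by blast
  have le: "length \<psi>s \<le> length \<omega>s" using max \<psi>s hom_basis_indep[OF B] by blast
  have "\<not> length \<psi>s < length \<omega>s"
  proof
    assume lt: "length \<psi>s < length \<omega>s"
    have "\<exists>cs. \<forall>m\<in>M. (\<Sum>k<length \<psi>s. fscale (cs ! k) ((\<psi>s ! k) m)) - (\<omega>s ! i) m \<in> I" if "i < length \<omega>s" for i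
    proof -
      have "\<omega>s ! i \<in> hom_space j" using \<omega>s(1) that by auto
      from B[unfolded hom_basis_def, rule_format, OF this] show ?thesis by blast
    qed
    then have "\<forall>i. \<exists>cs. i < length \<omega>s \<longrightarrow> (\<forall>m\<in>M. (\<Sum>k<length \<psi>s. fscale (cs ! k) ((\<psi>s ! k) m)) - (\<omega>s ! i) m \<in> I)"
      by blast
    from choice[OF this] obtain a where a: "\<And>i m. i < length \<omega>s \<Longrightarrow> m \<in> M \<Longrightarrow>
        (\<Sum>k<length \<psi>s. fscale (a i ! k) ((\<psi>s ! k) m)) - (\<omega>s ! i) m \<in> I" by blast
    have "\<exists>p::nat \<Rightarrow> complex. (\<forall>i\<in>{..<length \<omega>s}. p i \<in> UNIV) \<and> (\<exists>i\<in>{..<length \<omega>s}. p i \<noteq> 0) \<and>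
        (\<forall>k<length \<psi>s. (\<Sum>i<length \<omega>s. p i * (a i ! k)) = 0)"
      using lt by (intro underdetermined_system[OF UNIV_I]) simp_all
    then obtain p :: "nat \<Rightarrow> complex" where p: "\<exists>i\<in>{..<length \<omega>s}. p i \<noteq> 0"
        "\<forall>k<length \<psi>s. (\<Sum>i<length \<omega>s. p i * (a i ! k)) = 0" by blast
    have "(\<Sum>i<length \<omega>s. fscale (p i) ((\<omega>s ! i) m)) \<in> I" if m: "m \<in> M" for m
    proof -
      have "(\<Sum>i<length \<omega>s. fscale (p i) (\<Sum>k<length \<psi>s. fscale (a i ! k) ((\<psi>s ! k) m))) =
          (\<Sum>k<length \<psi>s. \<Sum>i<length \<omega>s. fscale (p i * (a i ! k)) ((\<psi>s ! k) m))"
        by (simp add: fv.scale_sum_right) (rule sum.swap)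
      also have "\<dots> = 0" using p(2) by (intro sum.neutral) (auto simp: fv.scale_sum_left[symmetric])
      finally have "(\<Sum>i<length \<omega>s. fscale (p i) ((\<omega>s ! i) m)) =
        - (\<Sum>i<length \<omega>s. fscale (p i) ((\<Sum>k<length \<psi>s. fscale (a i ! k) ((\<psi>s ! k) m)) - (\<omega>s ! i) m))"
        by (simp add: fv.scale_right_diff_distrib sum_subtractf)
      also have "\<dots> \<in> I" using a m by (intro I_neg I_sum I_scale) auto
      finally show ?thesis .
    qed
    then show False using indepD[OF \<omega>s(2), of p] p(1) by auto
  qed
  then show "l = length \<omega>s" using le \<psi>s \<Phi>s by simp
qed

lemma indep_map:
  assumes "distinct js"
  shows "indep (map \<omega> js) \<longleftrightarrow>
    (\<forall>c. (\<forall>m\<in>M. (\<Sum>i\<in>set js. fscale (c i) (\<omega> i m)) \<in> I) \<longrightarrow> (\<forall>i\<in>set js. c i = 0))" (is "_ \<longleftrightarrow> ?R")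
proof -
  have bij: "bij_betw ((!) js) {..<length js} (set js)" using bij_betw_nth[OF assms] by simp
  have sum: "(\<Sum>i\<in>set js. f i) = (\<Sum>i<length js. f (js ! i))" for f :: "_ \<Rightarrow> 'a \<Rightarrow> complex"
    using sum.reindex_bij_betw[OF bij, of f] by simp
  show ?thesis
  proof (intro iffI allI impI ballI)
    fix c i assume "indep (map \<omega> js)" "\<forall>m\<in>M. (\<Sum>i\<in>set js. fscale (c i) (\<omega> i m)) \<in> I" "i \<in> set js"
    then show "c i = 0" using indepD[of "map \<omega> js" "\<lambda>i. c (js ! i)"]
      by (auto simp: sum in_set_conv_nth)
  next
    assume R: ?R
    show "indep (map \<omega> js)"
      unfolding indep_def
    proof (intro allI impI)
      fix c i assume c: "\<forall>m\<in>M. (\<Sum>i<length (map \<omega> js). fscale (c i) ((map \<omega> js ! i) m)) \<in> I" and i: "i < length (map \<omega> js)"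
      define c' where "c' = (\<lambda>j. c (inv_into {..<length js} ((!) js) j))"
      have c': "c' (js ! i) = c i" if "i < length js" for i
        using that bij by (simp add: c'_def bij_betw_def inv_into_f_f)
      have "\<forall>m\<in>M. (\<Sum>i\<in>set js. fscale (c' i) (\<omega> i m)) \<in> I" using c by (simp add: sum c')
      then have "c' (js ! i) = 0" using R i by auto
      then show "c i = 0" using c' i by simp
    qed
  qed
qed

text \<open>The bound \<open>ub\<close> concerns families of mixed degrees, while a multiplicity
  concerns one degree \<open>j\<close>. An independent family of degree \<open>j\<close>, extended
  by the \<open>\<omega> i\<close> of the other degrees, stays independent; comparison with
  \<open>N\<close> bounds its length by the number of \<open>\<omega> i\<close> of degree
  \<open>j\<close>.\<close>

lemma fake_degrees_eq:
  assumes \<omega>: "\<And>i. i < N \<Longrightarrow> \<omega> i \<in> hom_space (e i)"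
    and ind: "\<And>c. (\<And>m. m \<in> M \<Longrightarrow> (\<Sum>i<N. fscale (c i) (\<omega> i m)) \<in> I) \<Longrightarrow> \<forall>i<N. c i = 0"
    and ub: "\<And>\<psi>s. (\<And>\<psi>. \<psi> \<in> set \<psi>s \<Longrightarrow> \<exists>j. \<psi> \<in> hom_space j) \<Longrightarrow> indep \<psi>s \<Longrightarrow> length \<psi>s \<le> N"
  shows "coinv_mult scale W K act scaleM M actM j = count (mset (map e [0..<N])) j"
    and "fake_degrees scale W K act scaleM M actM = mset (map e [0..<N])"
proof -
  have mult: "coinv_mult scale W K act scaleM M actM j = count (mset (map e [0..<N])) j" for j
  proof -
    define js where "js = filter (\<lambda>i. e i = j) [0..<N]"
    define ks where "ks = filter (\<lambda>i. e i \<noteq> j) [0..<N]"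
    have len: "length js + length ks = N"
      using sum_length_filter_compl[of "\<lambda>i. e i = j" "[0..<N]"] by (simp add: js_def ks_def)
    have sub: "indep (map \<omega> (filter P [0..<N]))" for P
      unfolding indep_map[OF distinct_filter[OF distinct_upt]]
    proof (intro allI impI ballI)
      fix c i assume c: "\<forall>m\<in>M. (\<Sum>i\<in>set (filter P [0..<N]). fscale (c i) (\<omega> i m)) \<in> I"
        and i: "i \<in> set (filter P [0..<N])"
      define c' where "c' i = (if P i then c i else 0)" for i
      have "(\<Sum>i<N. fscale (c' i) (\<omega> i m)) = (\<Sum>i\<in>set (filter P [0..<N]). fscale (c i) (\<omega> i m))" for m
        by (rule sum.mono_neutral_cong_right) (auto simp: c'_def)
      then have "\<forall>i<N. c' i = 0" using c by (intro ind) auto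
      then show "c i = 0" using i by (auto simp: c'_def)
    qed
    have "coinv_mult scale W K act scaleM M actM j = length (map \<omega> js)"
    proof (rule coinv_mult_eq)
      show "set (map \<omega> js) \<subseteq> hom_space j" using \<omega> by (auto simp: js_def)
      show "indep (map \<omega> js)" unfolding js_def by (rule sub)
      fix \<psi>s assume \<psi>s: "set \<psi>s \<subseteq> hom_space j" "indep \<psi>s"
      let ?l = "length \<psi>s" and ?L = "\<psi>s @ map \<omega> ks"
      have split: "(\<Sum>i<length ?L. fscale (c i) ((?L ! i) m)) =
          (\<Sum>i<?l. fscale (c i) ((\<psi>s ! i) m)) + (\<Sum>i<length ks. fscale (c (?l + i)) (\<omega> (ks ! i) m))" for c m
      proof -
        have "{..<length ?L} = {..<?l} \<union> {?l..<?l + length ks}" by auto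
        then have "(\<Sum>i<length ?L. fscale (c i) ((?L ! i) m)) =
          (\<Sum>i<?l. fscale (c i) ((?L ! i) m)) + (\<Sum>i\<in>{?l..<?l + length ks}. fscale (c i) ((?L ! i) m))"
          by (simp add: sum.union_disjoint ivl_disj_int)
        also have "(\<Sum>i\<in>{?l..<?l + length ks}. fscale (c i) ((?L ! i) m)) =
            (\<Sum>i<length ks. fscale (c (?l + i)) ((?L ! (?l + i)) m))"
          by (rule sum.reindex_bij_witness[of _ "\<lambda>i. ?l + i" "\<lambda>i. i - ?l"]) auto
        finally show ?thesis by (simp add: nth_append)
      qed
      have L: "indep ?L"
        unfolding indep_def
      proof (intro allI impI)
        fix c i assume c: "\<forall>m\<in>M. (\<Sum>i<length ?L. fscale (c i) ((?L ! i) m)) \<in> I" and i: "i < length ?L"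
        \<comment> \<open>The component of degree \<open>j\<close> loses the maps from
          \<open>ks\<close> and is still in \<open>I\<close>, because \<open>I\<close> is
          homogeneous.\<close>
        have 1: "(\<Sum>i<?l. fscale (c i) ((\<psi>s ! i) m)) \<in> I" if m: "m \<in> M" for m
        proof -
          have A: "\<psi>s ! i \<in> hom_space j" if "i < ?l" for i using \<psi>s(1) that by auto
          have A1: "fscale (c i) ((\<psi>s ! i) m) \<in> Sd j" if "i < ?l" for i
            using hom_spaceD(1)[OF A[OF that] m] by (rule Sd_scale)
          have A2: "fscale (c (?l + i)) (\<omega> (ks ! i) m) \<in> Sd (e (ks ! i))" "e (ks ! i) \<noteq> j" if "i < length ks" for i
            using that nth_mem[OF that] \<omega>[of "ks ! i"] hom_spaceD(1) m by (auto simp: ks_def intro!: Sd_scale)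
          have "hc j (\<Sum>i<length ?L. fscale (c i) ((?L ! i) m)) =
            hc j (\<Sum>i<?l. fscale (c i) ((\<psi>s ! i) m)) + hc j (\<Sum>i<length ks. fscale (c (?l + i)) (\<omega> (ks ! i) m))"
            unfolding split using A1 A2 by (intro hc_add S_sum) (auto intro: Sd_in_S)
          also have "hc j (\<Sum>i<?l. fscale (c i) ((\<psi>s ! i) m)) = (\<Sum>i<?l. fscale (c i) ((\<psi>s ! i) m))"
          proof -
            have "(\<Sum>i<?l. fscale (c i) ((\<psi>s ! i) m)) \<in> Sd j"
              using A1 by (intro fv.subspace_sum[OF Sd_subspace]) auto
            from hc_Sd[OF this] show ?thesis by simp
          qed
          also have "hc j (\<Sum>i<length ks. fscale (c (?l + i)) (\<omega> (ks ! i) m)) =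
              (\<Sum>i<length ks. hc j (fscale (c (?l + i)) (\<omega> (ks ! i) m)))"
            using A2 by (intro hc_sum) (auto intro: Sd_in_S)
          also have "\<dots> = 0" using hc_Sd[OF A2(1)] A2(2) by (intro sum.neutral) auto
          finally have "hc j (\<Sum>i<length ?L. fscale (c i) ((?L ! i) m)) = (\<Sum>i<?l. fscale (c i) ((\<psi>s ! i) m))"
            by simp
          then show ?thesis using I_hc[OF c[rule_format, OF m], of j] by simp
        qed
        have z: "c i = 0" if "i < ?l" for i using indepD[OF \<psi>s(2) 1 that] .
        have "(\<Sum>i<length ks. fscale (c (?l + i)) (\<omega> (ks ! i) m)) \<in> I" if "m \<in> M" for m
          using c that z unfolding split by auto
        then have "c (?l + i) = 0" if "i < length ks" for i
          using indepD[OF sub[of "\<lambda>i. e i \<noteq> j"], of "\<lambda>i. c (?l + i)" i] that by (simp add: ks_def)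
        from this[of "i - ?l"] z[of i] show "c i = 0" using i by (cases "i < ?l") auto
      qed
      have "\<exists>j. \<psi> \<in> hom_space j" if \<psi>: "\<psi> \<in> set ?L" for \<psi>
      proof -
        consider "\<psi> \<in> hom_space j" | i where "i \<in> set ks" "\<psi> = \<omega> i" using \<psi> \<psi>s(1) by auto
        then show ?thesis
        proof cases
          case 2
          then have "i < N" by (simp add: ks_def)
          then show ?thesis using \<omega>[of i] 2 by blast
        qed blast
      qed
      then have "length ?L \<le> N" by (rule ub[OF _ L])
      then show "length \<psi>s \<le> length (map \<omega> js)" using len by simp
    qed
    also have "\<dots> = count (mset (map e [0..<N])) j"
    proof -
      have "count (mset (map e xs)) j = length (filter (\<lambda>i. e i = j) xs)" for xs by (induction xs) auto
      from this[of "[0..<N]"] show ?thesis by (simp only: js_def length_map)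
    qed
    finally show ?thesis .
  qed
  then show "coinv_mult scale W K act scaleM M actM j = count (mset (map e [0..<N])) j" .
  show "fake_degrees scale W K act scaleM M actM = mset (map e [0..<N])"
    unfolding fake_degrees_def
    by (rule the_equality) (auto simp: mult intro: multiset_eqI)
qed

end

section \<open>Reflection groups\<close>

text \<open>The vector \<open>u\<close> may be 0, which covers the identity; the form \<alpha> is
  nonzero in every case, since it has to be cancelled.\<close>

locale refl_group = lin_group scale UNIV r b x K act
  for scale :: "complex \<Rightarrow> 'a::ab_group_add \<Rightarrow> 'a" and r b x
    and K :: "('g, 'z) monoid_scheme" and act +
  fixes Rf :: "'g set"
  assumes Rf_carrier: "Rf \<subseteq> carrier K"
    and generated: "carrier K = generate K Rf"
    and reflection: "s \<in> Rf \<Longrightarrow> \<exists>\<alpha>\<in>dual_space scale UNIV. \<alpha> \<noteq> 0 \<and> (\<exists>u. \<forall>w. act s w = w + scale (\<alpha> w) u)"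
begin

lemma cst_1: "cst 1 = 1"
  by (simp add: cst_def one_fun_def)

lemma one_in_S: "1 \<in> S" and one_in_R: "1 \<in> R"
  using cst_in_S[of 1] R_cst[of 1] by (simp_all add: cst_1)

lemma fa_one_UNIV: "fa \<one>\<^bsub>K\<^esub> f = f"
  by (rule fa_one) simp

lemma cst_mult_UNIV: "cst c * f = fscale c f"
  by (auto simp: cst_def fun_eq_iff fun_ops)

lemma S_power: "f \<in> S \<Longrightarrow> f ^ n \<in> S"
  by (induction n) (auto simp: one_in_S S_mult)

lemma D_power: "f \<in> S \<Longrightarrow> D v (f ^ Suc n) = fscale (of_nat (Suc n)) (f ^ n * D v f)"
proof (induction n)
  case (Suc n)
  have "D v (f ^ Suc (Suc n)) = D v f * f ^ Suc n + f * D v (f ^ Suc n)"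
    using Suc D_mult[of f "f ^ Suc n" v] S_power[of f "Suc n"] by simp
  also have "\<dots> = fscale (of_nat (Suc (Suc n))) (f ^ Suc n * D v f)"
    unfolding Suc.IH[OF Suc.prems] by (simp add: fun_eq_iff fun_ops algebra_simps)
  finally show ?case .
qed (auto simp: fun_eq_iff fun_ops)

lemma fa_prod: "fa k (\<Prod>i\<in>A. f i) = (\<Prod>i\<in>A. fa k (f i))"
proof -
  have "fa k 1 = 1" by (simp add: fun_act_def one_fun_def)
  then show ?thesis by (induction A rule: infinite_finite_induct) (auto simp: fa_mult)
qed

text \<open>Functions are moved by the inverse of \<open>s\<close>, which is again of the form w +
  \<alpha>(w) u' with the same \<alpha>.\<close>

lemma reflection_division:
  assumes s: "s \<in> Rf"
  shows "\<exists>\<alpha>\<in>DS. \<alpha> \<noteq> 0 \<and> (\<forall>n. \<forall>f\<in>lt (Suc n). \<exists>q\<in>lt n. fa s f - f = \<alpha> * q)"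
proof -
  obtain \<alpha> u where \<alpha>: "\<alpha> \<in> DS" "\<alpha> \<noteq> 0" "\<And>w. act s w = w + scale (\<alpha> w) u" using reflection[OF s] by blast
  have sK: "s \<in> carrier K" using s Rf_carrier by auto
  let ?t = "inv\<^bsub>K\<^esub> s"
  have "act ?t w = w + scale (\<alpha> w) (- act ?t u)" for w
  proof -
    have "w = act ?t (act s w)" using act_inv(1)[OF sK] by simp
    also have "\<dots> = act ?t w + scale (\<alpha> w) (act ?t u)" using sK by (simp add: \<alpha>(3) act_add act_scale)
    finally show ?thesis by (simp add: algebra_simps)
  qed
  then have "\<exists>q\<in>lt n. \<forall>w\<in>UNIV. f (act ?t w) - f w = \<alpha> w * q w" if "f \<in> lt (Suc n)" for f n
    by (rule division[OF that _ _ \<alpha>(1)]) simp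
  then have "\<exists>q\<in>lt n. fa s f - f = \<alpha> * q" if "f \<in> lt (Suc n)" for f n
    using that by (force simp: fun_act_def fun_eq_iff fun_ops)
  then show ?thesis using \<alpha> by blast
qed

subsection \<open>Flatness over the invariants\<close>

definition rels :: "'j set \<Rightarrow> ('j \<Rightarrow> 'a \<Rightarrow> complex) \<Rightarrow> ('j \<Rightarrow> 'a \<Rightarrow> complex) set" where
  "rels J U = {\<rho>. (\<forall>j\<in>J. \<rho> j \<in> R) \<and> (\<Sum>j\<in>J. \<rho> j * U j) = 0}"

text \<open>Membership in the S-module generated by the relations over R among the
  \<open>U j\<close>. Both rules compare values on \<open>J\<close> only, as the values of
  \<open>P\<close> elsewhere are arbitrary.\<close>

inductive span_rels :: "'j set \<Rightarrow> ('j \<Rightarrow> 'a \<Rightarrow> complex) \<Rightarrow> ('j \<Rightarrow> 'a \<Rightarrow> complex) \<Rightarrow> bool" for J U where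
  zero: "(\<forall>j\<in>J. P j = 0) \<Longrightarrow> span_rels J U P"
| add: "span_rels J U Q \<Longrightarrow> s \<in> S \<Longrightarrow> \<rho> \<in> rels J U \<Longrightarrow> (\<forall>j\<in>J. P j = Q j + s * \<rho> j) \<Longrightarrow> span_rels J U P"

lemma span_rels_cong: "span_rels J U P \<Longrightarrow> (\<And>j. j \<in> J \<Longrightarrow> P j = P' j) \<Longrightarrow> span_rels J U P'"
proof (induction rule: span_rels.induct)
  case (zero P)
  then show ?case by (intro span_rels.zero) simp
next
  case (add Q s \<rho> P)
  then show ?case using add.prems add.hyps by (intro span_rels.add[OF add.hyps(1-3)]) simp
qed

lemma span_rels_plus:
  assumes "span_rels J U P" "span_rels J U Q"
  shows "span_rels J U (\<lambda>j. P j + Q j)"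
  using assms(2)
proof (induction rule: span_rels.induct)
  case (zero Q)
  then show ?case using span_rels_cong[OF assms(1)] by simp
next
  case (add Q s \<rho> P')
  then show ?case
    by (intro span_rels.add[OF add.IH add.hyps(2,3)]) (simp add: ac_simps)
qed

lemma span_rels_mult: "span_rels J U P \<Longrightarrow> s \<in> S \<Longrightarrow> span_rels J U (\<lambda>j. s * P j)"
proof (induction rule: span_rels.induct)
  case (zero P)
  then show ?case by (intro span_rels.zero) simp
next
  case (add Q t \<rho> P)
  have "span_rels J U (\<lambda>j. s * Q j)" using add by blast
  then show ?case
    by (rule span_rels.add[of _ _ _ "s * t" \<rho>]) (use add in \<open>auto simp: S_mult algebra_simps\<close>)
qed

lemma span_rels_fa: "span_rels J U P \<Longrightarrow> k \<in> carrier K \<Longrightarrow> span_rels J U (\<lambda>j. fa k (P j))"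
proof (induction rule: span_rels.induct)
  case (zero P)
  then show ?case by (intro span_rels.zero) (simp add: fa_zero)
next
  case (add Q t \<rho> P)
  have 1: "span_rels J U (\<lambda>j. fa k (Q j))" using add by blast
  have 2: "fa k (\<rho> j) = \<rho> j" if "j \<in> J" for j using add that by (auto simp: rels_def R_iff)
  show ?case
    by (rule span_rels.add[OF 1, of "fa k t" \<rho>]) (use add 2 in \<open>auto simp: fa_S fa_add fa_mult\<close>)
qed

lemma span_rels_sum:
  assumes "finite A" "\<And>a. a \<in> A \<Longrightarrow> span_rels J U (P a)"
  shows "span_rels J U (\<lambda>j. \<Sum>a\<in>A. P a j)"
  using assms
proof (induction A rule: finite_induct)
  case empty
  then show ?case by (intro span_rels.zero) simp
next
  case (insert a A)
  then show ?case using span_rels_plus[of J U "P a" "\<lambda>j. \<Sum>a\<in>A. P a j"] by simp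
qed

lemma span_rels_minus: "span_rels J U P \<Longrightarrow> span_rels J U (\<lambda>j. - P j)"
  using span_rels_mult[of J U P "cst (- 1)"] cst_in_S by (simp add: cst_mult_UNIV)

text \<open>For a reflection \<open>s\<close> the quotients q in sP - P = \<alpha> q satisfy the
  same relation as P: the \<open>U j\<close> are invariant, and \<alpha> can be cancelled in a
  domain. They have lower degree, so the induction hypothesis settles sP - P. The case of a general
  group element follows by composition.\<close>

lemma flatness_bounded:
  assumes J: "finite J" and U: "\<And>j. j \<in> J \<Longrightarrow> U j \<in> R"
    and "\<And>j. j \<in> J \<Longrightarrow> P j \<in> lt n" "(\<Sum>j\<in>J. P j * U j) = 0"
  shows "span_rels J U P"
  using assms(3,4)
proof (induction n arbitrary: P)
  case 0
  then show ?case by (intro span_rels.zero) (auto simp: lt_0)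
next
  case (Suc n)
  have PS: "P j \<in> S" if "j \<in> J" for j using Suc.prems(1)[OF that] lt_in_S by blast
  have refl: "span_rels J U (\<lambda>j. fa s (P j) - P j)" if s: "s \<in> Rf" for s
  proof -
    obtain \<alpha> where \<alpha>: "\<alpha> \<in> DS" "\<alpha> \<noteq> 0" "\<And>f. f \<in> lt (Suc n) \<Longrightarrow> \<exists>q\<in>lt n. fa s f - f = \<alpha> * q"
      using reflection_division[OF s] by blast
    have sK: "s \<in> carrier K" using s Rf_carrier by auto
    have "\<forall>j. \<exists>q. j \<in> J \<longrightarrow> q \<in> lt n \<and> fa s (P j) - P j = \<alpha> * q" using \<alpha>(3) Suc.prems(1) by blast
    from choice[OF this] obtain q where q: "\<And>j. j \<in> J \<Longrightarrow> q j \<in> lt n" "\<And>j. j \<in> J \<Longrightarrow> fa s (P j) - P j = \<alpha> * q j"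
      by blast
    have "\<alpha> * (\<Sum>j\<in>J. q j * U j) = (\<Sum>j\<in>J. (fa s (P j) - P j) * U j)"
      unfolding sum_distrib_left by (intro sum.cong) (auto simp: q(2) mult.assoc)
    also have "\<dots> = (\<Sum>j\<in>J. fa s (P j * U j)) - (\<Sum>j\<in>J. P j * U j)"
      unfolding sum_subtractf[symmetric]
    proof (rule sum.cong[OF refl])
      fix j assume "j \<in> J"
      then have "fa s (U j) = U j" using U sK by (auto simp: R_iff)
      then show "(fa s (P j) - P j) * U j = fa s (P j * U j) - P j * U j" by (simp add: fa_mult left_diff_distrib)
    qed
    also have "\<dots> = 0" using Suc.prems(2) by (simp add: fa_sum[symmetric] fa_zero)
    finally have "\<alpha> * (\<Sum>j\<in>J. q j * U j) = 0" .
    moreover have "(\<Sum>j\<in>J. q j * U j) \<in> S"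
      using q(1) U by (intro S_sum S_mult lt_in_S[of _ n] R_in_S) auto
    ultimately have "(\<Sum>j\<in>J. q j * U j) = 0"
      using S_domain[of \<alpha> "\<Sum>j\<in>J. q j * U j"] \<alpha> DS_in_S by auto
    then have "span_rels J U q" using q(1) by (intro Suc.IH) auto
    then have "span_rels J U (\<lambda>j. \<alpha> * q j)" using \<alpha> DS_in_S by (intro span_rels_mult) auto
    then show ?thesis by (rule span_rels_cong) (simp add: q(2))
  qed
  have all: "span_rels J U (\<lambda>j. fa g (P j) - P j)" if "g \<in> carrier K" for g
    using that unfolding generated
  proof (induction rule: generate.induct)
    case one
    then show ?case by (intro span_rels.zero) (simp add: fa_one_UNIV)
  next
    case (incl s)
    then show ?case by (rule refl)
  next
    case (inv s)
    then have sK: "s \<in> carrier K" using Rf_carrier by auto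
    have "span_rels J U (\<lambda>j. - fa (inv\<^bsub>K\<^esub> s) (fa s (P j) - P j))"
      using sK by (intro span_rels_minus span_rels_fa refl inv) auto
    then show ?case
      by (rule span_rels_cong) (use sK in \<open>simp add: fa_diff fa_comp fa_one_UNIV\<close>)
  next
    case (eng g h)
    then have "g \<in> carrier K" "h \<in> carrier K" unfolding generated by auto
    \<comment> \<open>The identity ghP - P = g(hP - P) + (gP - P).\<close>
    then have "span_rels J U (\<lambda>j. fa g (fa h (P j) - P j) + (fa g (P j) - P j))"
      using eng by (intro span_rels_plus span_rels_fa) auto
    then show ?case
      by (rule span_rels_cong) (use \<open>g \<in> carrier K\<close> \<open>h \<in> carrier K\<close> in \<open>simp add: fa_diff fa_comp\<close>)
  qed
  have "(\<Sum>j\<in>J. Avg (P j) * U j) = Avg (\<Sum>j\<in>J. P j * U j)"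
    unfolding Avg_sum using U by (intro sum.cong) (auto simp: Avg_mult)
  then have "(\<lambda>j. Avg (P j)) \<in> rels J U"
    using Suc.prems(2) PS by (auto simp: rels_def Avg_in_R Avg_zero)
  then have A: "(\<lambda>j. Avg (P j)) \<in> rels J U" .
  have B: "span_rels J U (\<lambda>j. - (cst (1 / of_nat (card (carrier K))) * (\<Sum>g\<in>carrier K. fa g (P j) - P j)))"
    by (rule span_rels_minus, rule span_rels_mult, rule span_rels_sum[OF fin all]) (auto simp: cst_in_S)
  \<comment> \<open>P is its average minus the average of the gP - P, and the averaged coefficients
    form a relation over R.\<close>
  have "P j = - (cst (1 / of_nat (card (carrier K))) * (\<Sum>g\<in>carrier K. fa g (P j) - P j)) + 1 * Avg (P j)" for j
    using card_K by (simp add: cst_mult_UNIV sum_subtractf Avg_def fv.scale_right_diff_distrib sum_constant_fscale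
        del: sum_constant)
  then show ?case by (intro span_rels.add[OF B one_in_S A]) blast
qed

lemma flatness:
  assumes "finite J" "\<And>j. j \<in> J \<Longrightarrow> U j \<in> R" "\<And>j. j \<in> J \<Longrightarrow> P j \<in> S" "(\<Sum>j\<in>J. P j * U j) = 0"
  shows "span_rels J U P"
proof -
  have "\<forall>j. \<exists>n. j \<in> J \<longrightarrow> P j \<in> lt n" using assms(3) S_in_lt by blast
  from choice[OF this] obtain n where n: "\<And>j. j \<in> J \<Longrightarrow> P j \<in> lt (n j)" by blast
  have "P j \<in> lt (\<Sum>j\<in>J. n j)" if "j \<in> J" for j
    using n[OF that] lt_mono[of "n j" "\<Sum>j\<in>J. n j"] member_le_sum[OF that, of n] assms(1) by auto
  then show ?thesis using flatness_bounded[OF assms(1,2) _ assms(4)] by blast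
qed

text \<open>The orthogonality makes the combination of the \<open>\<rho> j\<close> with coefficients
  \<open>c j\<close> an invariant vanishing at 0, so its multiples lie in \<open>I\<close>.\<close>

lemma span_rels_in_I:
  assumes "span_rels J U P" "\<And>\<rho>. \<rho> \<in> rels J U \<Longrightarrow> (\<Sum>j\<in>J. c j * \<rho> j 0) = 0"
  shows "(\<Sum>j\<in>J. fscale (c j) (P j)) \<in> I"
  using assms(1)
proof (induction rule: span_rels.induct)
  case (zero P)
  then show ?case using fv.subspace_0[OF I_subspace] by simp
next
  case (add Q s \<rho> P)
  have "(\<Sum>j\<in>J. fscale (c j) (\<rho> j)) \<in> R0"
    using add.hyps(3) assms(2)[OF add.hyps(3)]
    by (auto simp: R0_def fun_ops rels_def intro!: fv.subspace_sum[OF R_subspace] fv.subspace_scale[OF R_subspace])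
  then have "s * (\<Sum>j\<in>J. fscale (c j) (\<rho> j)) \<in> I" using add by (intro I_base)
  moreover have "(\<Sum>j\<in>J. fscale (c j) (P j)) = (\<Sum>j\<in>J. fscale (c j) (Q j)) + s * (\<Sum>j\<in>J. fscale (c j) (\<rho> j))"
    using add.hyps(4) by (simp add: fv.scale_right_distrib sum.distrib sum_distrib_left fscale_mult)
  ultimately show ?case using add fv.subspace_add[OF I_subspace] by simp
qed

text \<open>Evaluating the components of lowest degree of a relation at a point gives constants \<open>c\<close>
  orthogonal to the constant terms of all relations among the coefficients.\<close>

lemma independent_over_invariants:
  assumes J: "finite J" and \<omega>: "\<And>j m. j \<in> J \<Longrightarrow> m \<in> M \<Longrightarrow> \<omega> j m \<in> S"
    and ind: "\<And>c. (\<And>m. m \<in> M \<Longrightarrow> (\<Sum>j\<in>J. fscale (c j) (\<omega> j m)) \<in> I) \<Longrightarrow> \<forall>j\<in>J. c j = 0"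
    and \<rho>: "\<And>j. j \<in> J \<Longrightarrow> \<rho> j \<in> R" "\<And>m. m \<in> M \<Longrightarrow> (\<Sum>j\<in>J. \<rho> j * \<omega> j m) = 0"
  shows "\<forall>j\<in>J. \<rho> j = 0"
proof (rule ccontr)
  assume "\<not> ?thesis"
  then obtain i where i: "i \<in> J" "\<rho> i \<noteq> 0" by blast
  then have "\<exists>d. \<exists>j\<in>J. hc d (\<rho> j) \<noteq> 0" using hc_eq_0[OF R_in_S[OF \<rho>(1)]] by blast
  then obtain d where d: "\<exists>j\<in>J. hc d (\<rho> j) \<noteq> 0" "\<And>e. e < d \<Longrightarrow> \<not> (\<exists>j\<in>J. hc e (\<rho> j) \<noteq> 0)"
    using exists_least_iff[of "\<lambda>d. \<exists>j\<in>J. hc d (\<rho> j) \<noteq> 0"] by blast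
  then obtain i where i: "i \<in> J" "hc d (\<rho> i) \<noteq> 0" by blast
  then obtain v where v: "hc d (\<rho> i) v \<noteq> 0" by (auto simp: fun_eq_iff fun_ops)
  define c where "c j = hc d (\<rho> j) v" for j
  have orth: "(\<Sum>j\<in>J. c j * \<sigma> j 0) = 0" if \<sigma>: "\<sigma> \<in> rels J \<rho>" for \<sigma>
  proof -
    have \<sigma>S: "\<sigma> j \<in> S" if "j \<in> J" for j using \<sigma> that by (auto simp: rels_def R_in_S)
    have "hc d (\<Sum>j\<in>J. \<sigma> j * \<rho> j) = (\<Sum>j\<in>J. hc d (\<sigma> j * \<rho> j))"
      using J \<sigma>S \<rho>(1) by (intro hc_sum) (auto intro: S_mult R_in_S)
    also have "\<dots> = (\<Sum>j\<in>J. fscale (\<sigma> j 0) (hc d (\<rho> j)))"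
    proof (rule sum.cong[OF refl])
      fix j assume j: "j \<in> J"
      have "hc d (\<sigma> j * \<rho> j) = (\<Sum>e\<le>d. hc (d - e) (\<sigma> j) * hc e (\<rho> j))"
        using j \<sigma>S \<rho>(1) by (intro hc_prod) (auto intro: R_in_S)
      also have "\<dots> = (\<Sum>e\<in>{d}. hc (d - e) (\<sigma> j) * hc e (\<rho> j))"
        using d(2) j by (intro sum.mono_neutral_right) auto
      also have "\<dots> = fscale (\<sigma> j 0) (hc d (\<rho> j))" using \<sigma>S[OF j] by (simp add: hc_0 cst_mult_UNIV)
      finally show "hc d (\<sigma> j * \<rho> j) = fscale (\<sigma> j 0) (hc d (\<rho> j))" .
    qed
    finally have "(\<Sum>j\<in>J. fscale (\<sigma> j 0) (hc d (\<rho> j))) v = 0"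
      using \<sigma> by (simp add: rels_def fun_ops)
    then show ?thesis by (simp add: fun_ops c_def mult.commute)
  qed
  have "\<forall>j\<in>J. c j = 0"
  proof (rule ind)
    fix m assume m: "m \<in> M"
    \<comment> \<open>The roles are exchanged here: the invariants \<open>\<rho> j\<close> are the
      related elements and the \<open>\<omega> j m\<close> are the coefficients.\<close>
    have "span_rels J \<rho> (\<lambda>j. \<omega> j m)"
      using J \<rho> \<omega> m by (intro flatness) (auto simp: mult.commute)
    then show "(\<Sum>j\<in>J. fscale (c j) (\<omega> j m)) \<in> I" using orth by (rule span_rels_in_I)
  qed
  then show False using i v by (auto simp: c_def)
qed

text \<open>With more maps than elements of \<open>B\<close>, linear algebra over the domain S gives
  coefficients \<open>p j\<close>, not all zero, of a relation valid on \<open>B\<close> and hence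
  on \<open>M\<close>. It is turned into a nontrivial relation over R, which contradicts
  \<open>independent_over_invariants\<close>. \<open>M\<close> enters only as a set on which the
  maps are determined by their values on \<open>B\<close>.\<close>

lemma card_le_rank:
  assumes J: "finite J" and \<omega>: "\<And>j m. j \<in> J \<Longrightarrow> m \<in> M \<Longrightarrow> \<omega> j m \<in> S"
    and ind: "\<And>c. (\<And>m. m \<in> M \<Longrightarrow> (\<Sum>j\<in>J. fscale (c j) (\<omega> j m)) \<in> I) \<Longrightarrow> \<forall>j\<in>J. c j = 0"
    and B: "finite B" "B \<subseteq> M" "\<And>m. m \<in> M \<Longrightarrow> \<exists>c. \<forall>j\<in>J. \<omega> j m = (\<Sum>u\<in>B. fscale (c u) (\<omega> j u))"
    and eqv: "\<And>k m. k \<in> carrier K \<Longrightarrow> m \<in> M \<Longrightarrow> \<exists>m'\<in>M. \<forall>j\<in>J. fa k (\<omega> j m') = \<omega> j m"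
  shows "card J \<le> card B"
proof (rule ccontr)
  assume "\<not> ?thesis"
  then have lt: "card J > card B" by simp
  obtain h where h: "bij_betw h {..<card B} B" using ex_bij_betw_nat_finite[OF B(1)] by (auto simp: atLeast0LessThan)
  have "\<exists>p. (\<forall>j\<in>J. p j \<in> S) \<and> (\<exists>j\<in>J. p j \<noteq> 0) \<and> (\<forall>k<card B. (\<Sum>j\<in>J. p j * \<omega> j (h k)) = 0)"
  proof (rule underdetermined_system[OF one_in_S S_add S_neg S_mult S_domain J lt])
    fix j k assume "j \<in> J" "k < card B"
    then show "\<omega> j (h k) \<in> S" using h B(2) by (intro \<omega>) (auto simp: bij_betw_def)
  qed
  then obtain p i where p: "\<And>j. j \<in> J \<Longrightarrow> p j \<in> S" "i \<in> J" "p i \<noteq> 0"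
    "\<And>k. k < card B \<Longrightarrow> (\<Sum>j\<in>J. p j * \<omega> j (h k)) = 0" by blast
  have pB: "(\<Sum>j\<in>J. p j * \<omega> j u) = 0" if u: "u \<in> B" for u
  proof -
    obtain k where "k < card B" "u = h k" using u h unfolding bij_betw_def by auto
    then show ?thesis using p(4) by simp
  qed
  have pM: "(\<Sum>j\<in>J. p j * \<omega> j m) = 0" if m: "m \<in> M" for m
  proof -
    obtain c where c: "\<And>j. j \<in> J \<Longrightarrow> \<omega> j m = (\<Sum>u\<in>B. fscale (c u) (\<omega> j u))" using B(3)[OF m] by blast
    have "(\<Sum>j\<in>J. p j * \<omega> j m) = (\<Sum>j\<in>J. \<Sum>u\<in>B. fscale (c u) (p j * \<omega> j u))"
      by (intro sum.cong) (auto simp: c sum_distrib_left fscale_mult)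
    also have "\<dots> = (\<Sum>u\<in>B. fscale (c u) (\<Sum>j\<in>J. p j * \<omega> j u))"
      unfolding fv.scale_sum_right by (rule sum.swap)
    finally show ?thesis using pB by simp
  qed
  \<comment> \<open>The product of the other conjugates of \<open>p i\<close>. Then
    \<open>p i * q\<close> is the norm of \<open>p i\<close>, invariant and nonzero, so that
    averaging cannot destroy the relation.\<close>
  define q where "q = (\<Prod>g\<in>carrier K - {\<one>\<^bsub>K\<^esub>}. fa g (p i))"
  have fa_ne: "fa g (p i) \<noteq> 0" if "g \<in> carrier K" for g
  proof
    assume "fa g (p i) = 0"
    then have "fa (inv\<^bsub>K\<^esub> g) (fa g (p i)) = 0" by (simp add: fa_zero)
    then show False using that p by (simp add: fa_comp fa_one_UNIV)
  qed
  have "1 * q \<in> S \<and> 1 * q \<noteq> 0"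
    unfolding q_def using fin fa_ne p one_in_S
    by (intro S_prod_nonzero) (auto simp: fa_S)
  then have qS: "q \<in> S" by simp
  have norm: "p i * q = (\<Prod>g\<in>carrier K. fa g (p i))"
    unfolding q_def by (subst prod.remove[OF fin one_closed]) (simp add: fa_one_UNIV)
  have "p i * q \<noteq> 0"
    unfolding q_def using S_prod_nonzero[of "carrier K - {\<one>\<^bsub>K\<^esub>}" "\<lambda>g. fa g (p i)" "p i"] fin fa_ne p
    by (auto simp: fa_S)
  moreover have "p i * q \<in> R"
  proof -
    have "fa l (\<Prod>g\<in>carrier K. fa g (p i)) = (\<Prod>g\<in>carrier K. fa g (p i))" if l: "l \<in> carrier K" for l
    proof -
      have "fa l (\<Prod>g\<in>carrier K. fa g (p i)) = (\<Prod>g\<in>carrier K. fa (l \<otimes>\<^bsub>K\<^esub> g) (p i))"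
        unfolding fa_prod using l by (intro prod.cong) (auto simp: fa_comp)
      also have "\<dots> = (\<Prod>g\<in>(\<lambda>k. l \<otimes>\<^bsub>K\<^esub> k) ` carrier K. fa g (p i))"
        by (rule prod.reindex_cong[symmetric, OF inj_on_cmult[OF l] refl]) auto
      also have "(\<lambda>k. l \<otimes>\<^bsub>K\<^esub> k) ` carrier K = carrier K" by (rule surj_const_mult[OF l])
      finally show ?thesis .
    qed
    then show ?thesis using p qS S_mult[of "p i" q] by (simp add: R_iff norm)
  qed
  ultimately have ne: "Avg (p i * q) \<noteq> 0" by (simp add: Avg_R)
  \<comment> \<open>Moving the relation at a suitable \<open>m'\<close> by \<open>k\<close> gives
    the relation at \<open>m\<close> with coefficients \<open>fa k (p j * q)\<close>; these are
    summed over the group.\<close>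
  have "\<forall>j\<in>J. Avg (p j * q) = 0"
  proof (rule independent_over_invariants[OF J \<omega> ind])
    fix m assume m: "m \<in> M"
    have "(\<Sum>j\<in>J. fa k (p j * q) * \<omega> j m) = 0" if k: "k \<in> carrier K" for k
    proof -
      obtain m' where m': "m' \<in> M" "\<And>j. j \<in> J \<Longrightarrow> fa k (\<omega> j m') = \<omega> j m" using eqv[OF k m] by blast
      have "(\<Sum>j\<in>J. fa k (p j * q) * \<omega> j m) = (\<Sum>j\<in>J. fa k (p j * q * \<omega> j m'))"
        by (intro sum.cong) (auto simp: fa_mult m'(2))
      also have "\<dots> = fa k (q * (\<Sum>j\<in>J. p j * \<omega> j m'))"
        by (simp add: fa_sum[symmetric] sum_distrib_left mult_ac)
      finally show ?thesis using pM[OF m'(1)] by (simp add: fa_zero)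
    qed
    then have "(\<Sum>k\<in>carrier K. \<Sum>j\<in>J. fa k (p j * q) * \<omega> j m) = 0" by simp
    then have "fscale (1 / of_nat (card (carrier K))) (\<Sum>j\<in>J. \<Sum>k\<in>carrier K. fa k (p j * q) * \<omega> j m) = 0"
      by (subst sum.swap) simp
    then show "(\<Sum>j\<in>J. Avg (p j * q) * \<omega> j m) = 0"
      by (simp add: Avg_def fscale_mult fv.scale_sum_right sum_distrib_right)
  qed (use p qS in \<open>auto intro: Avg_in_R S_mult\<close>)
  then show False using ne p by blast
qed

end

section \<open>Generators of the invariants, their differentials and algebraic independence\<close>

context lin_group
begin

lemma hc_fspan_homogeneous:
  assumes "\<And>f. f \<in> A \<Longrightarrow> \<exists>d. f \<in> Sd d" "g \<in> fspan A"
  shows "hc j g \<in> fspan A"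
proof -
  have "g \<in> fspan A \<and> g \<in> S \<and> hc j g \<in> fspan A"
    using assms(2)
  proof (induction rule: fv.span_induct_alt)
    case base
    then show ?case by (simp add: fv.span_zero)
  next
    case (step c f g)
    then obtain d where d: "f \<in> Sd d" using assms(1) by blast
    then have "hc j f \<in> fspan A" using step(1) by (auto simp: hc_Sd fv.span_zero fv.span_base)
    then show ?case
      using step d by (simp add: hc_add hc_scale S_scale S_add Sd_in_S fv.span_add fv.span_scale fv.span_base)
  qed
  then show ?thesis by blast
qed

lemma subst_in_R:
  assumes "\<And>i. i < length fs \<Longrightarrow> fs ! i \<in> R" "p \<in> mpolys (length fs)"
  shows "poly_subst W fs p \<in> R"
proof -
  have "fa k (poly_subst W fs p) = poly_subst W fs p" if k: "k \<in> carrier K" for k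
  proof
    fix w
    show "fa k (poly_subst W fs p) w = poly_subst W fs p w"
    proof (cases "w \<in> W")
      case True
      let ?u = "act (inv\<^bsub>K\<^esub> k) w"
      have u: "?u \<in> W" using True k act_in by auto
      have eq: "(fs ! i) ?u = (fs ! i) w" if "i < length fs" for i
      proof -
        have "fa k (fs ! i) w = (fs ! i) w" using assms(1)[OF that] k by (simp add: R_iff)
        then show ?thesis using True by (simp add: fun_act_def)
      qed
      have "(\<Prod>i\<in>Poly_Mapping.keys m. (fs ! i) ?u ^ Poly_Mapping.lookup m i) =
          (\<Prod>i\<in>Poly_Mapping.keys m. (fs ! i) w ^ Poly_Mapping.lookup m i)" if "m \<in> Poly_Mapping.keys p" for m
      proof (rule prod.cong[OF refl])
        fix i assume "i \<in> Poly_Mapping.keys m"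
        then have "i < length fs" using assms(2) that by (auto simp: mpolys_def)
        then show "(fs ! i) ?u ^ Poly_Mapping.lookup m i = (fs ! i) w ^ Poly_Mapping.lookup m i"
          by (simp only: eq)
      qed
      then show ?thesis using True u by (simp add: fun_act_def poly_subst_def)
    qed (simp add: fun_act_def poly_subst_def)
  qed
  moreover have "poly_subst W fs p \<in> S" using assms R_in_S by (intro poly_subst_in_S) auto
  ultimately show ?thesis by (simp add: R_iff)
qed

text \<open>A graded form of Nakayama's lemma. In degree d an element of \<open>Z\<close> is a
  combination of products of invariants of positive degrees less than d, which are polynomials in
  \<open>Fs\<close> by induction.\<close>

lemma generators_of_invariants:
  assumes Fs: "\<And>i. i < length Fs \<Longrightarrow> Fs ! i \<in> R" "\<And>i. i < length Fs \<Longrightarrow> \<exists>d. Fs ! i \<in> Sd d"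
    and gen: "\<And>f. f \<in> R0 \<Longrightarrow> \<exists>a\<in>fspan (set Fs). \<exists>z\<in>Z. f = a + z"
  shows "R = poly_subst W Fs ` mpolys (length Fs)"
proof
  let ?P = "poly_subst W Fs ` mpolys (length Fs)"
  note P_sub = subst_subspace[of W Fs "length Fs"]
  show "?P \<subseteq> R" using subst_in_R Fs(1) by blast
  have set_P: "fspan (set Fs) \<subseteq> ?P"
  proof (rule fv.span_minimal[OF _ P_sub], rule subsetI)
    fix f assume "f \<in> set Fs"
    then obtain i where i: "i < length Fs" "f = Fs ! i" by (auto simp: in_set_conv_nth)
    then have "Fs ! i \<in> S" using Fs(1) R_in_S by blast
    then show "f \<in> ?P" using i S_outside by (auto intro!: nth_in_subst)
  qed
  have deg: "f \<in> R \<Longrightarrow> f \<in> Sd d \<Longrightarrow> f \<in> ?P" for f d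
  proof (induction d arbitrary: f rule: less_induct)
    case (less d)
    show ?case
    proof (cases "d = 0")
      case True
      then obtain c where "f = cst c" using less Sd_0_iff by auto
      then show ?thesis using one_in_subst by (simp add: cst_def)
    next
      case False
      then obtain a z where az: "a \<in> fspan (set Fs)" "z \<in> Z" "f = a + z" using gen R0_Sd less by blast
      have zS: "z \<in> S" using az(2) Z_R0 R0_in_R R_in_S by blast
      have aS: "a \<in> S" using S_diff[OF Sd_in_S[OF less(3)] zS] az(3) by simp
      have "f = hc d f" using hc_Sd[OF less(3)] by simp
      also have "\<dots> = hc d a + hc d z" using aS zS by (simp add: az(3) hc_add)
      also have "hc d a + hc d z \<in> ?P"
      proof (rule fv.subspace_add[OF P_sub])
        have "hc d a \<in> fspan (set Fs)"
          using az(1) Fs(2) by (intro hc_fspan_homogeneous) (auto simp: in_set_conv_nth)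
        then show "hc d a \<in> ?P" using set_P by blast
        have "z \<in> S \<and> hc d z \<in> ?P"
          using az(2) unfolding Z_def
        proof (induction rule: fv.span_induct_alt)
          case base
          then show ?case using fv.subspace_0[OF P_sub] by simp
        next
          case (step c h y)
          then obtain f g where h: "h = f * g" "f \<in> R0" "g \<in> R0" by blast
          then have fg: "f \<in> R" "g \<in> R" "f \<in> S" "g \<in> S" "f 0 = 0" "g 0 = 0" using R_in_S by (auto simp: R0_def)
          have "hc d h = (\<Sum>i\<le>d. hc (d - i) f * hc i g)" unfolding h(1) using fg by (intro hc_prod)
          also have "\<dots> \<in> ?P"
          proof (rule fv.subspace_sum[OF P_sub])
            fix i assume "i \<in> {..d}"
            \<comment> \<open>In the two extreme cases one factor is a component of degree 0 of an
              invariant vanishing at 0.\<close>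
            then consider "i = 0" | "i = d" | "0 < i" "i < d" by fastforce
            then show "hc (d - i) f * hc i g \<in> ?P"
            proof cases
              case 3
              have "hc (d - i) f \<in> ?P" using 3 fg by (intro less.IH[of "d - i"] R_hc hc_in) auto
              moreover have "hc i g \<in> ?P" using 3 fg by (intro less.IH[of i] R_hc hc_in) auto
              ultimately show ?thesis by (rule subst_mult_closed)
            qed (use fg hc_0_eq_0 fv.subspace_0[OF P_sub] in auto)
          qed
          finally have "hc d h \<in> ?P" .
          moreover have "h \<in> S" using h fg by (simp add: S_mult)
          ultimately show ?case
            using step by (auto simp: hc_add hc_scale S_scale S_add intro!: fv.subspace_add[OF P_sub] fv.subspace_scale[OF P_sub])
        qed
        then show "hc d z \<in> ?P" by blast
      qed
      finally show ?thesis .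
    qed
  qed
  show "R \<subseteq> ?P"
  proof
    fix f assume f: "f \<in> R"
    then obtain n where n: "f = (\<Sum>d<n. hc d f)" using hc_expand R_in_S by blast
    have "(\<Sum>d<n. hc d f) \<in> ?P" using f R_hc hc_in R_in_S by (intro fv.subspace_sum[OF P_sub] deg) blast+
    then show "f \<in> ?P" using n by simp
  qed
qed

lemma differentials_independent:
  assumes "finite J" and F: "\<And>j. j \<in> J \<Longrightarrow> F j \<in> R" "\<And>j. j \<in> J \<Longrightarrow> F j \<in> Sd (d j)" "\<And>j. j \<in> J \<Longrightarrow> d j > 0"
    and ind: "\<And>c. (\<Sum>j\<in>J. fscale (c j) (F j)) \<in> Z \<Longrightarrow> \<forall>j\<in>J. c j = 0"
    and c: "\<And>w. w \<in> W \<Longrightarrow> (\<Sum>j\<in>J. fscale (c j) (D w (F j))) \<in> I"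
  shows "\<forall>j\<in>J. c j = 0"
proof (rule euler_independent[OF assms(1) finite_lessThan F(1) ind])
  fix l assume "l \<in> {..<r}"
  then show "x l \<in> S" "x l 0 = 0" "(\<Sum>j\<in>J. fscale (c j) (D (b l) (F j))) \<in> I"
    using x_dual DS_in_S b_in c by auto
next
  fix j assume j: "j \<in> J"
  show "(\<Sum>l<r. x l * D (b l) (F j)) = fscale (of_nat (d j)) (F j)" using F(2)[OF j] by (rule euler)
  show "complex_of_nat (d j) \<noteq> 0" using F(3)[OF j] by simp
qed

lemma D_expand:
  assumes "f \<in> S" "w \<in> W"
  shows "D w f = (\<Sum>k<r. fscale (x k w) (D (b k) f))"
proof -
  have "D (\<Sum>k<l. scale (x k w) (b k)) f = (\<Sum>k<l. fscale (x k w) (D (b k) f)) \<and> (\<Sum>k<l. scale (x k w) (b k)) \<in> W"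
    if "l \<le> r" for l
    using that
  proof (induction l)
    case 0
    have "D (scale 0 0) f = fscale 0 (D 0 f)" using assms by (intro D_dir_scale) auto
    then show ?case by simp
  next
    case (Suc l)
    then show ?case using assms b_in[of l] by (simp add: D_dir_add D_dir_scale W_scale W_add)
  qed
  from this[of r] show ?thesis using expand[OF assms(2)] by simp
qed

end

context refl_group
begin

text \<open>Bounds the size of a minimal generating system before finite generation is
  known.\<close>

lemma card_le_rank_differentials:
  assumes "finite J" "\<And>j. j \<in> J \<Longrightarrow> F j \<in> R" "\<And>j. j \<in> J \<Longrightarrow> F j \<in> Sd (d j)" "\<And>j. j \<in> J \<Longrightarrow> d j > 0"
    and "\<And>c. (\<Sum>j\<in>J. fscale (c j) (F j)) \<in> Z \<Longrightarrow> \<forall>j\<in>J. c j = 0"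
  shows "card J \<le> r"
proof -
  have "card J \<le> card (b ` {..<r})"
  proof (rule card_le_rank[where M = UNIV and \<omega> = "\<lambda>j w. D w (F j)"])
    show "\<forall>j\<in>J. c j = 0" if "\<And>m. m \<in> UNIV \<Longrightarrow> (\<Sum>j\<in>J. fscale (c j) (D m (F j))) \<in> I" for c
      by (rule differentials_independent[where F = F and d = d]) (use assms that in auto)
    fix m :: 'a
    show "\<exists>c. \<forall>j\<in>J. D m (F j) = (\<Sum>u\<in>b ` {..<r}. fscale (c u) (D u (F j)))"
    proof -
      note inj = b_inj
      show ?thesis
      proof (intro exI[of _ "\<lambda>u. x (inv_into {..<r} b u) m"] ballI)
        fix j assume "j \<in> J"
        then show "D m (F j) = (\<Sum>u\<in>b ` {..<r}. fscale (x (inv_into {..<r} b u) m) (D u (F j)))"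
          using D_expand[of "F j" m] assms(2) R_in_S by (simp add: sum.reindex[OF inj] inv_into_f_f[OF inj])
      qed
    qed
    fix k assume k: "k \<in> carrier K"
    have "act k (act (inv\<^bsub>K\<^esub> k) m) = m" using act_inv(2)[OF k] by simp
    then have "\<forall>j\<in>J. fa k (D (act (inv\<^bsub>K\<^esub> k) m) (F j)) = D m (F j)"
      using D_equivariant[OF assms(2) _ k] by simp
    then show "\<exists>m'\<in>UNIV. \<forall>j\<in>J. fa k (D m' (F j)) = D m (F j)" by blast
  qed (use assms D_in_S R_in_S in auto)
  also have "\<dots> \<le> r" using card_image_le[of "{..<r}" b] by simp
  finally show ?thesis .
qed

text \<open>By the chain rule, a polynomial relation \<open>p\<close> gives a linear relation
  between the differentials whose coefficients are the partial derivatives of \<open>p\<close> at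
  \<open>Fs\<close>. So these derivatives are polynomial relations of lower total degree, zero by
  induction, and in characteristic 0 \<open>p\<close> is constant. \<open>N\<close> bounds the total
  degree.\<close>

lemma alg_independent_of_differentials:
  assumes Fs: "\<And>i. i < length Fs \<Longrightarrow> Fs ! i \<in> R"
    and ind: "\<And>\<rho>. (\<And>i. i < length Fs \<Longrightarrow> \<rho> i \<in> R) \<Longrightarrow> (\<And>w. (\<Sum>i<length Fs. \<rho> i * D w (Fs ! i)) = 0) \<Longrightarrow>
      \<forall>i<length Fs. \<rho> i = 0"
  shows "alg_independent UNIV Fs"
proof -
  let ?n = "length Fs" and ?l = "Poly_Mapping.lookup" and ?e = "\<lambda>i. Poly_Mapping.single i (1::nat)"
  have *: "p = 0" if "p \<in> mpolys ?n" "poly_subst UNIV Fs p = 0"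
      "\<And>m. m \<in> Poly_Mapping.keys p \<Longrightarrow> (\<Sum>i<?n. ?l m i) \<le> N" for p N
    using that
  proof (induction N arbitrary: p)
    case (0 p)
    have "m = 0" if "m \<in> Poly_Mapping.keys p" for m
    proof (rule poly_mapping_eqI)
      fix i
      have "i \<notin> Poly_Mapping.keys m \<or> i < ?n" using 0(1) that by (auto simp: mpolys_def)
      then show "?l m i = ?l 0 i" using 0(3)[OF that] by (auto simp: in_keys_iff)
    qed
    then have sub: "Poly_Mapping.keys p \<subseteq> {0}" by blast
    have "poly_subst UNIV Fs p = fscale (?l p 0) (subst_monom UNIV Fs 0)"
      using poly_subst_superset[OF _ sub] by simp
    then have "?l p 0 = 0" using 0(2) by (simp add: subst_monom_0 fun_eq_iff fun_ops)
    then show ?case using sub by (intro poly_mapping_eqI) (auto simp: in_keys_iff subset_iff)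
  next
    case (Suc N p)
    have "\<forall>i<?n. poly_subst UNIV Fs (mpderiv i p) = 0"
    proof (rule ind)
      show "poly_subst UNIV Fs (mpderiv i p) \<in> R" for i
        using Fs Suc.prems by (intro subst_in_R mpderiv_mpolys)
      fix w
      have "(\<Sum>i<?n. poly_subst UNIV Fs (mpderiv i p) * D w (Fs ! i)) = D w (poly_subst UNIV Fs p)"
        using Fs R_in_S Suc.prems by (intro D_poly_subst[symmetric]) auto
      then show "(\<Sum>i<?n. poly_subst UNIV Fs (mpderiv i p) * D w (Fs ! i)) = 0"
        using Suc.prems by (simp add: D_zero)
    qed
    have zero: "mpderiv i p = 0" if i: "i < ?n" for i
    proof (rule Suc.IH)
      show "mpderiv i p \<in> mpolys ?n" using Suc.prems by (intro mpderiv_mpolys)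
      show "poly_subst UNIV Fs (mpderiv i p) = 0"
        using \<open>\<forall>i<?n. poly_subst UNIV Fs (mpderiv i p) = 0\<close> i by blast
      fix m assume "m \<in> Poly_Mapping.keys (mpderiv i p)"
      then have "m + ?e i \<in> Poly_Mapping.keys p" by (auto simp: in_keys_iff lookup_mpderiv)
      then have "(\<Sum>j<?n. ?l (m + ?e i) j) \<le> Suc N" by (rule Suc.prems)
      moreover have "(\<Sum>j<?n. ?l (m + ?e i) j) = (\<Sum>j<?n. ?l m j) + (\<Sum>j<?n. if j = i then 1 else 0)"
        unfolding sum.distrib[symmetric] by (intro sum.cong) (auto simp: lookup_add lookup_single when_def)
      ultimately show "(\<Sum>j<?n. ?l m j) \<le> N" using i by simp
    qed
    have "\<And>m. m \<in> Poly_Mapping.keys p \<Longrightarrow> (\<Sum>i<?n. ?l m i) \<le> N"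
    proof -
      fix m assume m: "m \<in> Poly_Mapping.keys p"
      have "?l m i = 0" if i: "i < ?n" for i
      proof (rule ccontr)
        assume ne: "?l m i \<noteq> 0"
        then have "m = (m - ?e i) + ?e i"
          by (intro poly_mapping_eqI) (auto simp: lookup_add lookup_minus lookup_single when_def)
        then have "?l (mpderiv i p) (m - ?e i) = of_nat (Suc (?l (m - ?e i) i)) * ?l p m"
          by (simp only: lookup_mpderiv)
        moreover have "\<dots> \<noteq> 0" using m by (simp add: in_keys_iff del: of_nat_Suc)
        ultimately show False using zero[OF i] by simp
      qed
      then show "(\<Sum>i<?n. ?l m i) \<le> N" by simp
    qed
    then show ?case using Suc.IH Suc.prems by blast
  qed
  show ?thesis
    unfolding alg_independent_def
  proof (intro ballI impI)
    fix p assume p: "p \<in> mpolys ?n" "poly_subst UNIV Fs p = 0"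
    show "p = 0"
    proof (rule *[OF p, of "\<Sum>m\<in>Poly_Mapping.keys p. \<Sum>i<?n. ?l m i"])
      show "m \<in> Poly_Mapping.keys p \<Longrightarrow> (\<Sum>i<?n. ?l m i) \<le> (\<Sum>m\<in>Poly_Mapping.keys p. \<Sum>i<?n. ?l m i)" for m
        by (rule member_le_sum) auto
    qed
  qed
qed

text \<open>If there were fewer than \<open>r\<close> generators, some nonzero vector field would kill all invariants,
  in particular the power sums of the orbit of a coordinate; Lagrange interpolation at a generic point
  shows that it kills the coordinates as well.\<close>

lemma rank_le_generators:
  assumes Fs: "\<And>i. i < length Fs \<Longrightarrow> Fs ! i \<in> R" and gen: "R = poly_subst UNIV Fs ` mpolys (length Fs)"
  shows "r \<le> length Fs"
proof (rule ccontr)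
  let ?n = "length Fs"
  assume "\<not> ?thesis"
  then have lt: "card {..<r} > ?n" by simp
  have "\<exists>p. (\<forall>k\<in>{..<r}. p k \<in> S) \<and> (\<exists>k\<in>{..<r}. p k \<noteq> 0) \<and> (\<forall>i<?n. (\<Sum>k\<in>{..<r}. p k * D (b k) (Fs ! i)) = 0)"
    using Fs R_in_S
    by (intro underdetermined_system[OF one_in_S S_add S_neg S_mult S_domain finite_lessThan lt] D_in_S) auto
  then obtain p k0 where p: "\<And>k. k < r \<Longrightarrow> p k \<in> S" "k0 < r" "p k0 \<noteq> 0"
      "\<And>i. i < ?n \<Longrightarrow> (\<Sum>k<r. p k * D (b k) (Fs ! i)) = 0" by blast
  define \<Delta> where "\<Delta> f = (\<Sum>k<r. p k * D (b k) f)" for f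
  have \<Delta>_R: "\<Delta> f = 0" if f: "f \<in> R" for f
  proof -
    obtain q where q: "q \<in> mpolys ?n" "f = poly_subst UNIV Fs q" using f gen by auto
    have "\<Delta> f = (\<Sum>k<r. \<Sum>i<?n. poly_subst UNIV Fs (mpderiv i q) * (p k * D (b k) (Fs ! i)))"
      unfolding \<Delta>_def q(2) using q(1) Fs R_in_S
      by (intro sum.cong refl) (simp add: D_poly_subst sum_distrib_left mult_ac)
    also have "\<dots> = (\<Sum>i<?n. poly_subst UNIV Fs (mpderiv i q) * (\<Sum>k<r. p k * D (b k) (Fs ! i)))"
      unfolding sum_distrib_left by (rule sum.swap)
    finally show ?thesis using p(4) by simp
  qed
  have \<Delta>_sum: "\<Delta> (\<Sum>g\<in>A. f g) = (\<Sum>g\<in>A. \<Delta> (f g))" if "finite A" "\<And>g. g \<in> A \<Longrightarrow> f g \<in> S" for A :: "'g set" and f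
  proof -
    have "\<Delta> (\<Sum>g\<in>A. f g) = (\<Sum>k<r. \<Sum>g\<in>A. p k * D (b k) (f g))"
      unfolding \<Delta>_def using that by (simp add: D_sum sum_distrib_left)
    also have "\<dots> = (\<Sum>g\<in>A. \<Delta> (f g))" unfolding \<Delta>_def by (rule sum.swap)
    finally show ?thesis .
  qed
  have \<Delta>_power: "\<Delta> (f ^ Suc e) = fscale (of_nat (Suc e)) (f ^ e * \<Delta> f)" if "f \<in> S" for f e
    unfolding \<Delta>_def D_power[OF that] by (simp add: fv.scale_sum_right sum_distrib_left fscale_mult mult_ac)
  have x0: "x k0 \<in> S" using x_dual[OF p(2)] DS_in_S by blast
  define y where "y g = fa g (x k0)" for g
  have yS: "y g \<in> S" if "g \<in> carrier K" for g using that x0 by (simp add: y_def fa_S)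
  have y1: "y \<one>\<^bsub>K\<^esub> = x k0" by (simp add: y_def fa_one_UNIV)
  have "\<Delta> (x k0) = (\<Sum>k<r. if k = k0 then p k0 else 0)"
    unfolding \<Delta>_def using p(2) x_b x_dual[OF p(2)]
    by (intro sum.cong refl) (auto simp: D_lin cst_mult_UNIV mult.commute[of "p _"])
  then have \<Delta>x: "\<Delta> (x k0) = p k0" using p(2) by simp
  \<comment> \<open>The power sum of exponent \<open>Suc e\<close> over the orbit is invariant,
    hence killed by \<open>\<Delta>\<close>; the factor \<open>Suc e\<close> is cancelled.\<close>
  have pow: "(\<Sum>g\<in>carrier K. y g ^ e * \<Delta> (y g)) = 0" for e
  proof -
    have fa_pow: "fa g (f ^ n) = fa g f ^ n" for g f n
      using fa_prod[of g "\<lambda>_. f" "{..<n}"] by simp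
    have "(\<Sum>g\<in>carrier K. y g ^ Suc e) = fscale (of_nat (card (carrier K))) (Avg (x k0 ^ Suc e))"
      using card_K by (simp add: Avg_def y_def fa_pow fa_mult)
    also have "\<dots> \<in> R" using x0 by (intro fv.subspace_scale[OF R_subspace] Avg_in_R S_power)
    finally have "0 = \<Delta> (\<Sum>g\<in>carrier K. y g ^ Suc e)" by (simp add: \<Delta>_R)
    also have "\<dots> = (\<Sum>g\<in>carrier K. \<Delta> (y g ^ Suc e))" using fin yS by (intro \<Delta>_sum S_power)
    also have "\<dots> = (\<Sum>g\<in>carrier K. fscale (of_nat (Suc e)) (y g ^ e * \<Delta> (y g)))"
      using yS by (intro sum.cong refl \<Delta>_power)
    also have "\<dots> = fscale (of_nat (Suc e)) (\<Sum>g\<in>carrier K. y g ^ e * \<Delta> (y g))"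
      by (simp add: fv.scale_sum_right)
    finally show ?thesis by (simp add: fv.scale_eq_0_iff del: of_nat_Suc)
  qed
  \<comment> \<open>\<open>A\<close> contains the group elements whose conjugate differs from
    \<open>x k0\<close> as a function. The point \<open>v\<close> is chosen so that these conjugates
    differ from it in value as well, and so that \<open>p k0\<close> is nonzero there.\<close>
  define A where "A = {g \<in> carrier K. y g \<noteq> x k0}"
  have "p k0 * (\<Prod>g\<in>A. y g - x k0) \<in> S \<and> p k0 * (\<Prod>g\<in>A. y g - x k0) \<noteq> 0"
    using fin yS x0 p by (intro S_prod_nonzero) (auto simp: A_def S_diff)
  then obtain v where v: "(p k0 * (\<Prod>g\<in>A. y g - x k0)) v \<noteq> 0" by (auto simp: fun_eq_iff fun_ops)
  then have pv: "p k0 v \<noteq> 0" and yv: "\<And>g. g \<in> A \<Longrightarrow> y g v \<noteq> x k0 v"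
    using fin by (auto simp: fun_ops A_def prod_zero_iff)
  \<comment> \<open>The interpolating polynomial: weighting the vanishing sums by its coefficients
    leaves only the group elements outside \<open>A\<close>, each with the same nonzero
    contribution.\<close>
  define q where "q = (\<Prod>g\<in>A. [:- y g v, 1:])"
  have q_A: "poly q (y g v) = 0" if "g \<in> A" for g
    unfolding q_def poly_prod using that fin by (intro prod_zero) (auto simp: A_def)
  have "finite A" using fin by (simp add: A_def)
  then have q_x: "poly q (x k0 v) \<noteq> 0" unfolding q_def poly_prod using yv by (fastforce simp: prod_zero_iff)
  have "0 = (\<Sum>e\<le>Polynomial.degree q. poly.coeff q e * (\<Sum>g\<in>carrier K. y g ^ e * \<Delta> (y g)) v)"
    by (simp add: pow zero_fun_apply)
  also have "\<dots> = (\<Sum>g\<in>carrier K. poly q (y g v) * \<Delta> (y g) v)"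
    unfolding fun_ops poly_altdef sum_distrib_left sum_distrib_right by (subst sum.swap) (simp add: mult_ac)
  also have "\<dots> = (\<Sum>g\<in>carrier K - A. poly q (x k0 v) * p k0 v)"
  proof (rule sum.mono_neutral_cong_right)
    show "\<forall>g\<in>carrier K - (carrier K - A). poly q (y g v) * \<Delta> (y g) v = 0" using q_A by auto
    show "poly q (y g v) * \<Delta> (y g) v = poly q (x k0 v) * p k0 v" if "g \<in> carrier K - A" for g
      using that \<Delta>x by (simp add: A_def)
  qed (use fin in auto)
  also have "\<dots> \<noteq> 0"
  proof -
    have "\<one>\<^bsub>K\<^esub> \<in> carrier K - A" by (simp add: A_def y1)
    then have "card (carrier K - A) \<noteq> 0" using fin by auto
    then show ?thesis using q_x pv by simp
  qed
  finally show False by simp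
qed

end

subsection \<open>Duals\<close>

lemma (in polyspace) polyspace_dual:
  "polyspace fscale DS r x (\<lambda>k \<phi>. if \<phi> \<in> DS then \<phi> (b k) else 0)"
proof
  show "fv.subspace DS" by (rule DS_subspace)
  fix k assume k: "k < r"
  show "x k \<in> DS" by (rule x_dual[OF k])
  show "(\<lambda>\<phi>. if \<phi> \<in> DS then \<phi> (b k) else 0) \<in> dual_space fscale DS"
    using DS_subspace by (auto simp: dual_space_def[of fscale] fun_ops dest: fv.subspace_add fv.subspace_scale)
  fix l assume "l < r"
  then show "(if x l \<in> DS then x l (b k) else 0) = (if k = l then 1 else 0)"
    using k x_b x_dual by simp
next
  fix \<phi> assume "\<phi> \<in> DS"
  then show "(\<Sum>k<r. fscale (if \<phi> \<in> DS then \<phi> (b k) else 0) (x k)) = \<phi>"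
    using DS_expand[of \<phi>] by simp
qed

lemma (in lin_group) fa_DS: "k \<in> carrier K \<Longrightarrow> l \<in> DS \<Longrightarrow> fa k l \<in> DS"
  unfolding dual_space_def fun_act_def
  by (auto simp: act_in act_add act_scale W_add W_scale)

lemma (in lin_group) lin_group_dual:
  "lin_group fscale DS r x (\<lambda>k \<phi>. if \<phi> \<in> DS then \<phi> (b k) else 0) K fa"
  by (intro lin_group.intro polyspace_dual lin_group_axioms.intro is_group fin)
    (auto simp: fa_DS fa_add fa_scale fa_comp DS_outside intro: fa_one)

subsection \<open>Linear forms\<close>

lemma (in polyspace) comp_S:
  assumes "f \<in> S" and "\<And>w. w \<in> W \<Longrightarrow> \<tau> w \<in> W"
    and "\<And>v w. v \<in> W \<Longrightarrow> w \<in> W \<Longrightarrow> \<tau> (v + w) = \<tau> v + \<tau> w"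
    and "\<And>c w. w \<in> W \<Longrightarrow> \<tau> (scale c w) = scale c (\<tau> w)"
  shows "(\<lambda>w. if w \<in> W then f (\<tau> w) else 0) \<in> S"
  using assms(1)
proof (induction rule: S_induct)
  case (Sd d f)
  then show ?case using comp_Sd[of f d \<tau>] assms Sd_in_S by blast
next
  case (add f g)
  have "(\<lambda>w. if w \<in> W then (f + g) (\<tau> w) else 0) =
      (\<lambda>w. if w \<in> W then f (\<tau> w) else 0) + (\<lambda>w. if w \<in> W then g (\<tau> w) else 0)"
    by (auto simp: fun_eq_iff fun_ops)
  then show ?case using add S_add by simp
qed

text \<open>Substituting the projection along \<open>u\<close> onto the kernel of \<open>l2\<close> kills \<open>P1\<close>.\<close>

lemma (in polyspace) linear_forms_regular:
  assumes l: "l1 \<in> DS" "l2 \<in> DS" "l1 \<noteq> 0" and u: "u \<in> W" "l1 u = 0" "l2 u = 1"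
    and P: "P1 \<in> S" "P2 \<in> S" "P1 * l1 + P2 * l2 = 0"
  shows "\<exists>q\<in>S. P1 = l2 * q"
proof -
  define \<tau> where "\<tau> w = w + scale (- l2 w) u" for w
  have \<tau>W: "\<tau> w \<in> W" if "w \<in> W" for w unfolding \<tau>_def using that u by (intro W_add W_scale)
  have \<tau>_add: "\<tau> (v + w) = \<tau> v + \<tau> w" if "v \<in> W" "w \<in> W" for v w
    using that l by (simp add: \<tau>_def DS_add algebra_simps)
  have \<tau>_scale: "\<tau> (scale c w) = scale c (\<tau> w)" if "w \<in> W" for c w
    using that l by (simp add: \<tau>_def DS_scale algebra_simps)
  define P where "P = (\<lambda>w. if w \<in> W then P1 (\<tau> w) else 0)"
  have PS: "P \<in> S" unfolding P_def by (rule comp_S[OF P(1) \<tau>W \<tau>_add \<tau>_scale])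
  have "P * l1 = 0"
  proof
    fix w show "(P * l1) w = 0 w"
    proof (cases "w \<in> W")
      case True
      have "l1 (\<tau> w) = l1 w" "l2 (\<tau> w) = 0"
        using True l(1,2) u DS_add[OF l(1) True] DS_add[OF l(2) True] DS_scale[OF l(1) u(1)] DS_scale[OF l(2) u(1)]
        by (simp_all add: \<tau>_def W_scale del: scale_minus_left)
      then show ?thesis using arg_cong[OF P(3), of "\<lambda>f. f (\<tau> w)"] True by (simp add: P_def fun_ops)
    qed (simp add: P_def fun_ops)
  qed
  then have "P = 0" using S_domain[OF PS] l DS_in_S by blast
  obtain n where n: "P1 \<in> lt n" using S_in_lt[OF P(1)] by blast
  then have "P1 \<in> lt (Suc n)" using lt_mono[of n "Suc n"] by auto
  then have "\<exists>q\<in>lt n. \<forall>w\<in>W. P1 (\<tau> w) - P1 w = (- l2) w * q w"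
    by (rule division[OF _ _ u(1) fv.subspace_neg[OF DS_subspace l(2)]]) (simp add: \<tau>_def uminus_apply)
  then obtain q where q: "q \<in> lt n" "\<And>w. w \<in> W \<Longrightarrow> P1 (\<tau> w) - P1 w = - l2 w * q w" by (auto simp: fun_ops)
  have "P1 = l2 * q"
  proof
    fix w show "P1 w = (l2 * q) w"
    proof (cases "w \<in> W")
      case True
      have "P w = 0" using \<open>P = 0\<close> by (simp add: zero_fun_apply)
      then have "P1 (\<tau> w) = 0" using True by (simp add: P_def)
      then show ?thesis using q(2)[OF True] by (simp add: fun_ops)
    next
      case False
      then show ?thesis using S_outside[OF P(1) False] DS_outside[OF l(2) False] by (simp add: fun_ops)
    qed
  qed
  then show ?thesis using q(1) lt_in_S by blast
qed

subsection \<open>Degrees\<close>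

context lin_group
begin

lemma fundamentalD:
  assumes "fundamental_invariants scale W K act fs ds"
  shows "length fs = r" "length ds = r" "i < r \<Longrightarrow> fs ! i \<in> Sd (ds ! i)" "i < r \<Longrightarrow> ds ! i > 0"
    "i < r \<Longrightarrow> fs ! i \<in> R0" "R = poly_subst W fs ` mpolys r" "alg_independent W fs"
    "(\<Sum>i<r. fscale (c i) (fs ! i)) \<in> Z \<Longrightarrow> \<forall>i<r. c i = 0"
proof -
  show len: "length fs = r" "length ds = r" using assms by (simp_all add: fundamental_invariants_def dim_W)
  show Sd: "fs ! i \<in> Sd (ds ! i)" if "i < r" for i using assms that len by (simp add: fundamental_invariants_def)
  show R: "R = poly_subst W fs ` mpolys r" using assms len by (simp add: fundamental_invariants_def R_def)
  show ind: "alg_independent W fs" using assms by (simp add: fundamental_invariants_def)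
  show pos: "ds ! i > 0" if i: "i < r" for i
  proof (rule ccontr)
    assume "\<not> ds ! i > 0"
    then obtain c where c: "fs ! i = cst c" using Sd[OF i] Sd_0_iff by auto
    let ?e = "Poly_Mapping.single i (1::nat)"
    have ne: "?e \<noteq> 0" by (metis lookup_single_eq lookup_zero zero_neq_one)
    \<comment> \<open>Coefficients of X_i - c, a nonzero polynomial relation satisfied by a constant
      generator c.\<close>
    define a where "a m = (if m = ?e then 1 else - c)" for m
    have "(\<Sum>m\<in>{?e, 0}. fscale (a m) (subst_monom W fs m)) = 0"
      using ne by (auto simp: a_def subst_monom_single subst_monom_0 c cst_def fun_eq_iff fun_ops simp del: One_nat_def)
    then have "a ?e = 0" using i len by (intro subst_monom_independent[OF ind _ _ _, of "{?e, 0}"]) auto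
    then show False by (simp add: a_def)
  qed
  show R0: "fs ! i \<in> R0" if i: "i < r" for i
  proof -
    have "fs ! i \<in> R" unfolding R using i len Sd_outside[OF Sd[OF i]] by (intro nth_in_subst) auto
    then show ?thesis using R0_Sd Sd[OF i] pos[OF i] by blast
  qed
  show "\<forall>i<r. c i = 0" if "(\<Sum>i<r. fscale (c i) (fs ! i)) \<in> Z"
  proof (intro allI impI)
    fix i assume i: "i < r"
    show "c i = 0"
    proof (rule subst_linear_part[OF ind, of 0 R0])
      show "(\<Sum>i<length fs. fscale (c i) (fs ! i)) \<in> fspan {f * g |f g. f \<in> R0 \<and> g \<in> R0}"
        using that by (simp add: Z_def len)
      show "R0 = {f \<in> poly_subst W fs ` mpolys (length fs). f 0 = 0}" by (simp add: R0_def R len)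
    qed (use i len R0 Sd_outside[OF Sd] in \<open>auto simp: R0_def\<close>)
  qed
qed

interpretation self: equivariant_module scale W r b x K act scale W r b x act
  by unfold_locales

lemma differential_hom: "f \<in> R \<Longrightarrow> f \<in> Sd d \<Longrightarrow> (\<lambda>w. D w f) \<in> self.hom_space (d - 1)"
  unfolding self.hom_space_def using R_in_S D_Sd by (auto simp: D_dir_add D_dir_scale D_equivariant)

text \<open>Uniqueness of the degrees follows from the fake degrees of the representation itself:
  every system of fundamental invariants computes them as its degrees minus one, and positivity
  makes this truncated subtraction reversible. The bound \<open>ub\<close> is a hypothesis because
  it has two sources: flatness on V for groups given by reflections, and pullback to V for
  H.\<close>

lemma degrees_and_fake_degrees:
  assumes ub: "\<And>\<psi>s. (\<And>\<psi>. \<psi> \<in> set \<psi>s \<Longrightarrow> \<exists>j. \<psi> \<in> self.hom_space j) \<Longrightarrow> self.indep \<psi>s \<Longrightarrow> length \<psi>s \<le> r"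
    and fund: "fundamental_invariants scale W K act fs ds"
  shows "degrees scale W K act = mset ds"
    and "fake_degrees scale W K act scale W act = mset (map (\<lambda>d. d - 1) ds)"
proof -
  have fake: "coinv_mult scale W K act scale W act j = count (mset (map (\<lambda>d. d - 1) ds')) j"
      "fake_degrees scale W K act scale W act = mset (map (\<lambda>d. d - 1) ds')"
    if f: "fundamental_invariants scale W K act fs' ds'" for fs' ds' j
  proof -
    note F = fundamentalD[OF f]
    have map: "map (\<lambda>d. d - 1) ds' = map (\<lambda>i. ds' ! i - 1) [0..<r]"
      using F(2) by (auto intro: nth_equalityI)
    have hom: "(\<lambda>w. D w (fs' ! i)) \<in> self.hom_space (ds' ! i - 1)" if "i < r" for i
      using F that R0_in_R by (intro differential_hom) auto
    have ind: "\<forall>i<r. c i = 0" if "\<And>w. w \<in> W \<Longrightarrow> (\<Sum>i<r. fscale (c i) (D w (fs' ! i))) \<in> I" for c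
    proof -
      have "\<forall>i\<in>{..<r}. c i = 0"
        by (rule differentials_independent[where F = "(!) fs'" and d = "(!) ds'"])
          (use F R0_in_R that in \<open>auto simp: Ball_def\<close>)
      then show ?thesis by simp
    qed
    show "coinv_mult scale W K act scale W act j = count (mset (map (\<lambda>d. d - 1) ds')) j"
      unfolding map by (rule self.fake_degrees_eq(1)[OF hom ind ub])
    show "fake_degrees scale W K act scale W act = mset (map (\<lambda>d. d - 1) ds')"
      unfolding map by (rule self.fake_degrees_eq(2)[OF hom ind ub])
  qed
  show "fake_degrees scale W K act scale W act = mset (map (\<lambda>d. d - 1) ds)" by (rule fake(2)[OF fund])
  have Suc: "image_mset Suc (mset (map (\<lambda>d. d - 1) ds')) = mset ds'"
    if f: "fundamental_invariants scale W K act fs' ds'" for fs' ds'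
  proof -
    have "map (\<lambda>d. Suc (d - 1)) ds' = ds'"
      using fundamentalD(2,4)[OF f] by (intro map_idI) (auto simp: in_set_conv_nth)
    then show ?thesis by (simp add: image_mset.compositionality comp_def flip: mset_map)
  qed
  show "degrees scale W K act = mset ds"
    unfolding degrees_def
  proof (rule the_equality)
    show "\<exists>fs' ds'. fundamental_invariants scale W K act fs' ds' \<and> mset ds = mset ds'" using fund by blast
    fix E assume "\<exists>fs' ds'. fundamental_invariants scale W K act fs' ds' \<and> E = mset ds'"
    then obtain fs' ds' where *: "fundamental_invariants scale W K act fs' ds'" "E = mset ds'" by blast
    then have "mset (map (\<lambda>d. d - 1) ds') = mset (map (\<lambda>d. d - 1) ds)" using fake(2)[OF fund] fake(2)[OF *(1)] by simp
    then show "E = mset ds" using Suc[OF fund] Suc[OF *(1)] * by metis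
  qed
qed

end

context refl_group
begin

lemma R_of_reflections:
  assumes "f \<in> S" "\<And>s. s \<in> Rf \<Longrightarrow> fa s f = f"
  shows "f \<in> R"
proof -
  have "fa k f = f" if "k \<in> carrier K" for k
    using that unfolding generated
  proof (induction rule: generate.induct)
    case one
    then show ?case by (rule fa_one_UNIV)
  next
    case (incl s)
    then show ?case by (rule assms(2))
  next
    case (inv s)
    then have "s \<in> carrier K" "fa s f = f" using Rf_carrier assms(2) by auto
    then show ?case using fa_comp[of "inv\<^bsub>K\<^esub> s" s f] by (simp add: fa_one_UNIV)
  next
    case (eng g h)
    then have "g \<in> carrier K" "h \<in> carrier K" unfolding generated by auto
    then show ?case using eng fa_comp[of g h f] by simp
  qed
  then show ?thesis using assms(1) by (simp add: R_iff)
qed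

text \<open>A maximal subset of \<open>X\<close> independent modulo \<open>Z\<close> has at most
  \<open>r\<close> elements by flatness; it generates R, so it has at least \<open>r\<close>.
  Drawing the generators from a prescribed \<open>X\<close> preserves extra structure, later the
  block to which each generator belongs.\<close>

lemma fundamental_invariants_exist:
  assumes X: "\<And>f. f \<in> X \<Longrightarrow> f \<in> R" "\<And>f. f \<in> X \<Longrightarrow> f \<in> Sd (d f)" "\<And>f. f \<in> X \<Longrightarrow> d f > 0"
    and gen: "\<And>f. f \<in> R0 \<Longrightarrow> \<exists>a\<in>fspan X. \<exists>z\<in>Z. f = a + z"
  shows "\<exists>Fs. set Fs \<subseteq> X \<and> fundamental_invariants scale UNIV K act Fs (map d Fs)"
proof -
  define ind where "ind J \<longleftrightarrow> (\<forall>c. (\<Sum>f\<in>J. fscale (c f) f) \<in> Z \<longrightarrow> (\<forall>f\<in>J. c f = 0))" for J :: "('a \<Rightarrow> complex) set"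
  define Q where "Q J \<longleftrightarrow> finite J \<and> J \<subseteq> X \<and> ind J" for J
  have bound: "card J \<le> r" if "Q J" for J
    by (rule card_le_rank_differentials[where F = "\<lambda>f. f" and d = d])
      (use that X in \<open>auto simp: Q_def ind_def subset_iff\<close>)
  have "Q {}" by (simp add: Q_def ind_def)
  then obtain J where J: "Q J" "\<And>J'. Q J' \<Longrightarrow> card J' \<le> card J"
    using ex_has_greatest_nat[of Q "{}" card "Suc r"] bound by (auto simp: less_Suc_eq_le)
  then have JX: "finite J" "J \<subseteq> X" "ind J" by (auto simp: Q_def)
  have span: "\<exists>a\<in>fspan J. \<exists>z\<in>Z. f = a + z" if f: "f \<in> X" for f
  proof (cases "f \<in> J")
    case True
    then show ?thesis by (intro bexI[of _ f] bexI[of _ 0]) (auto simp: fv.span_base fv.subspace_0[OF Z_subspace])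
  next
    case False
    then have "\<not> Q (insert f J)" using J(2)[of "insert f J"] JX by auto
    then obtain c g where c: "(\<Sum>f\<in>insert f J. fscale (c f) f) \<in> Z" "g \<in> insert f J" "c g \<noteq> 0"
      using JX f by (auto simp: Q_def ind_def)
    then have c': "fscale (c f) f + (\<Sum>f\<in>J. fscale (c f) f) \<in> Z" using False JX by simp
    have "c f \<noteq> 0"
    proof
      assume "c f = 0"
      then show False using c c' JX(3) by (auto simp: ind_def)
    qed
    have "fscale (1 / c f) (fscale (c f) f + (\<Sum>f\<in>J. fscale (c f) f)) \<in> Z"
      using c' by (intro fv.subspace_scale[OF Z_subspace])
    moreover have "fscale (- 1 / c f) (\<Sum>f\<in>J. fscale (c f) f) \<in> fspan J"
      by (intro fv.span_scale fv.span_sum fv.span_base)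
    moreover have "f = fscale (- 1 / c f) (\<Sum>f\<in>J. fscale (c f) f) +
        fscale (1 / c f) (fscale (c f) f + (\<Sum>f\<in>J. fscale (c f) f))"
      using \<open>c f \<noteq> 0\<close> by (simp add: fun_eq_iff fun_ops algebra_simps)
    ultimately show ?thesis by blast
  qed
  have sumset: "fv.subspace {f. \<exists>a\<in>fspan J. \<exists>z\<in>Z. f = a + z}"
  proof (rule fv.subspaceI)
    show "0 \<in> {f. \<exists>a\<in>fspan J. \<exists>z\<in>Z. f = a + z}"
      using fv.span_zero fv.subspace_0[OF Z_subspace] by (intro CollectI bexI[of _ 0]) auto
  next
    fix f g assume "f \<in> {f. \<exists>a\<in>fspan J. \<exists>z\<in>Z. f = a + z}" "g \<in> {f. \<exists>a\<in>fspan J. \<exists>z\<in>Z. f = a + z}"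
    then obtain a z a' z' where "a \<in> fspan J" "z \<in> Z" "f = a + z" "a' \<in> fspan J" "z' \<in> Z" "g = a' + z'" by blast
    then show "f + g \<in> {f. \<exists>a\<in>fspan J. \<exists>z\<in>Z. f = a + z}"
      by (intro CollectI bexI[of _ "a + a'"] bexI[of _ "z + z'"]) (auto simp: fv.span_add fv.subspace_add[OF Z_subspace])
  next
    fix c f assume "f \<in> {f. \<exists>a\<in>fspan J. \<exists>z\<in>Z. f = a + z}"
    then obtain a z where "a \<in> fspan J" "z \<in> Z" "f = a + z" by blast
    then show "fscale c f \<in> {f. \<exists>a\<in>fspan J. \<exists>z\<in>Z. f = a + z}"
      by (intro CollectI bexI[of _ "fscale c a"] bexI[of _ "fscale c z"])
        (auto simp: fv.span_scale fv.subspace_scale[OF Z_subspace] fv.scale_right_distrib)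
  qed
  have genJ: "\<exists>a\<in>fspan J. \<exists>z\<in>Z. f = a + z" if "f \<in> R0" for f
  proof -
    obtain a z where az: "a \<in> fspan X" "z \<in> Z" "f = a + z" using gen[OF \<open>f \<in> R0\<close>] by blast
    have "fspan X \<subseteq> {f. \<exists>a\<in>fspan J. \<exists>z\<in>Z. f = a + z}" using span by (intro fv.span_minimal[OF _ sumset]) blast
    then obtain a' z' where "a' \<in> fspan J" "z' \<in> Z" "a = a' + z'" using az(1) by blast
    then show ?thesis
      using az by (intro bexI[of _ a'] bexI[of _ "z' + z"]) (auto simp: fv.subspace_add[OF Z_subspace])
  qed
  obtain Fs where Fs: "set Fs = J" "distinct Fs" using finite_distinct_list[OF JX(1)] by blast
  have FsX: "Fs ! i \<in> X" if "i < length Fs" for i using that Fs(1) JX(2) nth_mem by blast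
  have R_gen: "R = poly_subst UNIV Fs ` mpolys (length Fs)"
  proof (rule generators_of_invariants)
    show "\<And>f. f \<in> R0 \<Longrightarrow> \<exists>a\<in>fspan (set Fs). \<exists>z\<in>Z. f = a + z" unfolding Fs(1) by (rule genJ)
  qed (use X FsX in blast)+
  have "r \<le> length Fs" by (rule rank_le_generators[OF _ R_gen]) (use X FsX in blast)
  moreover have "length Fs \<le> r" using bound[OF J(1)] Fs distinct_card[OF Fs(2)] by simp
  ultimately have len: "length Fs = r" by simp
  have bij: "bij_betw ((!) Fs) {..<r} J" using bij_betw_nth[OF Fs(2)] Fs(1) len by simp
  have indFs: "\<forall>i\<in>{..<r}. c i = 0" if c: "(\<Sum>i<r. fscale (c i) (Fs ! i)) \<in> Z" for c
  proof -
    define c' where "c' f = c (inv_into {..<r} ((!) Fs) f)" for f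
    have c': "c' (Fs ! i) = c i" if "i < r" for i using that bij by (simp add: c'_def bij_betw_def inv_into_f_f)
    have "(\<Sum>f\<in>J. fscale (c' f) f) = (\<Sum>i<r. fscale (c' (Fs ! i)) (Fs ! i))"
      using sum.reindex_bij_betw[OF bij, of "\<lambda>f. fscale (c' f) f"] by simp
    also have "\<dots> = (\<Sum>i<r. fscale (c i) (Fs ! i))" using c' by simp
    finally have "\<forall>f\<in>J. c' f = 0" using c JX(3) by (auto simp: ind_def)
    then show ?thesis using c' bij by (auto simp: bij_betw_def)
  qed
  have "alg_independent UNIV Fs"
  proof (rule alg_independent_of_differentials)
    show "\<And>i. i < length Fs \<Longrightarrow> Fs ! i \<in> R" using X FsX by blast
    fix \<rho> assume \<rho>: "\<And>i. i < length Fs \<Longrightarrow> \<rho> i \<in> R" "\<And>w. (\<Sum>i<length Fs. \<rho> i * D w (Fs ! i)) = 0"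
    have "\<forall>i\<in>{..<r}. \<rho> i = 0"
    proof (rule independent_over_invariants[where M = UNIV and \<omega> = "\<lambda>i w. D w (Fs ! i)"])
      fix c assume "\<And>m. m \<in> UNIV \<Longrightarrow> (\<Sum>i<r. fscale (c i) (D m (Fs ! i))) \<in> I"
      then show "\<forall>i\<in>{..<r}. c i = 0"
        by (intro differentials_independent[where F = "(!) Fs" and d = "\<lambda>i. d (Fs ! i)", OF _ _ _ _ indFs])
          (use X FsX len in auto)
    qed (use \<rho> X FsX R_in_S D_in_S len in auto)
    then show "\<forall>i<length Fs. \<rho> i = 0" by (simp add: len)
  qed
  then have "fundamental_invariants scale UNIV K act Fs (map d Fs)"
    using R_gen X FsX len by (auto simp: fundamental_invariants_def R_def dim_W)
  then show ?thesis using Fs(1) JX(2) by blast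
qed

end

section \<open>Equivariant maps from a module of a reflection group\<close>

locale refl_module = refl_group scale r b x K act Rf + M: lin_group scaleM M n bM xM K actM
  for scale :: "complex \<Rightarrow> 'a::ab_group_add \<Rightarrow> 'a" and r b x
    and K :: "('g, 'z) monoid_scheme" and act Rf
    and scaleM :: "complex \<Rightarrow> 'm::ab_group_add \<Rightarrow> 'm" and M n bM xM and actM
begin

sublocale equivariant_module scale UNIV r b x K act scaleM M n bM xM actM
  by unfold_locales

text \<open>Supplies the hypothesis \<open>ub\<close> of \<open>fake_degrees_eq\<close>: an
  equivariant map is determined by its values on the basis of \<open>M\<close>, so
  \<open>card_le_rank\<close> applies.\<close>

lemma length_indep_le:
  assumes \<psi>s: "\<And>\<psi>. \<psi> \<in> set \<psi>s \<Longrightarrow> \<exists>j. \<psi> \<in> hom_space j" and ind: "indep \<psi>s"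
  shows "length \<psi>s \<le> n"
proof -
  have hom: "\<exists>j. \<psi>s ! i \<in> hom_space j" if "i < length \<psi>s" for i using \<psi>s that by simp
  note inj = M.b_inj
  have "card {..<length \<psi>s} \<le> card (bM ` {..<n})"
  proof (rule card_le_rank[where M = M and \<omega> = "(!) \<psi>s"])
    fix j m assume "j \<in> {..<length \<psi>s}" "m \<in> M"
    then show "(\<psi>s ! j) m \<in> S" using hom[of j] hom_spaceD(1) Sd_in_S by blast
  next
    fix c assume "\<And>m. m \<in> M \<Longrightarrow> (\<Sum>j<length \<psi>s. fscale (c j) ((\<psi>s ! j) m)) \<in> I"
    then show "\<forall>j\<in>{..<length \<psi>s}. c j = 0" using indepD[OF ind] by blast
  next
    fix m assume m: "m \<in> M"
    have *: "(\<psi>s ! j) m = (\<Sum>k<n. fscale (xM k m) ((\<psi>s ! j) (bM k)))" if j: "j < length \<psi>s" for j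
    proof -
      obtain e where e: "\<psi>s ! j \<in> hom_space e" using hom[OF j] by blast
      have "(\<psi>s ! j) (\<Sum>k<l. scaleM (xM k m) (bM k)) = (\<Sum>k<l. fscale (xM k m) ((\<psi>s ! j) (bM k))) \<and>
          (\<Sum>k<l. scaleM (xM k m) (bM k)) \<in> M" if "l \<le> n" for l
        using that
      proof (induction l)
        case 0
        have "(\<psi>s ! j) (scaleM 0 0) = fscale 0 ((\<psi>s ! j) 0)" by (rule hom_spaceD(3)[OF e]) simp
        then show ?case by simp
      next
        case (Suc l)
        then show ?case using M.b_in[of l] hom_spaceD(2,3)[OF e] by (simp add: M.W_scale M.W_add)
      qed
      from this[of n] show ?thesis using M.expand[OF m] by simp
    qed
    show "\<exists>c. \<forall>j\<in>{..<length \<psi>s}. (\<psi>s ! j) m = (\<Sum>u\<in>bM ` {..<n}. fscale (c u) ((\<psi>s ! j) u))"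
      by (intro exI[of _ "\<lambda>u. xM (inv_into {..<n} bM u) m"])
        (auto simp: sum.reindex[OF inj] inv_into_f_f[OF inj] *)
  next
    fix k m assume k: "k \<in> carrier K" and m: "m \<in> M"
    have "\<forall>j\<in>{..<length \<psi>s}. fa k ((\<psi>s ! j) (actM (inv\<^bsub>K\<^esub> k) m)) = (\<psi>s ! j) m"
    proof
      fix j assume "j \<in> {..<length \<psi>s}"
      then obtain e where e: "\<psi>s ! j \<in> hom_space e" using hom by blast
      show "fa k ((\<psi>s ! j) (actM (inv\<^bsub>K\<^esub> k) m)) = (\<psi>s ! j) m"
        using hom_spaceD(4)[OF e k, of "actM (inv\<^bsub>K\<^esub> k) m"] k m by (simp add: M.act_in M.act_inv)
    qed
    then show "\<exists>m'\<in>M. \<forall>j\<in>{..<length \<psi>s}. fa k ((\<psi>s ! j) m') = (\<psi>s ! j) m"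
      using k m M.act_in by blast
  qed (use M.b_in in auto)
  then show ?thesis using card_image[OF inj] by simp
qed

end

lemma (in refl_group) degrees_of_fundamental_invariants:
  assumes "fundamental_invariants scale UNIV K act fs ds"
  shows "degrees scale UNIV K act = mset ds"
    and "fake_degrees scale UNIV K act scale UNIV act = mset (map (\<lambda>d. d - 1) ds)"
proof -
  interpret self: refl_module scale r b x K act Rf scale UNIV r b x act
    by unfold_locales
  show "degrees scale UNIV K act = mset ds"
    "fake_degrees scale UNIV K act scale UNIV act = mset (map (\<lambda>d. d - 1) ds)"
    using degrees_and_fake_degrees[OF self.length_indep_le assms] by blast+
qed

section \<open>Normal reflection subgroups\<close>

text \<open>Both groups act on the same V, so polynomial functions, derivations and components are
  shared; the invariants, the ideals and the averages depend on the group.\<close>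

locale refl_pair = G: refl_group scale r b x KG act RG + N: refl_group scale r b x "KG\<lparr>carrier := N\<rparr>" act RN
    + normal N KG
  for scale :: "complex \<Rightarrow> 'v::ab_group_add \<Rightarrow> 'v" and r b x
    and KG :: "('g, 'z) monoid_scheme" and act RG N RN +
  fixes fs :: "('v \<Rightarrow> complex) list" and ds :: "nat list" and Es :: "('v \<Rightarrow> complex) set"
  assumes fund: "fundamental_invariants scale UNIV (KG\<lparr>carrier := N\<rparr>) act fs ds"
    and Es: "Es = fspan (set fs)"
    and stable: "g \<in> carrier KG \<Longrightarrow> f \<in> Es \<Longrightarrow> fun_act KG act UNIV g f \<in> Es"
begin

section \<open>Coordinates on E^* and the action of H on E\<close>

lemmas fundN = N.fundamentalD[OF fund]

lemma Es_subspace: "fv.subspace Es"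
  by (simp add: Es)

lemma fs_in: "k < r \<Longrightarrow> fs ! k \<in> Es"
  unfolding Es using fundN(1) by (intro fv.span_base) simp

lemma fs_ind: "(\<Sum>k<r. fscale (c k) (fs ! k)) = 0 \<Longrightarrow> k < r \<Longrightarrow> c k = 0"
  using fundN(8)[of c] fv.subspace_0[OF N.Z_subspace] by simp

definition be :: "nat \<Rightarrow> ('v \<Rightarrow> complex) \<Rightarrow> complex" where
  "be k f = (if f \<in> Es then (SOME c. f = (\<Sum>k<r. fscale (c k) (fs ! k))) k else 0)"

lemma Es_expand: "f \<in> Es \<Longrightarrow> f = (\<Sum>k<r. fscale (be k f) (fs ! k))"
proof -
  assume f: "f \<in> Es"
  have "fv.subspace {f. \<exists>c. f = (\<Sum>k<r. fscale (c k) (fs ! k))}"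
  proof (rule fv.subspaceI)
    show "0 \<in> {f. \<exists>c. f = (\<Sum>k<r. fscale (c k) (fs ! k))}" by (intro CollectI exI[of _ "\<lambda>_. 0"]) simp
  next
    fix f g assume "f \<in> {f. \<exists>c. f = (\<Sum>k<r. fscale (c k) (fs ! k))}" "g \<in> {f. \<exists>c. f = (\<Sum>k<r. fscale (c k) (fs ! k))}"
    then obtain c c' where "f = (\<Sum>k<r. fscale (c k) (fs ! k))" "g = (\<Sum>k<r. fscale (c' k) (fs ! k))" by blast
    then show "f + g \<in> {f. \<exists>c. f = (\<Sum>k<r. fscale (c k) (fs ! k))}"
      by (intro CollectI exI[of _ "\<lambda>k. c k + c' k"]) (simp add: fv.scale_left_distrib sum.distrib)
  next
    fix a f assume "f \<in> {f. \<exists>c. f = (\<Sum>k<r. fscale (c k) (fs ! k))}"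
    then obtain c where "f = (\<Sum>k<r. fscale (c k) (fs ! k))" by blast
    then show "fscale a f \<in> {f. \<exists>c. f = (\<Sum>k<r. fscale (c k) (fs ! k))}"
      by (intro CollectI exI[of _ "\<lambda>k. a * c k"]) (simp add: fv.scale_sum_right)
  qed
  moreover have "set fs \<subseteq> {f. \<exists>c. f = (\<Sum>k<r. fscale (c k) (fs ! k))}"
  proof
    fix f assume "f \<in> set fs"
    then obtain i where i: "i < r" "f = fs ! i" using fundN(1) by (auto simp: in_set_conv_nth)
    have "f = (\<Sum>k<r. if k = i then f else 0)" using i by simp
    also have "\<dots> = (\<Sum>k<r. fscale (if k = i then 1 else 0) (fs ! k))" using i by (intro sum.cong) auto
    finally show "f \<in> {f. \<exists>c. f = (\<Sum>k<r. fscale (c k) (fs ! k))}"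
      by (intro CollectI exI[of _ "\<lambda>k. if k = i then 1 else 0"])
  qed
  ultimately have "Es \<subseteq> {f. \<exists>c. f = (\<Sum>k<r. fscale (c k) (fs ! k))}" unfolding Es by (intro fv.span_minimal)
  then have "\<exists>c. f = (\<Sum>k<r. fscale (c k) (fs ! k))" using f by blast
  from someI_ex[OF this] show ?thesis using f by (simp add: be_def)
qed

lemma be_eq:
  assumes "f = (\<Sum>k<r. fscale (c k) (fs ! k))" "k < r"
  shows "be k f = c k"
proof -
  have "f \<in> Es" unfolding assms(1)
    by (intro fv.subspace_sum[OF Es_subspace] fv.subspace_scale[OF Es_subspace] fs_in) simp
  then have "(\<Sum>k<r. fscale (be k f - c k) (fs ! k)) = 0"
    using Es_expand assms(1) by (simp add: fv.scale_left_diff_distrib sum_subtractf)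
  from fs_ind[OF this assms(2)] show ?thesis by simp
qed

lemma polyspace_Es: "polyspace fscale Es r ((!) fs) be"
proof
  show "fv.subspace Es" by (rule Es_subspace)
  fix k assume k: "k < r"
  show "fs ! k \<in> Es" using k by (rule fs_in)
  show "be k \<in> dual_space fscale Es"
    unfolding dual_space_def
  proof (intro CollectI conjI ballI allI impI)
    fix f g assume "f \<in> Es" "g \<in> Es"
    then have "f + g = (\<Sum>k<r. fscale (be k f + be k g) (fs ! k))"
      using Es_expand by (simp add: fv.scale_left_distrib sum.distrib flip: Es_expand)
    then show "be k (f + g) = be k f + be k g" using k by (rule be_eq)
  next
    fix c f assume "f \<in> Es"
    then have "fscale c f = fscale c (\<Sum>k<r. fscale (be k f) (fs ! k))" using Es_expand by simp
    also have "\<dots> = (\<Sum>k<r. fscale (c * be k f) (fs ! k))" by (simp add: fv.scale_sum_right)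
    finally show "be k (fscale c f) = c * be k f" using k by (rule be_eq)
  qed (simp add: be_def)
  fix l assume l: "l < r"
  have "fs ! l = (\<Sum>k<r. if k = l then fs ! l else 0)" using l by simp
  also have "\<dots> = (\<Sum>k<r. fscale (if k = l then 1 else 0) (fs ! k))" by (intro sum.cong) auto
  finally show "be k (fs ! l) = (if k = l then 1 else 0)" using k by (rule be_eq)
next
  fix f assume "f \<in> Es"
  then show "(\<Sum>k<r. fscale (be k f) (fs ! k)) = f" using Es_expand by simp
qed

sublocale EsG: lin_group fscale Es r "(!) fs" be KG "fun_act KG act UNIV"
  by (intro lin_group.intro polyspace_Es lin_group_axioms.intro G.is_group G.fin)
    (auto simp: stable G.fa_add G.fa_scale G.fa_comp G.fa_one_UNIV)

abbreviation "E \<equiv> dual_space fscale Es"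
abbreviation "xe \<equiv> \<lambda>k \<phi>. if \<phi> \<in> E then \<phi> (fs ! k) else 0"
abbreviation "actE \<equiv> fun_act KG (fun_act KG act UNIV) Es"
abbreviation "H \<equiv> KG Mod N"

definition "actH C \<phi> = the_elem ((\<lambda>g. actE g \<phi>) ` C)"

text \<open>In E, the dual of \<open>Es\<close>, the coordinate functionals \<open>be\<close> become
  the basis and the evaluations \<open>xe\<close> at the \<open>fs\<close> become the
  coordinates.\<close>

sublocale EG: lin_group fscale E r be xe KG actE
  by (rule EsG.lin_group_dual)

lemma N_in: "n \<in> N \<Longrightarrow> n \<in> carrier KG"
  using subset by auto

lemma N_fa: "n \<in> N \<Longrightarrow> N.fa n f = G.fa n f"
  using G.m_inv_consistent[OF subgroup_axioms] by (simp add: fun_act_def)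

lemma R_sub: "f \<in> G.R \<Longrightarrow> f \<in> N.R"
  using N_in by (simp add: G.R_iff N.R_iff N_fa)

lemma Es_N: "f \<in> Es \<Longrightarrow> f \<in> N.R0"
proof -
  have "Es \<subseteq> N.R0"
    unfolding Es using fundN(1,5) by (intro fv.span_minimal[OF _ N.R0_subspace]) (auto simp: in_set_conv_nth)
  then show "f \<in> Es \<Longrightarrow> f \<in> N.R0" by auto
qed

lemma Es_fa: "f \<in> Es \<Longrightarrow> n \<in> N \<Longrightarrow> G.fa n f = f"
  using Es_N[of f] N_fa[of n f] by (auto simp: N.R0_def N.R_iff)

lemma cosetD: "C \<in> carrier H \<Longrightarrow> g \<in> C \<Longrightarrow> g \<in> carrier KG \<and> C = N #>\<^bsub>KG\<^esub> g"
proof -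
  assume C: "C \<in> carrier H" "g \<in> C"
  then obtain a where a: "a \<in> carrier KG" "C = N #>\<^bsub>KG\<^esub> a" by (auto simp: carrier_FactGroup)
  then show ?thesis using C G.repr_independence[OF _ a(1) subgroup_axioms, of g]
    by (auto simp: r_coset_def N_in)
qed

lemma carrier_H_nonempty: "C \<in> carrier H \<Longrightarrow> \<exists>g. g \<in> C"
proof -
  assume "C \<in> carrier H"
  then obtain a where "a \<in> carrier KG" "C = N #>\<^bsub>KG\<^esub> a" by (auto simp: carrier_FactGroup)
  then show ?thesis using G.rcos_self[OF _ subgroup_axioms] by blast
qed

lemma actH_eq: "C \<in> carrier H \<Longrightarrow> g \<in> C \<Longrightarrow> actH C \<phi> = actE g \<phi>"
proof -
  assume C: "C \<in> carrier H" "g \<in> C"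
  then have g: "g \<in> carrier KG" "C = N #>\<^bsub>KG\<^esub> g" using cosetD by auto
  have "actE h \<phi> = actE g \<phi>" if h: "h \<in> C" for h
  proof
    fix f
    obtain n where n: "n \<in> N" "h = n \<otimes>\<^bsub>KG\<^esub> g" using h g(2) by (auto simp: r_coset_def)
    have "G.fa (inv\<^bsub>KG\<^esub> h) f = G.fa (inv\<^bsub>KG\<^esub> g) f" if "f \<in> Es"
    proof -
      have "G.fa (inv\<^bsub>KG\<^esub> h) f = G.fa (inv\<^bsub>KG\<^esub> g) (G.fa (inv\<^bsub>KG\<^esub> n) f)"
        using g n N_in by (simp add: G.inv_mult_group G.fa_comp)
      then show ?thesis using Es_fa[OF that m_inv_closed[OF n(1)]] by simp
    qed
    then show "actE h \<phi> f = actE g \<phi> f" by (simp add: fun_act_def[of KG "fun_act KG act UNIV"])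
  qed
  then have "(\<lambda>g. actE g \<phi>) ` C \<subseteq> {actE g \<phi>}" by blast
  then have "(\<lambda>g. actE g \<phi>) ` C = {actE g \<phi>}" using C(2) by blast
  then show ?thesis by (simp add: actH_def)
qed

lemma lin_group_H: "lin_group fscale E r be xe H actH"
proof (intro lin_group.intro EG.polyspace_axioms lin_group_axioms.intro factorgroup_is_group)
  show "finite (carrier H)" using G.fin by (simp add: carrier_FactGroup)
next
  fix C \<phi> assume C: "C \<in> carrier H" and \<phi>: "\<phi> \<in> E"
  then obtain g where g: "g \<in> C" using carrier_H_nonempty by blast
  then have gK: "g \<in> carrier KG" using cosetD C by blast
  show "actH C \<phi> \<in> E" using EG.act_in[OF gK \<phi>] actH_eq[OF C g] by simp
  show "actH C (fscale c \<phi>) = fscale c (actH C \<phi>)" for c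
    using EG.act_scale[OF gK \<phi>] actH_eq[OF C g] by simp
  show "actH C (\<phi> + \<psi>) = actH C \<phi> + actH C \<psi>" if "\<psi> \<in> E" for \<psi>
    using EG.act_add[OF gK \<phi> that] actH_eq[OF C g] by simp
  show "actH (C \<otimes>\<^bsub>H\<^esub> D) \<phi> = actH C (actH D \<phi>)" if D: "D \<in> carrier H" for D
  proof -
    obtain h where h: "h \<in> D" using carrier_H_nonempty D by blast
    then have hK: "h \<in> carrier KG" using cosetD D by blast
    have "C \<otimes>\<^bsub>H\<^esub> D \<in> carrier H" using C D group.is_monoid[OF factorgroup_is_group] by (rule monoid.m_closed[rotated])
    moreover have "g \<otimes>\<^bsub>KG\<^esub> h \<in> C \<otimes>\<^bsub>H\<^esub> D" using g h by (auto simp: set_mult_def)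
    ultimately show ?thesis using actH_eq[OF C g] actH_eq[OF D h] EG.act_mult[OF gK hK \<phi>] by (simp add: actH_eq)
  qed
next
  fix \<phi> assume \<phi>: "\<phi> \<in> E"
  have "\<one>\<^bsub>H\<^esub> \<in> carrier H" using group.is_monoid[OF factorgroup_is_group] by (rule monoid.one_closed)
  moreover have "\<one>\<^bsub>KG\<^esub> \<in> \<one>\<^bsub>H\<^esub>" by simp
  ultimately have "actH \<one>\<^bsub>H\<^esub> \<phi> = actE \<one>\<^bsub>KG\<^esub> \<phi>" by (rule actH_eq)
  then show "actH \<one>\<^bsub>H\<^esub> \<phi> = \<phi>" using EG.act_one[OF \<phi>] by simp
qed

sublocale EH: lin_group fscale E r be xe H actH
  by (rule lin_group_H)

subsection \<open>Polynomial functions on the quotient\<close>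

text \<open>\<open>ev\<close> is the quotient map from $V$ to $E = V/N$, and \<open>pull\<close> identifies $S(E^*)$ with $S(V^*)^N$.\<close>

definition ev :: "'v \<Rightarrow> ('v \<Rightarrow> complex) \<Rightarrow> complex" where
  "ev v = (\<lambda>f. if f \<in> Es then f v else 0)"

definition pull :: "((('v \<Rightarrow> complex) \<Rightarrow> complex) \<Rightarrow> complex) \<Rightarrow> 'v \<Rightarrow> complex" where
  "pull F = (\<lambda>v. F (ev v))"

lemma ev_in: "ev v \<in> E"
  using Es_subspace by (auto simp: dual_space_def ev_def fun_ops fv.subspace_add fv.subspace_scale)

lemma ev_act: "g \<in> carrier KG \<Longrightarrow> ev (act g v) = actE g (ev v)"
  by (auto simp: ev_def fun_act_def stable[unfolded fun_act_def] fun_eq_iff)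
    (use stable[of "inv\<^bsub>KG\<^esub> g"] in \<open>auto simp: fun_act_def\<close>)

lemma ev_0: "ev 0 = 0"
  using Es_N by (auto simp: ev_def N.R0_def fun_eq_iff fun_ops)

lemma pull_add: "pull (F + F') = pull F + pull F'"
  and pull_diff: "pull (F - F') = pull F - pull F'"
  and pull_mult: "pull (F * F') = pull F * pull F'"
  and pull_scale: "pull (fscale c F) = fscale c (pull F)"
  and pull_zero: "pull 0 = 0"
  by (auto simp: pull_def fun_ops fun_eq_iff)

lemma pull_sum: "pull (\<Sum>i\<in>A. F i) = (\<Sum>i\<in>A. pull (F i))"
  by (auto simp: pull_def fun_ops fun_eq_iff)

lemma pull_at_0: "pull F 0 = F 0"
  by (simp add: pull_def ev_0)

lemma pull_cst: "pull (EG.cst c) = G.cst c"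
  by (auto simp: pull_def EG.cst_def G.cst_def ev_in)

lemma pull_xe: "k < r \<Longrightarrow> pull (xe k) = fs ! k"
proof -
  have "pull (xe k) = (\<lambda>v. ev v (fs ! k))" by (simp add: pull_def ev_in)
  then show "k < r \<Longrightarrow> ?thesis" by (simp add: ev_def fs_in)
qed

lemma pull_poly_subst:
  assumes "p \<in> mpolys (length Fs)"
  shows "pull (poly_subst E Fs p) = poly_subst UNIV (map pull Fs) p"
proof
  fix v
  have "(\<Prod>i\<in>Poly_Mapping.keys m. (Fs ! i) (ev v) ^ Poly_Mapping.lookup m i) =
      (\<Prod>i\<in>Poly_Mapping.keys m. (map pull Fs ! i) v ^ Poly_Mapping.lookup m i)" if "m \<in> Poly_Mapping.keys p" for m
  proof (rule prod.cong[OF refl])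
    fix i assume "i \<in> Poly_Mapping.keys m"
    then have "i < length Fs" using assms that by (auto simp: mpolys_def)
    then show "(Fs ! i) (ev v) ^ Poly_Mapping.lookup m i = (map pull Fs ! i) v ^ Poly_Mapping.lookup m i"
      by (simp add: pull_def)
  qed
  then show "pull (poly_subst E Fs p) v = poly_subst UNIV (map pull Fs) p v"
    by (simp add: pull_def poly_subst_def ev_in)
qed

lemma pull_subst_xe: "p \<in> mpolys r \<Longrightarrow> pull (poly_subst E (map xe [0..<r]) p) = poly_subst UNIV fs p"
proof -
  have "map pull (map xe [0..<r]) = fs"
    using fundN(1) pull_xe by (intro nth_equalityI) auto
  then show "p \<in> mpolys r \<Longrightarrow> ?thesis" using pull_poly_subst[of p "map xe [0..<r]"] by simp
qed

lemma pull_S: "F \<in> EG.S \<Longrightarrow> pull F \<in> N.R"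
  unfolding EG.S_eq_subst fundN(6) using pull_subst_xe by auto

lemma pull_ex: "f \<in> N.R \<Longrightarrow> \<exists>F\<in>EG.S. f = pull F"
proof -
  assume "f \<in> N.R"
  then obtain p where p: "p \<in> mpolys r" "f = poly_subst UNIV fs p" unfolding fundN(6) by blast
  then have "f = pull (poly_subst E (map xe [0..<r]) p)" by (simp add: pull_subst_xe)
  then show ?thesis unfolding EG.S_eq_subst using p(1) by blast
qed

lemma pull_eq_0: "F \<in> EG.S \<Longrightarrow> pull F = 0 \<Longrightarrow> F = 0"
  unfolding EG.S_eq_subst using pull_subst_xe fundN(1,7) by (auto simp: alg_independent_def)

lemma pull_inj: "F \<in> EG.S \<Longrightarrow> F' \<in> EG.S \<Longrightarrow> pull F = pull F' \<Longrightarrow> F = F'"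
  using pull_eq_0[of "F - F'"] by (simp add: EG.S_diff pull_diff)

lemma pull_fa:
  assumes C: "C \<in> carrier H" "g \<in> C"
  shows "pull (EH.fa C F) = G.fa g (pull F)"
proof
  fix v
  have g: "g \<in> carrier KG" using cosetD C by blast
  have inv: "inv\<^bsub>H\<^esub> C = set_inv\<^bsub>KG\<^esub> C" using C(1) by (rule inv_FactGroup)
  have "inv\<^bsub>KG\<^esub> g \<in> inv\<^bsub>H\<^esub> C" unfolding inv using C(2) by (auto simp: SET_INV_def)
  moreover have "inv\<^bsub>H\<^esub> C \<in> carrier H" using C(1) group.inv_closed[OF factorgroup_is_group] by blast
  ultimately have "actH (inv\<^bsub>H\<^esub> C) (ev v) = ev (act (inv\<^bsub>KG\<^esub> g) v)"
    using g by (simp add: actH_eq ev_act)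
  then show "pull (EH.fa C F) v = G.fa g (pull F) v"
    by (simp add: pull_def fun_act_def ev_in)
qed

lemma EH_R_iff: "F \<in> EH.R \<longleftrightarrow> F \<in> EG.S \<and> pull F \<in> G.R"
proof
  assume F: "F \<in> EH.R"
  have "G.fa g (pull F) = pull F" if g: "g \<in> carrier KG" for g
  proof -
    have C: "N #>\<^bsub>KG\<^esub> g \<in> carrier H" "g \<in> N #>\<^bsub>KG\<^esub> g"
      using g G.rcos_self[OF g subgroup_axioms] by (auto simp: carrier_FactGroup)
    then show ?thesis using pull_fa[OF C, of F] F by (simp add: EH.R_iff)
  qed
  then show "F \<in> EG.S \<and> pull F \<in> G.R" using F pull_S N.R_in_S by (auto simp: EH.R_iff G.R_iff)
next
  assume F: "F \<in> EG.S \<and> pull F \<in> G.R"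
  have "EH.fa C F = F" if C: "C \<in> carrier H" for C
  proof -
    obtain g where g: "g \<in> C" using carrier_H_nonempty C by blast
    then have "g \<in> carrier KG" using cosetD C by blast
    then have "pull (EH.fa C F) = pull F" using F pull_fa[OF C g, of F] by (simp add: G.R_iff)
    then show ?thesis using F C by (intro pull_inj) (auto simp: EH.fa_S)
  qed
  then show "F \<in> EH.R" using F by (simp add: EH.R_iff)
qed

lemma Avg_I: "p \<in> G.I \<Longrightarrow> \<exists>F\<in>EH.I. N.Avg p = pull F"
proof (induction rule: G.I_induct)
  case zero
  then show ?case using fv.subspace_0[OF EH.I_subspace] by (intro bexI[of _ 0]) (auto simp: N.Avg_zero pull_zero)
next
  case (base s h)
  then have h: "h \<in> G.R" "h 0 = 0" by (auto simp: G.R0_def)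
  obtain s' where s': "s' \<in> EG.S" "N.Avg s = pull s'" using pull_ex[OF N.Avg_in_R[OF base(1)]] by blast
  obtain h' where h': "h' \<in> EG.S" "h = pull h'" using pull_ex[OF R_sub[OF h(1)]] by blast
  have "h' \<in> EH.R0" using h h' by (simp add: EH.R0_def EH_R_iff pull_at_0)
  then have "s' * h' \<in> EH.I" using s' by (intro EH.I_base)
  moreover have "N.Avg (s * h) = pull (s' * h')" using R_sub[OF h(1)] by (simp add: N.Avg_mult pull_mult s' h')
  ultimately show ?case by blast
next
  case (add f g)
  then obtain F F' where "F \<in> EH.I" "N.Avg f = pull F" "F' \<in> EH.I" "N.Avg g = pull F'" by blast
  then show ?case
    by (intro bexI[of _ "F + F'"]) (auto simp: N.Avg_add pull_add fv.subspace_add[OF EH.I_subspace])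
qed

text \<open>Averaging over N fixes \<open>pull F\<close> and takes \<open>G.I\<close> into the
  pullback of \<open>EH.I\<close>. Independence modulo the ideal of H on E thereby becomes
  independence modulo the ideal of G on V.\<close>

lemma pull_I: "F \<in> EG.S \<Longrightarrow> pull F \<in> G.I \<Longrightarrow> F \<in> EH.I"
proof -
  assume F: "F \<in> EG.S" "pull F \<in> G.I"
  obtain F' where F': "F' \<in> EH.I" "N.Avg (pull F) = pull F'" using Avg_I[OF F(2)] by blast
  then have "pull F = pull F'" using N.Avg_R[OF pull_S[OF F(1)]] by simp
  then have "F = F'" using F F' EH.I_in_S by (intro pull_inj)
  then show ?thesis using F' by simp
qed

sublocale GE: refl_module scale r b x KG act RG fscale E r be xe actE
  by unfold_locales

lemma actH_coset: "g \<in> carrier KG \<Longrightarrow> actH (N #>\<^bsub>KG\<^esub> g) \<phi> = actE g \<phi>"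
  and coset_in_H: "g \<in> carrier KG \<Longrightarrow> N #>\<^bsub>KG\<^esub> g \<in> carrier H"
  and in_coset: "g \<in> carrier KG \<Longrightarrow> g \<in> N #>\<^bsub>KG\<^esub> g"
proof -
  assume g: "g \<in> carrier KG"
  show "N #>\<^bsub>KG\<^esub> g \<in> carrier H" using g by (auto simp: carrier_FactGroup)
  moreover show "g \<in> N #>\<^bsub>KG\<^esub> g" using G.rcos_self[OF g subgroup_axioms] .
  ultimately show "actH (N #>\<^bsub>KG\<^esub> g) \<phi> = actE g \<phi>" by (rule actH_eq)
qed

text \<open>The rank bound for H on E, obtained from flatness for G on V by pulling the maps back.
  \<open>L\<close> contains the coordinates on which the maps depend: all of them for the general
  bound, those of one block for counting the generators in that block.\<close>

lemma card_le_pullback: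
  assumes J: "finite J" and L: "L \<subseteq> {..<r}" and \<psi>S: "\<And>j w. j \<in> J \<Longrightarrow> w \<in> E \<Longrightarrow> \<psi> j w \<in> EG.S"
    and exp: "\<And>j w. j \<in> J \<Longrightarrow> w \<in> E \<Longrightarrow> \<psi> j w = (\<Sum>k\<in>L. fscale (xe k w) (\<psi> j (be k)))"
    and eqv: "\<And>C j w. C \<in> carrier H \<Longrightarrow> j \<in> J \<Longrightarrow> w \<in> E \<Longrightarrow> EH.fa C (\<psi> j w) = \<psi> j (actH C w)"
    and ind: "\<And>c. (\<And>w. w \<in> E \<Longrightarrow> (\<Sum>j\<in>J. fscale (c j) (\<psi> j w)) \<in> EH.I) \<Longrightarrow> \<forall>j\<in>J. c j = 0"
  shows "card J \<le> card L"
proof -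
  have "card J \<le> card (be ` L)"
  proof (rule G.card_le_rank[where M = E and \<omega> = "\<lambda>j w. pull (\<psi> j w)"])
    show "finite J" by (rule J)
    fix j w assume "j \<in> J" "w \<in> E"
    then show "pull (\<psi> j w) \<in> G.S" using \<psi>S pull_S N.R_in_S by blast
  next
    fix c assume c: "\<And>w. w \<in> E \<Longrightarrow> (\<Sum>j\<in>J. fscale (c j) (pull (\<psi> j w))) \<in> G.I"
    show "\<forall>j\<in>J. c j = 0"
    proof (rule ind)
      fix w assume w: "w \<in> E"
      show "(\<Sum>j\<in>J. fscale (c j) (\<psi> j w)) \<in> EH.I"
        using c[OF w] \<psi>S w by (intro pull_I) (auto simp: pull_sum pull_scale intro!: EG.S_sum EG.S_scale)
    qed
  next
    show "finite (be ` L)" using L finite_subset by blast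
    show "be ` L \<subseteq> E" using L EG.b_in by auto
    fix w assume w: "w \<in> E"
    have injL: "inj_on be L" using EG.b_inj L by (rule inj_on_subset)
    show "\<exists>c. \<forall>j\<in>J. pull (\<psi> j w) = (\<Sum>u\<in>be ` L. fscale (c u) (pull (\<psi> j u)))"
    proof (intro exI[of _ "\<lambda>u. xe (inv_into L be u) w"] ballI)
      fix j assume "j \<in> J"
      then have "pull (\<psi> j w) = (\<Sum>k\<in>L. fscale (xe k w) (pull (\<psi> j (be k))))"
        using exp[of j w] w by (simp add: pull_sum pull_scale)
      then show "pull (\<psi> j w) = (\<Sum>u\<in>be ` L. fscale (xe (inv_into L be u) w) (pull (\<psi> j u)))"
        by (auto simp: sum.reindex[OF injL] inv_into_f_f[OF injL] intro!: sum.cong)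
    qed
    fix k assume k: "k \<in> carrier KG"
    have w': "actE (inv\<^bsub>KG\<^esub> k) w \<in> E" using k w EG.act_in by simp
    have "\<forall>j\<in>J. G.fa k (pull (\<psi> j (actE (inv\<^bsub>KG\<^esub> k) w))) = pull (\<psi> j w)"
    proof
      fix j assume "j \<in> J"
      then have "EH.fa (N #>\<^bsub>KG\<^esub> k) (\<psi> j (actE (inv\<^bsub>KG\<^esub> k) w)) = \<psi> j w"
        using eqv[OF coset_in_H[OF k] _ w'] EG.act_inv(2)[OF k w] by (simp add: actH_coset[OF k])
      then show "G.fa k (pull (\<psi> j (actE (inv\<^bsub>KG\<^esub> k) w))) = pull (\<psi> j w)"
        using pull_fa[OF coset_in_H[OF k] in_coset[OF k]] by metis
    qed
    then show "\<exists>w'\<in>E. \<forall>j\<in>J. G.fa k (pull (\<psi> j w')) = pull (\<psi> j w)" using w' by blast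
  qed
  then show ?thesis using card_image[OF inj_on_subset[OF EG.b_inj L]] by simp
qed

lemma degrees_of_fundamental_invariants_H:
  assumes "fundamental_invariants fscale E H actH Fs ks"
  shows "degrees fscale E H actH = mset ks"
    and "fake_degrees fscale E H actH fscale E actH = mset (map (\<lambda>d. d - 1) ks)"
proof -
  interpret self: equivariant_module fscale E r be xe H actH fscale E r be xe actH
    by unfold_locales
  have ub: "length \<psi>s \<le> r"
    if \<psi>s: "\<And>\<psi>. \<psi> \<in> set \<psi>s \<Longrightarrow> \<exists>j. \<psi> \<in> self.hom_space j" and ind: "self.indep \<psi>s" for \<psi>s
  proof -
    have hom: "\<exists>j. \<psi>s ! i \<in> self.hom_space j" if "i < length \<psi>s" for i using \<psi>s that by simp
    have "card {..<length \<psi>s} \<le> card {..<r}"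
    proof (rule card_le_pullback[where \<psi> = "(!) \<psi>s"])
      fix j w assume j: "j \<in> {..<length \<psi>s}" and w: "w \<in> E"
      obtain e where e: "\<psi>s ! j \<in> self.hom_space e" using hom j by auto
      show "(\<psi>s ! j) w \<in> EG.S" using self.hom_spaceD(1)[OF e w] EG.Sd_in_S by blast
      show "EH.fa C ((\<psi>s ! j) w) = (\<psi>s ! j) (actH C w)" if "C \<in> carrier H" for C
        using self.hom_spaceD(4)[OF e that w] .
      have "(\<psi>s ! j) (\<Sum>k<l. fscale (xe k w) (be k)) = (\<Sum>k<l. fscale (xe k w) ((\<psi>s ! j) (be k))) \<and>
          (\<Sum>k<l. fscale (xe k w) (be k)) \<in> E" if "l \<le> r" for l
        using that
      proof (induction l)
        case 0
        have "(\<psi>s ! j) (fscale 0 0) = fscale 0 ((\<psi>s ! j) 0)" by (rule self.hom_spaceD(3)[OF e]) simp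
        then show ?case by simp
      next
        case (Suc l)
        then have "be l \<in> E" using EG.b_in[of l] by simp
        then show ?case using Suc self.hom_spaceD(2,3)[OF e] by (simp add: EG.W_scale EG.W_add)
      qed
      from this[of r] show "(\<psi>s ! j) w = (\<Sum>k<r. fscale (xe k w) ((\<psi>s ! j) (be k)))"
        using EG.expand[OF w] by simp
    next
      fix c assume "\<And>w. w \<in> E \<Longrightarrow> (\<Sum>j<length \<psi>s. fscale (c j) ((\<psi>s ! j) w)) \<in> EH.I"
      then show "\<forall>j\<in>{..<length \<psi>s}. c j = 0" using self.indepD[OF ind] by blast
    qed auto
    then show ?thesis by simp
  qed
  show "degrees fscale E H actH = mset ks"
    "fake_degrees fscale E H actH fscale E actH = mset (map (\<lambda>d. d - 1) ks)"
    using EH.degrees_and_fake_degrees[OF ub assms] by blast+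
qed

end

context refl_pair
begin

subsection \<open>Homogeneous blocks of the dual of the quotient\<close>

definition B :: "nat \<Rightarrow> ('v \<Rightarrow> complex) set" where
  "B d = fspan {fs ! i |i. i < r \<and> ds ! i = d}"

lemma B_subspace: "fv.subspace (B d)"
  by (simp add: B_def)

lemma fs_in_B: "i < r \<Longrightarrow> fs ! i \<in> B (ds ! i)"
  unfolding B_def by (rule fv.span_base) blast

lemma B_in_Es: "f \<in> B d \<Longrightarrow> f \<in> Es"
proof -
  have "B d \<subseteq> Es" unfolding B_def by (rule fv.span_minimal[OF _ Es_subspace]) (auto simp: fs_in)
  then show "f \<in> B d \<Longrightarrow> f \<in> Es" by blast
qed

lemma B_in_Sd: "f \<in> B d \<Longrightarrow> f \<in> G.Sd d"
proof -
  have "B d \<subseteq> G.Sd d" unfolding B_def by (rule fv.span_minimal[OF _ G.Sd_subspace]) (auto simp: fundN(3))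
  then show "f \<in> B d \<Longrightarrow> f \<in> G.Sd d" by blast
qed

lemma be_B: "f \<in> B d \<Longrightarrow> k < r \<Longrightarrow> ds ! k \<noteq> d \<Longrightarrow> be k f = 0"
proof -
  assume k: "k < r" "ds ! k \<noteq> d" and f: "f \<in> B d"
  have "fv.subspace {f \<in> Es. be k f = 0}"
    using EsG.DS_add[OF EsG.x_dual[OF k(1)]] EsG.DS_scale[OF EsG.x_dual[OF k(1)]]
      EsG.DS_0[OF EsG.x_dual[OF k(1)]] Es_subspace
    by (intro fv.subspaceI) (auto simp: fv.subspace_0 fv.subspace_add fv.subspace_scale)
  moreover have "{fs ! i |i. i < r \<and> ds ! i = d} \<subseteq> {f \<in> Es. be k f = 0}"
    using k EsG.x_b[OF k(1)] fs_in by auto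
  ultimately have "B d \<subseteq> {f \<in> Es. be k f = 0}" unfolding B_def by (intro fv.span_minimal)
  then show ?thesis using f by blast
qed

text \<open>Shows that \<open>B d\<close> is the whole degree \<open>d\<close> part of
  \<open>Es\<close>, whatever the choice of \<open>fs\<close>; stability under G follows.\<close>

lemma in_B: "f \<in> Es \<Longrightarrow> f \<in> G.Sd d \<Longrightarrow> f \<in> B d"
proof -
  assume f: "f \<in> Es" "f \<in> G.Sd d"
  have fsS: "fs ! k \<in> G.S" if "k < r" for k using fundN(3)[OF that] G.Sd_in_S by blast
  have "f = G.hc d f" using G.hc_Sd[OF f(2)] by simp
  also have "\<dots> = G.hc d (\<Sum>k<r. fscale (be k f) (fs ! k))" using Es_expand[OF f(1)] by simp
  also have "\<dots> = (\<Sum>k<r. G.hc d (fscale (be k f) (fs ! k)))"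
    using fsS by (intro G.hc_sum) (auto intro: G.S_scale)
  also have "\<dots> \<in> B d"
  proof (intro fv.subspace_sum[OF B_subspace])
    fix k assume k: "k \<in> {..<r}"
    then have "G.hc d (fscale (be k f) (fs ! k)) = fscale (be k f) (if d = ds ! k then fs ! k else 0)"
      using fsS[of k] G.hc_Sd[OF fundN(3)[of k]] by (simp add: G.hc_scale)
    then show "G.hc d (fscale (be k f) (fs ! k)) \<in> B d"
      using k fs_in_B[of k] by (auto simp: fv.subspace_0[OF B_subspace] intro: fv.subspace_scale[OF B_subspace])
  qed
  finally show ?thesis .
qed

lemma B_fa: "g \<in> carrier KG \<Longrightarrow> f \<in> B d \<Longrightarrow> G.fa g f \<in> B d"
  by (intro in_B stable G.fa_Sd) (auto intro: B_in_Es B_in_Sd)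

definition evf :: "('v \<Rightarrow> complex) \<Rightarrow> (('v \<Rightarrow> complex) \<Rightarrow> complex) \<Rightarrow> complex" where
  "evf f = (\<lambda>\<phi>. if \<phi> \<in> E then \<phi> f else 0)"

lemma evf_in: "evf f \<in> EG.DS"
  using EG.W_add EG.W_scale by (auto simp: dual_space_def[of fscale E] evf_def fun_ops)

lemma pull_evf: "f \<in> Es \<Longrightarrow> pull (evf f) = f"
proof -
  have "pull (evf f) = (\<lambda>v. ev v f)" by (simp add: pull_def evf_def ev_in)
  then show "f \<in> Es \<Longrightarrow> ?thesis" by (simp add: ev_def)
qed

lemma reflection_one_block:
  assumes s: "s \<in> RG" and f: "f1 \<in> B d" "f2 \<in> B d'" "d \<noteq> d'"
  shows "G.fa s f1 = f1 \<or> G.fa s f2 = f2"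
proof (rule ccontr)
  assume contra: "\<not> ?thesis"
  have sK: "s \<in> carrier KG" using s G.Rf_carrier by auto
  define h1 where "h1 = G.fa s f1 - f1"
  define h2 where "h2 = G.fa s f2 - f2"
  have h: "h1 \<in> B d" "h2 \<in> B d'" "h1 \<noteq> 0" "h2 \<noteq> 0"
    using contra f B_fa[OF sK] by (auto simp: h1_def h2_def intro: fv.subspace_diff[OF B_subspace])
  obtain \<alpha> where \<alpha>: "\<alpha> \<in> G.DS" "\<alpha> \<noteq> 0" "\<And>n f. f \<in> G.lt (Suc n) \<Longrightarrow> \<exists>q\<in>G.lt n. G.fa s f - f = \<alpha> * q"
    using G.reflection_division[OF s] by blast
  obtain A1 where A1: "A1 \<in> G.S" "h1 = \<alpha> * A1"
    using \<alpha>(3)[OF G.Sd_in_lt[OF B_in_Sd[OF f(1)], of "Suc d"]] G.lt_in_S by (auto simp: h1_def)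
  obtain A2 where A2: "A2 \<in> G.S" "h2 = \<alpha> * A2"
    using \<alpha>(3)[OF G.Sd_in_lt[OF B_in_Sd[OF f(2)], of "Suc d'"]] G.lt_in_S by (auto simp: h2_def)
  define U where "U j = (if j = 0 then h1 else h2)" for j :: nat
  define P where "P j = (if j = 0 then A2 else - A1)" for j :: nat
  have hN: "h1 \<in> N.R" "h2 \<in> N.R" using h B_in_Es Es_N N.R0_in_R by blast+
  have "N.span_rels {0, 1} U P"
    using hN A1(1) A2(1) by (intro N.flatness) (auto simp: U_def P_def A1(2) A2(2) G.S_neg mult_ac)
  have rel: "\<exists>q\<in>G.S. \<rho> 0 = h2 * q" if \<rho>: "\<rho> \<in> N.rels {0, 1} U" for \<rho>
  proof -
    have \<rho>': "\<rho> 0 \<in> N.R" "\<rho> 1 \<in> N.R" "\<rho> 0 * h1 + \<rho> 1 * h2 = 0"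
      using \<rho> by (auto simp: N.rels_def U_def)
    obtain P0 P1 where P: "P0 \<in> EG.S" "\<rho> 0 = pull P0" "P1 \<in> EG.S" "\<rho> 1 = pull P1"
      using pull_ex[OF \<rho>'(1)] pull_ex[OF \<rho>'(2)] by blast
    have hE: "pull (evf h1) = h1" "pull (evf h2) = h2" using h B_in_Es pull_evf by blast+
    have "pull (P0 * evf h1 + P1 * evf h2) = 0" using \<rho>'(3) by (simp only: pull_add pull_mult P(2,4) hE)
    then have zero: "P0 * evf h1 + P1 * evf h2 = 0"
      using P evf_in EG.DS_in_S by (intro pull_eq_0 EG.S_add EG.S_mult) auto
    have "\<exists>k<r. be k h2 \<noteq> 0"
    proof (rule ccontr)
      assume "\<not> ?thesis"
      then have "(\<Sum>k<r. fscale (be k h2) (fs ! k)) = 0" by (intro sum.neutral) auto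
      then show False using Es_expand[OF B_in_Es[OF h(2)]] h(4) by simp
    qed
    then obtain k where k: "k < r" "be k h2 \<noteq> 0" by blast
    then have "be k h1 = 0" using be_B[OF h(2) k(1)] be_B[OF h(1) k(1)] f(3) by metis
    \<comment> \<open>A vector of E on which the form \<open>h1\<close> is 0 and \<open>h2\<close>
      is 1; it exists because the two forms use coordinates of different blocks.\<close>
    define u where "u = fscale (1 / be k h2) (be k)"
    have u: "u \<in> E" using EG.b_in[OF k(1)] by (simp add: u_def EG.W_scale)
    have "\<exists>q\<in>EG.S. P0 = evf h2 * q"
    proof (rule EG.linear_forms_regular[OF evf_in evf_in _ u _ _ P(1,3) zero])
      show "evf h1 \<noteq> 0" using hE(1) h(3) pull_zero by auto
      show "evf h1 u = 0" "evf h2 u = 1" using u \<open>be k h1 = 0\<close> k(2) by (simp_all add: evf_def u_def fscale_apply)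
    qed
    then obtain q where q: "q \<in> EG.S" "P0 = evf h2 * q" by blast
    then have "\<rho> 0 = h2 * pull q" using P(2) hE by (simp add: pull_mult)
    then show ?thesis using pull_S[OF q(1)] N.R_in_S by blast
  qed
  have "\<exists>q\<in>G.S. P' 0 = h2 * q" if "N.span_rels {0, 1} U P'" for P'
    using that
  proof (induction rule: N.span_rels.induct)
    case (zero P)
    then show ?case by (intro bexI[of _ 0]) auto
  next
    case (add Q t \<rho> P)
    obtain q where q: "q \<in> G.S" "Q 0 = h2 * q" using add.IH by blast
    obtain q' where q': "q' \<in> G.S" "\<rho> 0 = h2 * q'" using rel[OF add.hyps(3)] by blast
    have "P 0 = h2 * (q + t * q')" using add.hyps(4) q q' by (simp add: algebra_simps)
    moreover have "q + t * q' \<in> G.S" using q q' add.hyps(2) by (intro G.S_add G.S_mult)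
    ultimately show ?case by blast
  qed
  from this[OF \<open>N.span_rels {0, 1} U P\<close>] obtain q where q: "q \<in> G.S" "A2 = h2 * q" by (auto simp: P_def)
  \<comment> \<open>From A2 = h2 q and h2 = \<alpha> A2 one gets \<alpha> q = 1, impossible at the
    origin.\<close>
  have "h2 * (\<alpha> * q) = \<alpha> * (h2 * q)" by (rule mult.left_commute)
  also have "\<dots> = \<alpha> * A2" by (simp only: q(2))
  also have "\<dots> = h2 * 1" by (simp only: A2(2) mult_1_right)
  finally have cancel: "h2 * (\<alpha> * q) = h2 * 1" .
  have hS: "h2 \<in> G.S" using B_in_Sd[OF h(2)] by (rule G.Sd_in_S)
  have \<alpha>S: "\<alpha> * q \<in> G.S" using G.DS_in_S[OF \<alpha>(1)] q(1) by (rule G.S_mult)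
  have "\<alpha> * q = 1" by (rule G.S_mult_cancel[OF hS \<alpha>S G.one_in_S cancel h(4)])
  then have "(\<alpha> * q) 0 = 1" by (simp add: one_fun_apply)
  then show False using \<alpha>(1) by (simp add: times_fun_apply)
qed

text \<open>\<open>T d k\<close> is the image of $S^k(B_d)$ in $S(V^*)$.\<close>

primrec T :: "nat \<Rightarrow> nat \<Rightarrow> ('v \<Rightarrow> complex) set" where
  "T d 0 = {f. \<exists>c. f = G.cst c}"
| "T d (Suc k) = fspan {f * l |f l. f \<in> T d k \<and> l \<in> B d}"

lemma T_subspace: "fv.subspace (T d k)"
proof (cases k)
  case 0
  have "0 = G.cst 0" "G.cst c + G.cst c' = G.cst (c + c')" "fscale c (G.cst c') = G.cst (c * c')" for c c'
    by (auto simp: G.cst_def fun_eq_iff fun_ops)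
  then show ?thesis using 0 by (intro fv.subspaceI) (force, force, force)
qed simp

lemmas T_add = fv.subspace_add[OF T_subspace]
  and T_scale = fv.subspace_scale[OF T_subspace]
  and T_sum = fv.subspace_sum[OF T_subspace]
  and T_0 = fv.subspace_0[OF T_subspace]

lemma T_mult_B: "f \<in> T d k \<Longrightarrow> l \<in> B d \<Longrightarrow> f * l \<in> T d (Suc k)"
  unfolding T.simps(2) by (rule fv.span_base) blast

lemma T_induct [consumes 1, case_names cst mult add]:
  assumes "f \<in> T d k"
    and "\<And>c. Q 0 (G.cst c)"
    and "\<And>k f l. f \<in> T d k \<Longrightarrow> Q k f \<Longrightarrow> l \<in> B d \<Longrightarrow> Q (Suc k) (f * l)"
    and "\<And>k f g. f \<in> T d k \<Longrightarrow> g \<in> T d k \<Longrightarrow> Q k f \<Longrightarrow> Q k g \<Longrightarrow> Q k (f + g)"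
  shows "Q k f"
  using assms(1)
proof (induction k arbitrary: f)
  case 0
  then show ?case using assms(2) by auto
next
  case (Suc k)
  from Suc.prems have "f \<in> T d (Suc k) \<and> Q (Suc k) f"
    unfolding T.simps(2)
  proof (induction rule: fv.span_induct_alt)
    case base
    have "Q (Suc k) (0 * 0)" using Suc.IH[OF T_0] T_0 fv.subspace_0[OF B_subspace] by (intro assms(3))
    then show ?case using fv.span_zero by simp
  next
    case (step c h g)
    then obtain f l where h: "h = f * l" "f \<in> T d k" "l \<in> B d" by blast
    then have eq: "fscale c h = f * fscale c l" and l: "fscale c l \<in> B d"
      using fv.subspace_scale[OF B_subspace] by (auto simp: fscale_mult)
    have "fscale c h \<in> T d (Suc k)" "Q (Suc k) (fscale c h)"
      unfolding eq using h(2) l Suc.IH by (auto simp del: T.simps intro: T_mult_B assms(3))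
    moreover have "g \<in> T d (Suc k)" "Q (Suc k) g" using step by auto
    ultimately show ?case using T_add[of "fscale c h" d "Suc k" g] assms(4) unfolding T.simps(2)[symmetric] by blast
  qed
  then show ?case by blast
qed

lemma T_Sd: "f \<in> T d k \<Longrightarrow> f \<in> G.Sd (d * k)"
proof (induction rule: T_induct)
  case (cst c)
  then show ?case using G.cst_in by simp
next
  case (mult k f l)
  then show ?case using G.Sd_mult[of f "d * k" l d] B_in_Sd by (simp add: add.commute)
qed (rule G.Sd_add)

lemma T_fa: "f \<in> T d k \<Longrightarrow> g \<in> carrier KG \<Longrightarrow> G.fa g f \<in> T d k"
proof (induction rule: T_induct)
  case (cst c)
  then show ?case using G.R_cst[of c] by (auto simp: G.R_iff)
next
  case (mult k f l)
  then show ?case unfolding G.fa_mult by (intro T_mult_B B_fa) auto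
next
  case (add k f g')
  then show ?case unfolding G.fa_add by (intro T_add) auto
qed

lemma T_fix: "f \<in> T d k \<Longrightarrow> g \<in> carrier KG \<Longrightarrow> (\<And>l. l \<in> B d \<Longrightarrow> G.fa g l = l) \<Longrightarrow> G.fa g f = f"
proof (induction rule: T_induct)
  case (cst c)
  then show ?case using G.R_cst[of c] by (auto simp: G.R_iff)
next
  case (mult k f l)
  then show ?case by (simp add: G.fa_mult)
next
  case (add k f g')
  then show ?case by (simp add: G.fa_add)
qed

lemma T_mult: "h \<in> T d l \<Longrightarrow> f \<in> T d k \<Longrightarrow> f * h \<in> T d (k + l)"
proof (induction rule: T_induct)
  case (cst c)
  then show ?case using T_scale[of f d k c] by (simp add: G.cst_mult_UNIV mult.commute[of f])
next
  case (mult l h b)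
  then have "f * h * b \<in> T d (Suc (k + l))" by (intro T_mult_B) auto
  then show ?case by (simp add: mult.assoc del: T.simps)
next
  case (add l h h')
  then show ?case unfolding distrib_left by (intro T_add) auto
qed

lemma T_prod_powers:
  assumes "finite A" "\<And>i. i \<in> A \<Longrightarrow> i < r \<and> ds ! i = d"
  shows "\<exists>k. (\<Prod>i\<in>A. fs ! i ^ e i) \<in> T d k"
  using assms
proof (induction A rule: finite_induct)
  case empty
  have "1 \<in> T d 0" using G.cst_1 by (auto intro: exI[of _ 1])
  then show ?case by (auto simp del: T.simps)
next
  case (insert i A)
  have pow: "fs ! i ^ n \<in> T d n" for n
  proof (induction n)
    case 0
    show ?case using G.cst_1 by (auto intro: exI[of _ 1])
  next
    case (Suc n)
    have "fs ! i \<in> B d" using insert.prems[of i] fs_in_B[of i] by auto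
    from T_mult_B[OF Suc this] show ?case by (simp add: mult.commute del: T.simps)
  qed
  obtain k where "(\<Prod>i\<in>A. fs ! i ^ e i) \<in> T d k" using insert by blast
  from T_mult[OF this pow, of "e i"] show ?case using insert(1,2) by (auto simp del: T.simps)
qed

text \<open>Records the two gradings at once: a product of k linear forms of the block has degree k
  on E and d k on V, and a derivative along E removes one factor of degree d. The clause for
  \<open>k = 0\<close> is carried along because the truncated \<open>d * (k - 1)\<close> does not
  show that the derivative of a constant vanishes.\<close>

lemma T_lift: "f \<in> T d k \<Longrightarrow> \<exists>F\<in>EG.Sd k. pull F = f \<and>
    (\<forall>w\<in>E. (k = 0 \<longrightarrow> EG.D w F = 0) \<and> pull (EG.D w F) \<in> G.Sd (d * (k - 1))) \<and>
    (\<forall>j<r. ds ! j \<noteq> d \<longrightarrow> EG.D (be j) F = 0)"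
proof (induction rule: T_induct)
  case (cst c)
  then show ?case
    using EG.b_in by (intro bexI[of _ "EG.cst c"]) (auto simp: pull_cst EG.D_cst pull_zero EG.cst_in)
next
  case (mult k f l)
  then obtain F where F: "F \<in> EG.Sd k" "pull F = f" "\<And>w. w \<in> E \<Longrightarrow> k = 0 \<Longrightarrow> EG.D w F = 0"
    "\<And>w. w \<in> E \<Longrightarrow> pull (EG.D w F) \<in> G.Sd (d * (k - 1))" "\<And>j. j < r \<Longrightarrow> ds ! j \<noteq> d \<Longrightarrow> EG.D (be j) F = 0" by blast
  have l: "pull (evf l) = l" "l \<in> G.Sd d" using mult B_in_Es pull_evf B_in_Sd by blast+
  have D: "EG.D w (F * evf l) = EG.D w F * evf l + fscale (w l) F" if "w \<in> E" for w
    using that F(1) evf_in[of l]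
    by (simp add: EG.D_mult EG.Sd_in_S EG.DS_in_S EG.D_lin EG.S_cst_mult evf_def[of l])
  have "pull (EG.D w (F * evf l)) \<in> G.Sd (d * k)" if w: "w \<in> E" for w
  proof -
    have "pull (EG.D w F) * l \<in> G.Sd (d * k)"
    proof (cases k)
      case 0
      then show ?thesis using F(3)[OF w] by (simp add: pull_zero)
    next
      case (Suc n)
      then show ?thesis using G.Sd_mult[OF F(4)[OF w] l(2)] by (simp add: add.commute)
    qed
    then show ?thesis using T_Sd[OF \<open>f \<in> T d k\<close>] l F(2)
      by (simp add: D[OF w] pull_add pull_mult pull_scale G.Sd_add G.Sd_scale)
  qed
  moreover have "EG.D (be j) (F * evf l) = 0" if "j < r" "ds ! j \<noteq> d" for j
    using D[OF EG.b_in[OF that(1)]] F(5)[OF that] be_B[OF \<open>l \<in> B d\<close> that] by simp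
  moreover have "F * evf l \<in> EG.Sd (Suc k)" using F(1) evf_in by (rule EG.Sd_mult_DS)
  moreover have "pull (F * evf l) = f * l" by (simp add: pull_mult F(2) l(1))
  ultimately show ?case by (intro bexI[of _ "F * evf l"]) auto
next
  case (add k f g)
  then obtain F F' where F: "F \<in> EG.Sd k" "pull F = f" "\<And>w. w \<in> E \<Longrightarrow> k = 0 \<Longrightarrow> EG.D w F = 0"
    "\<And>w. w \<in> E \<Longrightarrow> pull (EG.D w F) \<in> G.Sd (d * (k - 1))" "\<And>j. j < r \<Longrightarrow> ds ! j \<noteq> d \<Longrightarrow> EG.D (be j) F = 0"
    and F': "F' \<in> EG.Sd k" "pull F' = g" "\<And>w. w \<in> E \<Longrightarrow> k = 0 \<Longrightarrow> EG.D w F' = 0"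
    "\<And>w. w \<in> E \<Longrightarrow> pull (EG.D w F') \<in> G.Sd (d * (k - 1))" "\<And>j. j < r \<Longrightarrow> ds ! j \<noteq> d \<Longrightarrow> EG.D (be j) F' = 0"
    by blast
  have "EG.D w (F + F') = EG.D w F + EG.D w F'" if "w \<in> E" for w
    using that F(1) F'(1) by (intro EG.D_add EG.Sd_in_S)
  then show ?case using F F' EG.b_in
    by (intro bexI[of _ "F + F'"]) (auto simp: pull_add EG.Sd_add G.Sd_add)
qed

text \<open>By \<open>reflection_one_block\<close>, averaging over the subgroup \<open>L\<close> fixing the blocks other than
  \<open>B d\<close> already makes an element of \<open>T d k\<close> invariant: \<open>H\<close> is the product of its actions on the blocks.\<close>

lemma Avg_block:
  assumes t: "t \<in> T d k" and u: "\<And>g. g \<in> carrier KG \<Longrightarrow> (\<And>d' f. d' \<noteq> d \<Longrightarrow> f \<in> B d' \<Longrightarrow> G.fa g f = f) \<Longrightarrow> G.fa g u = u"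
  shows "G.Avg (t * u) = G.Avg t * G.Avg u"
proof -
  define L where "L = {g \<in> carrier KG. \<forall>d' f. d' \<noteq> d \<longrightarrow> f \<in> B d' \<longrightarrow> G.fa g f = f}"
  have L: "finite L" "\<one>\<^bsub>KG\<^esub> \<in> L" "\<And>g. g \<in> L \<Longrightarrow> g \<in> carrier KG"
    using G.fin by (auto simp: L_def G.fa_one_UNIV)
  have L_mult: "g \<otimes>\<^bsub>KG\<^esub> h \<in> L" if "g \<in> L" "h \<in> L" for g h
    using that by (auto simp: L_def G.fa_comp[symmetric])
  have cL: "of_nat (card L) \<noteq> (0::complex)" using L by auto
  define a where "a = fscale (1 / of_nat (card L)) (\<Sum>g\<in>L. G.fa g t)"
  have aT: "a \<in> T d k" unfolding a_def using t L by (intro T_scale T_sum T_fa)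
  have aR: "a \<in> G.R"
  proof (rule G.R_of_reflections)
    show "a \<in> G.S" using T_Sd[OF aT] G.Sd_in_S by blast
    fix s assume s: "s \<in> RG"
    then have sK: "s \<in> carrier KG" using G.Rf_carrier by auto
    show "G.fa s a = a"
    proof (cases "\<forall>l\<in>B d. G.fa s l = l")
      case True
      then show ?thesis using T_fix[OF aT sK] by blast
    next
      case False
      then obtain l where "l \<in> B d" "G.fa s l \<noteq> l" by blast
      \<comment> \<open>A reflection moving \<open>B d\<close> fixes all other blocks, so it lies in
        \<open>L\<close> and permutes the summands of \<open>a\<close>.\<close>
      then have sL: "s \<in> L" using reflection_one_block[OF s] sK by (auto simp: L_def)
      have inj: "inj_on (\<lambda>g. s \<otimes>\<^bsub>KG\<^esub> g) L" by (rule inj_on_subset[OF G.inj_on_cmult[OF sK]]) (use L in auto)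
      have "(\<lambda>g. s \<otimes>\<^bsub>KG\<^esub> g) ` L = L" using L_mult[OF sL] by (intro endo_inj_surj[OF L(1) _ inj]) auto
      then have "(\<Sum>g\<in>L. G.fa g t) = (\<Sum>g\<in>L. G.fa (s \<otimes>\<^bsub>KG\<^esub> g) t)"
        using sum.reindex[OF inj, of "\<lambda>g. G.fa g t"] by simp
      also have "\<dots> = (\<Sum>g\<in>L. G.fa s (G.fa g t))" using L sK by (intro sum.cong) (auto simp: G.fa_comp)
      finally have eq: "(\<Sum>g\<in>L. G.fa g t) = (\<Sum>g\<in>L. G.fa s (G.fa g t))" .
      have "G.fa s a = fscale (1 / of_nat (card L)) (\<Sum>g\<in>L. G.fa s (G.fa g t))"
        by (simp only: a_def G.fa_scale G.fa_sum)
      then show ?thesis by (simp only: a_def eq[symmetric])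
    qed
  qed
  \<comment> \<open>Averaging over \<open>L\<close> first does not change the average over G. With
    \<open>v = 1\<close> this identifies \<open>a\<close> with the average of \<open>t\<close>; with
    \<open>v = u\<close> it gives the claim.\<close>
  have Avg: "G.Avg (t * v) = a * G.Avg v" if v: "\<And>g. g \<in> L \<Longrightarrow> G.fa g v = v" for v
  proof -
    have "a * v = fscale (1 / of_nat (card L)) (\<Sum>g\<in>L. G.fa g (t * v))"
      using v by (simp add: a_def fscale_mult sum_distrib_right G.fa_mult)
    then have "G.Avg (a * v) = fscale (1 / of_nat (card L)) (\<Sum>g\<in>L. G.Avg (G.fa g (t * v)))"
      by (simp add: G.Avg_scale G.Avg_sum)
    also have "\<dots> = G.Avg (t * v)"
      using L(3) cL by (simp add: G.Avg_fa G.sum_constant_fscale del: sum_constant)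
    finally show ?thesis using G.Avg_mult[OF aR, of v] by (simp add: mult.commute)
  qed
  have "G.fa g 1 = 1" if "g \<in> L" for g using G.one_in_R L(3)[OF that] by (simp add: G.R_iff)
  from Avg[OF this] have "G.Avg t = a" using G.Avg_R[OF G.one_in_R] by simp
  moreover have "G.Avg (t * u) = a * G.Avg u" by (rule Avg) (auto simp: L_def intro!: u)
  ultimately show ?thesis by simp
qed

lemma Avg_prod_blocks:
  assumes "finite Ds" "\<And>d. d \<in> Ds \<Longrightarrow> \<exists>k. t d \<in> T d k"
  shows "G.Avg (\<Prod>d\<in>Ds. t d) = (\<Prod>d\<in>Ds. G.Avg (t d))"
  using assms
proof (induction Ds rule: finite_induct)
  case empty
  then show ?case using G.Avg_R[OF G.one_in_R] by simp
next
  case (insert d Ds)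
  obtain k where k: "t d \<in> T d k" using insert.prems by blast
  have "G.Avg (t d * (\<Prod>d\<in>Ds. t d)) = G.Avg (t d) * G.Avg (\<Prod>d\<in>Ds. t d)"
  proof (rule Avg_block[OF k])
    fix g assume g: "g \<in> carrier KG" "\<And>d' f. d' \<noteq> d \<Longrightarrow> f \<in> B d' \<Longrightarrow> G.fa g f = f"
    have "G.fa g (t d') = t d'" if d': "d' \<in> Ds" for d'
    proof -
      obtain k' where "t d' \<in> T d' k'" using insert.prems d' by blast
      moreover have "d' \<noteq> d" using d' insert.hyps by blast
      ultimately show ?thesis using T_fix g by blast
    qed
    then show "G.fa g (\<Prod>d\<in>Ds. t d) = (\<Prod>d\<in>Ds. t d)" by (simp add: G.fa_prod)
  qed
  then show ?case using insert by simp
qed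

text \<open>The invariants of positive degree that live in a single block, from which the generators
  of the invariants of G are drawn.\<close>

definition X :: "('v \<Rightarrow> complex) set" where
  "X = {f \<in> G.R. \<exists>d k. d > 0 \<and> k > 0 \<and> f \<in> T d k}"

lemma X_R0: "f \<in> X \<Longrightarrow> f \<in> G.R0"
proof -
  assume "f \<in> X"
  then obtain d k where "d > 0" "k > 0" "f \<in> T d k" "f \<in> G.R" by (auto simp: X_def simp del: T.simps)
  then show ?thesis using G.R0_Sd[OF _ T_Sd, of f d k] by simp
qed

lemma span_X_R0: "f \<in> fspan X \<Longrightarrow> f \<in> G.R0"
  using fv.span_minimal[OF _ G.R0_subspace, of X] X_R0 by blast

text \<open>The sum \<open>Q\<close> of the constants, the span of \<open>X\<close> and
  \<open>G.Z\<close> is closed under products, since a product of two invariants vanishing at 0 lies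
  in \<open>G.Z\<close>. An invariant of G is a polynomial in \<open>fs\<close> and equals its own
  average, so averages of monomials suffice.\<close>

lemma invariants_generated: "f \<in> G.R \<Longrightarrow> \<exists>c. \<exists>a\<in>fspan X. \<exists>z\<in>G.Z. f = G.cst c + a + z"
proof -
  define Q where "Q = {f. \<exists>c. \<exists>a\<in>fspan X. \<exists>z\<in>G.Z. f = G.cst c + a + z}"
  have cst_eq: "G.cst c = fscale c 1" for c by (auto simp: G.cst_def fun_eq_iff fun_ops)
  have QI: "f \<in> Q" if "a \<in> fspan X" "z \<in> G.Z" "f = G.cst c + a + z" for f c a z using that by (auto simp: Q_def)
  have Q_sub: "fv.subspace Q"
  proof (rule fv.subspaceI)
    show "0 \<in> Q" by (rule QI[of 0 0 _ 0]) (auto simp: fv.span_zero fv.subspace_0[OF G.Z_subspace] cst_eq)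
  next
    fix f g assume "f \<in> Q" "g \<in> Q"
    then obtain c a z c' a' z' where "a \<in> fspan X" "z \<in> G.Z" "f = G.cst c + a + z"
      "a' \<in> fspan X" "z' \<in> G.Z" "g = G.cst c' + a' + z'" unfolding Q_def by blast
    then show "f + g \<in> Q"
      by (intro QI[of "a + a'" "z + z'" _ "c + c'"])
        (auto simp: fv.span_add fv.subspace_add[OF G.Z_subspace] cst_eq fv.scale_left_distrib)
  next
    fix e f assume "f \<in> Q"
    then obtain c a z where "a \<in> fspan X" "z \<in> G.Z" "f = G.cst c + a + z" unfolding Q_def by blast
    then show "fscale e f \<in> Q"
      by (intro QI[of "fscale e a" "fscale e z" _ "e * c"])
        (auto simp: fv.span_scale fv.subspace_scale[OF G.Z_subspace] cst_eq fv.scale_right_distrib)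
  qed
  have Q_cst: "G.cst c \<in> Q" for c
    by (rule QI[of 0 0 _ c]) (auto simp: fv.span_zero fv.subspace_0[OF G.Z_subspace])
  have Q_mult: "f * g \<in> Q" if fg: "f \<in> Q" "g \<in> Q" for f g
  proof -
    obtain c a z c' a' z' where *: "a \<in> fspan X" "z \<in> G.Z" "f = G.cst c + a + z"
      "a' \<in> fspan X" "z' \<in> G.Z" "g = G.cst c' + a' + z'" using fg unfolding Q_def by blast
    let ?u = "a + z" and ?u' = "a' + z'"
    have u: "?u \<in> G.R0" "?u' \<in> G.R0"
      using * span_X_R0 G.Z_R0 by (auto intro: fv.subspace_add[OF G.R0_subspace])
    have "fscale c a' + fscale c' a \<in> fspan X" using * by (intro fv.span_add fv.span_scale)
    moreover have "fscale c z' + fscale c' z + ?u * ?u' \<in> G.Z"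
      using * u by (intro fv.subspace_add[OF G.Z_subspace] fv.subspace_scale[OF G.Z_subspace] G.Z_base)
    moreover have "f * g = G.cst (c * c') + (fscale c a' + fscale c' a) + (fscale c z' + fscale c' z + ?u * ?u')"
      unfolding *(3,6) cst_eq by (simp add: fun_eq_iff fun_ops algebra_simps)
    ultimately show ?thesis by (rule QI)
  qed
  have Q_prod: "(\<Prod>d\<in>A. h d) \<in> Q" if "finite A" "\<And>d. d \<in> A \<Longrightarrow> h d \<in> Q" for A :: "nat set" and h
    using that
  proof (induction A rule: finite_induct)
    case empty
    then show ?case using Q_cst[of 1] by (simp add: G.cst_1)
  next
    case (insert d A)
    then show ?case by (simp add: Q_mult)
  qed
  have Q_Avg: "G.Avg t \<in> Q" if t: "t \<in> T d k" and d: "d > 0" for t d k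
  proof -
    have aT: "G.Avg t \<in> T d k" unfolding G.Avg_def using t by (intro T_scale T_sum T_fa)
    have "G.Avg t \<in> G.R" using T_Sd[OF t] G.Sd_in_S by (intro G.Avg_in_R) blast
    show ?thesis
    proof (cases "k = 0")
      case True
      then show ?thesis using aT Q_cst by auto
    next
      case False
      then have "G.Avg t \<in> X" using aT d \<open>G.Avg t \<in> G.R\<close> by (auto simp: X_def simp del: T.simps)
      then show ?thesis
        by (intro QI[of "G.Avg t" 0 _ 0]) (auto simp: fv.span_base fv.subspace_0[OF G.Z_subspace] cst_eq)
    qed
  qed
  \<comment> \<open>A monomial is a product of one factor per block, and by
    \<open>Avg_prod_blocks\<close> its average is the product of the averages of these
    factors.\<close>
  have Q_monom: "G.Avg (subst_monom UNIV fs m) \<in> Q" if m: "m \<in> exponents r" for m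
  proof -
    let ?K = "Poly_Mapping.keys m"
    define Ds where "Ds = (\<lambda>i. ds ! i) ` ?K"
    define t where "t d = (\<Prod>i\<in>{i \<in> ?K. ds ! i = d}. fs ! i ^ Poly_Mapping.lookup m i)" for d
    have "subst_monom UNIV fs m = (\<Prod>i\<in>?K. fs ! i ^ Poly_Mapping.lookup m i)"
      by (auto simp: subst_monom_def fun_ops)
    also have "\<dots> = (\<Prod>d\<in>Ds. t d)"
      unfolding t_def Ds_def by (rule prod.group[symmetric]) auto
    finally have eq: "subst_monom UNIV fs m = (\<Prod>d\<in>Ds. t d)" .
    have tT: "\<exists>k. t d \<in> T d k" for d
      unfolding t_def using m by (intro T_prod_powers) auto
    have "G.Avg (t d) \<in> Q" if "d \<in> Ds" for d
    proof -
      have "d > 0" using that m fundN(4) by (auto simp: Ds_def)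
      then show ?thesis using tT[of d] Q_Avg by blast
    qed
    moreover have "finite Ds" by (simp add: Ds_def)
    ultimately have "(\<Prod>d\<in>Ds. G.Avg (t d)) \<in> Q" by (intro Q_prod)
    then show ?thesis unfolding eq using Avg_prod_blocks[OF \<open>finite Ds\<close> tT] by simp
  qed
  assume f: "f \<in> G.R"
  have "f \<in> fspan (subst_monom UNIV fs ` exponents r)"
    using R_sub[OF f] fundN(6) poly_subst_image[of UNIV fs r] by auto
  then have "G.Avg f \<in> Q"
  proof (induction rule: fv.span_induct_alt)
    case base
    then show ?case using fv.subspace_0[OF Q_sub] by (simp add: G.Avg_zero)
  next
    case (step c h g)
    then have "G.Avg h \<in> Q" using Q_monom by blast
    then show ?case
      using step by (auto simp: G.Avg_add G.Avg_scale intro!: fv.subspace_add[OF Q_sub] fv.subspace_scale[OF Q_sub])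
  qed
  then show ?thesis using G.Avg_R[OF f] by (simp add: Q_def)
qed

section \<open>The two integers attached to each generator and the resulting lists of
  degrees\<close>

lemma simultaneous_indexing:
  "\<exists>\<delta> \<kappa>. (\<forall>i<r. \<delta> i > 0 \<and> \<kappa> i > 0) \<and>
     degrees scale UNIV (KG\<lparr>carrier := N\<rparr>) act = mset (map \<delta> [0..<r]) \<and>
     degrees scale UNIV KG act = mset (map (\<lambda>i. \<delta> i * \<kappa> i) [0..<r]) \<and>
     degrees fscale E H actH = mset (map \<kappa> [0..<r]) \<and>
     fake_degrees scale UNIV (KG\<lparr>carrier := N\<rparr>) act scale UNIV act = mset (map (\<lambda>i. \<delta> i - 1) [0..<r]) \<and>
     fake_degrees scale UNIV KG act scale UNIV act = mset (map (\<lambda>i. \<delta> i * \<kappa> i - 1) [0..<r]) \<and>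
     fake_degrees scale UNIV KG act fscale E actE = mset (map (\<lambda>i. \<delta> i * (\<kappa> i - 1)) [0..<r]) \<and>
     fake_degrees fscale E H actH fscale E actH = mset (map (\<lambda>i. \<kappa> i - 1) [0..<r])"
proof -
  have "\<forall>f. \<exists>d k. f \<in> X \<longrightarrow> d > 0 \<and> k > 0 \<and> f \<in> T d k" by (auto simp: X_def simp del: T.simps)
  then obtain dX kX where dk: "\<And>f. f \<in> X \<Longrightarrow> dX f > 0" "\<And>f. f \<in> X \<Longrightarrow> kX f > 0" "\<And>f. f \<in> X \<Longrightarrow> f \<in> T (dX f) (kX f)"
    by metis
  have "\<exists>Gs. set Gs \<subseteq> X \<and> fundamental_invariants scale UNIV KG act Gs (map (\<lambda>f. dX f * kX f) Gs)"
  proof (rule G.fundamental_invariants_exist)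
    show "f \<in> G.R" "f \<in> G.Sd (dX f * kX f)" "dX f * kX f > 0" if "f \<in> X" for f
      using that dk T_Sd by (auto simp: X_def simp del: T.simps)
    fix f assume f: "f \<in> G.R0"
    then obtain c a z where *: "a \<in> fspan X" "z \<in> G.Z" "f = G.cst c + a + z"
      using invariants_generated G.R0_in_R by blast
    have "a 0 = 0" "z 0 = 0" "f 0 = 0" using * f span_X_R0 G.Z_R0 by (auto simp: G.R0_def)
    then have "c = 0" using *(3) by (simp add: fun_ops G.cst_def)
    then have "f = a + z" using *(3) by (simp add: G.cst_def fun_eq_iff fun_ops)
    then show "\<exists>a\<in>fspan X. \<exists>z\<in>G.Z. f = a + z" using * by blast
  qed
  then obtain Gs where Gs: "set Gs \<subseteq> X" "fundamental_invariants scale UNIV KG act Gs (map (\<lambda>f. dX f * kX f) Gs)" by blast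
  note fundG = G.fundamentalD[OF Gs(2)]
  define \<delta> where "\<delta> i = dX (Gs ! i)" for i
  define \<kappa> where "\<kappa> i = kX (Gs ! i)" for i
  have GX: "Gs ! i \<in> X" if "i < r" for i using that Gs(1) fundG(1) by auto
  have pos: "\<delta> i > 0" "\<kappa> i > 0" if "i < r" for i using dk GX[OF that] by (auto simp: \<delta>_def \<kappa>_def)
  have "\<forall>i. \<exists>F. i < r \<longrightarrow> F \<in> EG.Sd (\<kappa> i) \<and> pull F = Gs ! i \<and>
      (\<forall>w\<in>E. pull (EG.D w F) \<in> G.Sd (\<delta> i * (\<kappa> i - 1))) \<and> (\<forall>j<r. ds ! j \<noteq> \<delta> i \<longrightarrow> EG.D (be j) F = 0)"
    using T_lift[OF dk(3)[OF GX]] unfolding \<delta>_def \<kappa>_def by blast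
  from choice[OF this] obtain FE where FE: "\<And>i. i < r \<Longrightarrow> FE i \<in> EG.Sd (\<kappa> i)" "\<And>i. i < r \<Longrightarrow> pull (FE i) = Gs ! i"
    "\<And>i w. i < r \<Longrightarrow> w \<in> E \<Longrightarrow> pull (EG.D w (FE i)) \<in> G.Sd (\<delta> i * (\<kappa> i - 1))"
    "\<And>i j. i < r \<Longrightarrow> j < r \<Longrightarrow> ds ! j \<noteq> \<delta> i \<Longrightarrow> EG.D (be j) (FE i) = 0"
    by blast
  have FE_R: "FE i \<in> EH.R" if "i < r" for i
    using FE(1,2)[OF that] GX[OF that] EG.Sd_in_S by (auto simp: EH_R_iff X_def)
  define Fs where "Fs = map FE [0..<r]"
  have pull_Fs: "map pull Fs = Gs" using FE(2) fundG(1) by (intro nth_equalityI) (auto simp: Fs_def)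
  have pull_sub: "pull (poly_subst E Fs p) = poly_subst UNIV Gs p" if "p \<in> mpolys r" for p
    using pull_poly_subst[of p Fs] that by (simp add: pull_Fs) (simp add: Fs_def)
  have sub_S: "poly_subst E Fs p \<in> EG.S" if "p \<in> mpolys r" for p
    using that FE(1) EG.Sd_in_S by (intro EG.poly_subst_in_S) (auto simp: Fs_def)
  \<comment> \<open>Since \<open>pull\<close> identifies the invariants of H with those of G, the
    lifts of \<open>Gs\<close> are fundamental invariants of H; only the degree changes, from
    \<delta> \<kappa> on V to \<kappa> on E.\<close>
  have fundH: "fundamental_invariants fscale E H actH Fs (map \<kappa> [0..<r])"
    unfolding fundamental_invariants_def EH.R_def[symmetric]
  proof (intro conjI allI impI)
    show "length Fs = fv.dim E" by (simp add: Fs_def EG.dim_W)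
    show "length (map \<kappa> [0..<r]) = length Fs" by (simp add: Fs_def)
    show "Fs ! i \<in> EG.Sd (map \<kappa> [0..<r] ! i)" if "i < length Fs" for i using that FE(1) by (simp add: Fs_def)
    show "alg_independent E Fs"
      unfolding alg_independent_def
    proof (intro ballI impI)
      fix p assume p: "p \<in> mpolys (length Fs)" "poly_subst E Fs p = 0"
      then have "poly_subst UNIV Gs p = 0" using pull_sub[of p] by (simp add: Fs_def pull_zero)
      then show "p = 0" using fundG(1,7) p(1) by (auto simp: alg_independent_def Fs_def)
    qed
    show "EH.R = poly_subst E Fs ` mpolys (length Fs)"
    proof (intro equalityI subsetI)
      fix F assume F: "F \<in> EH.R"
      then obtain p where p: "p \<in> mpolys r" "pull F = poly_subst UNIV Gs p"
        unfolding EH_R_iff fundG(6) by blast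
      then have "F = poly_subst E Fs p" using F sub_S pull_sub by (intro pull_inj) (auto simp: EH_R_iff)
      then show "F \<in> poly_subst E Fs ` mpolys (length Fs)" using p(1) by (auto simp: Fs_def)
    next
      fix F assume "F \<in> poly_subst E Fs ` mpolys (length Fs)"
      then obtain p where p: "p \<in> mpolys r" "F = poly_subst E Fs p" by (auto simp: Fs_def)
      then have "F \<in> EG.S" "pull F \<in> G.R" using sub_S[OF p(1)] pull_sub[OF p(1)] fundG(6) by auto
      then show "F \<in> EH.R" by (simp add: EH_R_iff)
    qed
  qed
  note fundHD = EH.fundamentalD[OF fundH]
  \<comment> \<open>Stated for subfamilies: one block is used to count the \<delta>, all indices to
    find the fake degrees of E.\<close>
  have indD: "\<forall>j\<in>J. c j = 0"
    if J: "J \<subseteq> {..<r}" and c: "\<And>w. w \<in> E \<Longrightarrow> (\<Sum>j\<in>J. fscale (c j) (EG.D w (FE j))) \<in> EH.I" for J c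
  proof (rule EH.differentials_independent[where F = FE and d = \<kappa>, OF finite_subset[OF J finite_lessThan] _ _ _ _ c])
    fix j assume "j \<in> J"
    then have "j < r" using J by auto
    then show "FE j \<in> EH.R" "FE j \<in> EG.Sd (\<kappa> j)" "\<kappa> j > 0" using FE_R FE(1) pos by auto
  next
    fix e assume e: "(\<Sum>j\<in>J. fscale (e j) (FE j)) \<in> EH.Z"
    have "(\<Sum>j<r. fscale (if j \<in> J then e j else 0) (Fs ! j)) = (\<Sum>j\<in>J. fscale (e j) (FE j))"
      using J by (intro sum.mono_neutral_cong_right) (auto simp: Fs_def)
    then have "\<forall>j<r. (if j \<in> J then e j else 0) = 0" using e by (intro fundHD(8)) simp
    then show "\<forall>j\<in>J. e j = 0" using J by (auto split: if_splits)
  qed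
  \<comment> \<open>The differentials of the generators in block d involve only the coordinates of
    that block, so there are at most dim B_d of them, the multiplicity of d in \<open>ds\<close>.
    Both multisets have \<open>r\<close> elements, so the inclusion is an equality.\<close>
  have "mset (map \<delta> [0..<r]) \<subseteq># mset ds"
  proof (rule mset_subset_eqI)
    fix d
    define J where "J = {j. j < r \<and> \<delta> j = d}"
    define L where "L = {k. k < r \<and> ds ! k = d}"
    have "card J \<le> card L"
    proof (rule card_le_pullback[where \<psi> = "\<lambda>j w. EG.D w (FE j)"])
      show "finite J" "L \<subseteq> {..<r}" by (auto simp: J_def L_def)
      fix j w assume j: "j \<in> J" and w: "w \<in> E"
      then have jr: "j < r" "\<delta> j = d" by (auto simp: J_def)
      have FS: "FE j \<in> EG.S" using FE(1)[OF jr(1)] EG.Sd_in_S by blast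
      show "EG.D w (FE j) \<in> EG.S" using FS w by (rule EG.D_in_S)
      show "EG.D w (FE j) = (\<Sum>k\<in>L. fscale (xe k w) (EG.D (be k) (FE j)))"
        unfolding EG.D_expand[OF FS w] using FE(4)[OF jr(1)] jr(2)
        by (intro sum.mono_neutral_right) (auto simp: L_def)
      show "EH.fa C (EG.D w (FE j)) = EG.D (actH C w) (FE j)" if "C \<in> carrier H" for C
        using EH.D_equivariant[OF FE_R[OF jr(1)] w that] .
    next
      fix c assume "\<And>w. w \<in> E \<Longrightarrow> (\<Sum>j\<in>J. fscale (c j) (EG.D w (FE j))) \<in> EH.I"
      then show "\<forall>j\<in>J. c j = 0" by (intro indD) (auto simp: J_def)
    qed
    moreover have count: "count (mset xs) d = card {i. i < length xs \<and> xs ! i = d}" for xs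
    proof -
      have "count (mset xs) d = length (filter (\<lambda>x. x = d) xs)" by (induction xs) auto
      then show ?thesis unfolding length_filter_conv_card .
    qed
    have "count (mset (map \<delta> [0..<r])) d = card J"
      unfolding count by (rule arg_cong[of _ _ card]) (auto simp: J_def)
    moreover have "count (mset ds) d = card L"
      unfolding count by (simp add: L_def fundN(2))
    ultimately show "count (mset (map \<delta> [0..<r])) d \<le> count (mset ds) d" by simp
  qed
  moreover have "size (mset (map \<delta> [0..<r])) = size (mset ds)" using fundN(2) by simp
  ultimately have \<delta>_ds: "mset ds = mset (map \<delta> [0..<r])"
    by (metis mset_subset_size subset_mset.le_neq_trans less_irrefl)
  have fakeE: "fake_degrees scale UNIV KG act fscale E actE = mset (map (\<lambda>i. \<delta> i * (\<kappa> i - 1)) [0..<r])"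
  proof (rule GE.fake_degrees_eq(2)[where \<omega> = "\<lambda>i w. pull (EG.D w (FE i))"])
    fix i assume i: "i < r"
    have FS: "FE i \<in> EG.S" using FE(1)[OF i] EG.Sd_in_S by blast
    show "(\<lambda>w. pull (EG.D w (FE i))) \<in> GE.hom_space (\<delta> i * (\<kappa> i - 1))"
      unfolding GE.hom_space_def
    proof (intro CollectI conjI ballI allI)
      fix g w assume g: "g \<in> carrier KG" and w: "w \<in> E"
      have "G.fa g (pull (EG.D w (FE i))) = pull (EH.fa (N #>\<^bsub>KG\<^esub> g) (EG.D w (FE i)))"
        using pull_fa[OF coset_in_H[OF g] in_coset[OF g]] by simp
      also have "\<dots> = pull (EG.D (actE g w) (FE i))"
        using EH.D_equivariant[OF FE_R[OF i] w coset_in_H[OF g]] by (simp add: actH_coset[OF g])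
      finally show "G.fa g (pull (EG.D w (FE i))) = pull (EG.D (actE g w) (FE i))" .
    qed (use FS FE(3)[OF i] in \<open>auto simp: EG.D_dir_add EG.D_dir_scale pull_add pull_scale\<close>)
  next
    fix c assume c: "\<And>w. w \<in> E \<Longrightarrow> (\<Sum>i<r. fscale (c i) (pull (EG.D w (FE i)))) \<in> G.I"
    have "\<forall>i\<in>{..<r}. c i = 0"
    proof (rule indD)
      fix w assume w: "w \<in> E"
      have "EG.D w (FE i) \<in> EG.S" if "i < r" for i
        using FE(1)[OF that] EG.Sd_in_S w by (intro EG.D_in_S) auto
      then show "(\<Sum>i<r. fscale (c i) (EG.D w (FE i))) \<in> EH.I"
        using c[OF w] by (intro pull_I) (auto simp: pull_sum pull_scale intro!: EG.S_sum EG.S_scale)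
    qed simp
    then show "\<forall>i<r. c i = 0" by simp
  qed (rule GE.length_indep_le)
  have map_Gs: "map (\<lambda>f. dX f * kX f) Gs = map (\<lambda>i. \<delta> i * \<kappa> i) [0..<r]"
    using fundG(1) by (intro nth_equalityI) (auto simp: \<delta>_def \<kappa>_def)
  have "image_mset (\<lambda>d. d - 1) (mset ds) = image_mset (\<lambda>d. d - 1) (mset (map \<delta> [0..<r]))"
    by (simp only: \<delta>_ds)
  then have map_ds: "mset (map (\<lambda>d. d - 1) ds) = mset (map (\<lambda>i. \<delta> i - 1) [0..<r])"
    unfolding mset_map[symmetric] map_map comp_def .
  note degN = N.degrees_of_fundamental_invariants[OF fund]
  note degG = G.degrees_of_fundamental_invariants[OF Gs(2), unfolded map_Gs map_map comp_def]
  note degH = degrees_of_fundamental_invariants_H[OF fundH, unfolded map_map comp_def]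
  have pos': "\<forall>i<r. \<delta> i > 0 \<and> \<kappa> i > 0" using pos by blast
  show ?thesis
    by (rule exI[of _ \<delta>], rule exI[of _ \<kappa>]) (use pos' degN degG degH fakeE \<delta>_ds map_ds in \<open>simp only: simp_thms\<close>)
qed

end

section \<open>Reflection groups in the general linear group\<close>

lemma finite_dimensional_polyspace:
  fixes scale :: "complex \<Rightarrow> 'v::ab_group_add \<Rightarrow> 'v"
  assumes "finite_dimensional_vector_space scale Basis"
  shows "\<exists>b x. polyspace scale UNIV (vector_space.dim scale (UNIV :: 'v set)) b x"
proof -
  interpret finite_dimensional_vector_space scale Basis by (rule assms)
  obtain h where h: "bij_betw h {..<card Basis} Basis"
    using ex_bij_betw_nat_finite[OF finite_Basis] by (auto simp: atLeast0LessThan)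
  have hB: "h k \<in> Basis" if "k < card Basis" for k using h that by (auto simp: bij_betw_def)
  have sp: "v \<in> span Basis" for v using span_Basis by auto
  define x where "x k v = representation Basis v (h k)" for k v
  have "polyspace scale UNIV (card Basis) h x"
  proof (intro polyspace.intro vector_space_axioms polyspace_axioms.intro)
    show "x k \<in> dual_space scale UNIV" for k
      by (simp add: dual_space_def x_def representation_add[OF independent_Basis sp sp]
          representation_scale[OF independent_Basis sp])
    show "x k (h l) = (if k = l then 1 else 0)" if "k < card Basis" "l < card Basis" for k l
    proof -
      have "h k = h l \<longleftrightarrow> k = l" using h that by (auto simp: bij_betw_def inj_on_def)
      then show ?thesis using representation_basis[OF independent_Basis hB[OF that(2)]] by (simp add: x_def)
    qed
    show "(\<Sum>k<card Basis. scale (x k w) (h k)) = w" for w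
    proof -
      have "(\<Sum>k<card Basis. scale (x k w) (h k)) = (\<Sum>v\<in>Basis. scale (representation Basis w v) v)"
        unfolding x_def by (rule sum.reindex_bij_betw[OF h])
      also have "\<dots> = w" by (rule sum_representation_eq[OF independent_Basis sp finite_Basis order_refl])
      finally show ?thesis .
    qed
  qed auto
  then show ?thesis by auto
qed

lemma linear_iff_additive:
  "vector_space scale \<Longrightarrow> Vector_Spaces.linear scale scale g \<longleftrightarrow>
    (\<forall>v w. g (v + w) = g v + g w) \<and> (\<forall>c v. g (scale c v) = scale c (g v))"
  by (auto simp: Vector_Spaces.linear_def module_hom_iff vector_space_def module_def)

lemma group_GL:
  assumes "vector_space scale"
  shows "group (GL scale)"
proof (rule groupI)
  fix g assume g: "g \<in> carrier (GL scale)"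
  then have bij: "bij g" and lin: "\<And>v w. g (v + w) = g v + g w" "\<And>c v. g (scale c v) = scale c (g v)"
    by (auto simp: GL_def linear_iff_additive[OF assms])
  define h where "h = inv_into UNIV g"
  have g_inv: "g (h v) = v" "h (g v) = v" for v
    using bij by (simp_all add: h_def bij_is_inj bij_is_surj surj_f_inv_f)
  have "h (v + w) = h v + h w" "h (scale c v) = scale c (h v)" for v w c
    using lin(1)[of "h v" "h w"] lin(2)[of c "h v"] g_inv by metis+
  then have "h \<in> carrier (GL scale)" using bij_imp_bij_inv[OF bij]
    by (simp add: GL_def linear_iff_additive[OF assms] h_def)
  moreover have "h \<circ> g = id" using g_inv by auto
  ultimately show "\<exists>h\<in>carrier (GL scale). h \<otimes>\<^bsub>GL scale\<^esub> g = \<one>\<^bsub>GL scale\<^esub>" by (auto simp: GL_def)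
qed (auto simp: GL_def linear_iff_additive[OF assms] bij_comp comp_assoc)

text \<open>\<alpha> is the coordinate along a vector \<open>c\<close> outside the hyperplane, and
  \<open>u\<close> is \<open>s c - c\<close>. As \<alpha> depends only on the hyperplane and
  \<open>c\<close>, it is nonzero for the identity too, where \<open>u\<close> is 0.\<close>

lemma reflection_linear_form:
  fixes scale :: "complex \<Rightarrow> 'v::ab_group_add \<Rightarrow> 'v"
  assumes "finite_dimensional_vector_space scale Basis" and s: "s \<in> reflections scale"
  shows "\<exists>\<alpha>\<in>dual_space scale UNIV. \<alpha> \<noteq> 0 \<and> (\<exists>u. \<forall>w. s w = w + scale (\<alpha> w) u)"
proof -
  interpret finite_dimensional_vector_space scale Basis by (rule assms)
  obtain U where U: "subspace U" "dim U + 1 = dim (UNIV :: 'v set)" "\<And>u. u \<in> U \<Longrightarrow> s u = u"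
    using s by (auto simp: reflections_def)
  have lin: "s (v + w) = s v + s w" "s (scale c v) = scale c (s v)" for v w c
    using s by (auto simp: reflections_def GL_def linear_iff_additive[OF vector_space_axioms])
  obtain c where c: "c \<notin> U" using U(2) by (metis UNIV_eq_I add_cancel_right_right zero_neq_one)
  have "dim (insert c U) = dim U + 1" using c U(1) by (simp add: dim_insert span_eq_iff[THEN iffD2])
  then have "span (insert c U) = UNIV" using U(2) dim_eq_full dim_UNIV dimension_def by metis
  then have "\<exists>k. v - scale k c \<in> U" for v
    using span_breakdown_eq[of v c U] U(1) by (metis UNIV_I span_eq_iff)
  then obtain \<alpha> where \<alpha>: "\<And>v. v - scale (\<alpha> v) c \<in> U" by metis
  have uniq: "\<alpha> v = k" if "v - scale k c \<in> U" for v k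
  proof (rule ccontr)
    assume ne: "\<alpha> v \<noteq> k"
    have "(v - scale k c) - (v - scale (\<alpha> v) c) \<in> U" by (rule subspace_diff[OF U(1) that \<alpha>])
    then have "scale (\<alpha> v - k) c \<in> U" by (simp add: scale_left_diff_distrib)
    then have "scale (1 / (\<alpha> v - k)) (scale (\<alpha> v - k) c) \<in> U" by (rule subspace_scale[OF U(1)])
    then show False using c ne by simp
  qed
  have add: "\<alpha> (v + w) = \<alpha> v + \<alpha> w" for v w
    using subspace_add[OF U(1) \<alpha>[of v] \<alpha>[of w]] by (intro uniq) (simp add: scale_left_distrib algebra_simps)
  have scl: "\<alpha> (scale a v) = a * \<alpha> v" for a v
    using subspace_scale[OF U(1) \<alpha>[of v], of a] by (intro uniq) (simp add: scale_right_diff_distrib)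
  have one: "\<alpha> c = 1" using subspace_0[OF U(1)] by (intro uniq) simp
  have "s w = w + scale (\<alpha> w) (s c - c)" for w
  proof -
    have "s w = s ((w - scale (\<alpha> w) c) + scale (\<alpha> w) c)" by simp
    also have "\<dots> = w - scale (\<alpha> w) c + scale (\<alpha> w) (s c)" unfolding lin using U(3)[OF \<alpha>] by simp
    finally show ?thesis by (simp add: scale_right_diff_distrib algebra_simps)
  qed
  moreover have "\<alpha> \<in> dual_space scale UNIV" by (simp add: dual_space_def add scl)
  moreover have "\<alpha> \<noteq> 0" using one by (auto simp: zero_fun_def)
  ultimately show ?thesis by blast
qed

lemma refl_group_GLsub:
  assumes fd: "finite_dimensional_vector_space scale Basis" and "polyspace scale UNIV r b x"
    and K: "subgroup K (GL scale)" "finite K" "Rf \<subseteq> reflections scale" "K = generate (GL scale) Rf"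
  shows "refl_group scale r b x (GLsub scale K) id Rf"
proof -
  have vs: "vector_space scale" using fd by (simp add: finite_dimensional_vector_space_def)
  interpret GL: group "GL scale" using group_GL[OF vs] .
  have lin: "k (v + w) = k v + k w" "k (scale c v) = scale c (k v)" if "k \<in> K" for k v w c
    using subgroup.mem_carrier[OF K(1) that] by (auto simp: GL_def linear_iff_additive[OF vs])
  have RK: "Rf \<subseteq> K" using K(4) by (auto intro: generate.incl)
  show ?thesis
  proof (intro refl_group.intro lin_group.intro assms(2) lin_group_axioms.intro refl_group_axioms.intro)
    show "group (GLsub scale K)" using K(1) by (rule GL.subgroup_imp_group)
    show "carrier (GLsub scale K) = generate (GLsub scale K) Rf"
      using GL.generate_consistent[OF RK K(1)] K(4) by simp
    show "\<exists>\<alpha>\<in>dual_space scale UNIV. \<alpha> \<noteq> 0 \<and> (\<exists>u. \<forall>w. id s w = w + scale (\<alpha> w) u)" if "s \<in> Rf" for s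
      using reflection_linear_form[OF fd, of s] that K(3) by auto
  qed (use K(2) RK lin in \<open>auto simp: GL_def\<close>)
qed

lemma image_mset_shift: "image_mset (\<lambda>i. g (i - 1)) (mset_set {1..r}) = mset (map g [0..<r])"
proof -
  have "mset_set {1..r} = image_mset Suc (mset_set {0..<r})"
    by (simp add: image_mset_mset_set image_Suc_atLeastLessThan atLeastLessThanSuc_atLeastAtMost)
  then show ?thesis by (simp add: image_mset.compositionality comp_def)
qed

theorem theorem1p3:
  fixes scale :: "complex \<Rightarrow> 'v::ab_group_add \<Rightarrow> 'v"
    and Basis :: "'v set"
    and r :: nat
    and G N :: "('v \<Rightarrow> 'v) set"
    and Es :: "('v \<Rightarrow> complex) set"
  defines "KG \<equiv> GLsub scale G"
    and "KN \<equiv> GLsub scale N"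
    and "H \<equiv> GLsub scale G Mod N"
    and "E \<equiv> dual_space fscale Es"
    and "actG \<equiv> act_E scale G Es"
    and "actH \<equiv> act_E_coset scale G Es"
  assumes "finite_dimensional_vector_space scale Basis"
    and "vector_space.dim scale (UNIV :: 'v set) = r"
    and "complex_reflection_group scale G"
    and "normal_reflection_subgroup scale N G"
    and "quotient_dual scale G N Es"
  shows "\<exists>dN dG dH eN_V eG_V eG_E eH_E :: nat \<Rightarrow> nat.
     image_mset dN (mset_set {1..r}) = degrees scale UNIV KN id \<and>
     image_mset dG (mset_set {1..r}) = degrees scale UNIV KG id \<and>
     image_mset dH (mset_set {1..r}) = degrees fscale E H actH \<and>
     image_mset eN_V (mset_set {1..r}) = fake_degrees scale UNIV KN id scale UNIV id \<and>
     image_mset eG_V (mset_set {1..r}) = fake_degrees scale UNIV KG id scale UNIV id \<and>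
     image_mset eG_E (mset_set {1..r}) = fake_degrees scale UNIV KG id fscale E actG \<and>
     image_mset eH_E (mset_set {1..r}) = fake_degrees fscale E H actH fscale E actH \<and>
     (\<forall>i\<in>{1..r}. eN_V i + eG_E i = eG_V i \<and>
                 dN i * dH i = dG i \<and>
                 dN i * eH_E i = eG_E i)"
proof -
  have vs: "vector_space scale" using assms(7) by (simp add: finite_dimensional_vector_space_def)
  interpret GL: group "GL scale" using group_GL[OF vs] .
  obtain b x where P: "polyspace scale UNIV r b x" using finite_dimensional_polyspace[OF assms(7)] assms(8) by auto
  obtain RG where G: "subgroup G (GL scale)" "finite G" "RG \<subseteq> reflections scale" "G = generate (GL scale) RG"
    using assms(9) by (auto simp: complex_reflection_group_def generated_by_reflections_def)
  obtain RN where N: "N \<lhd> GLsub scale G" "RN \<subseteq> reflections scale" "N = generate (GL scale) RN"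
    using assms(10) by (auto simp: normal_reflection_subgroup_def generated_by_reflections_def)
  have NG: "subgroup N (GLsub scale G)" using N(1) by (rule normal_imp_subgroup)
  then have "N \<subseteq> G" using subgroup.subset by fastforce
  then have finN: "finite N" using G(2) finite_subset by blast
  have subN: "subgroup N (GL scale)" using GL.incl_subgroup[OF G(1) NG] .
  have GN: "(GLsub scale G)\<lparr>carrier := N\<rparr> = GLsub scale N" by simp
  obtain fs ds where Q: "fundamental_invariants scale UNIV (GLsub scale N) id fs ds" "Es = fspan (set fs)"
    "\<And>g f. g \<in> G \<Longrightarrow> f \<in> Es \<Longrightarrow> fun_act (GLsub scale G) id UNIV g f \<in> Es"
    using assms(11) by (auto simp: quotient_dual_def)
  interpret refl_pair scale r b x "GLsub scale G" id RG N RN fs ds Es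
  proof (intro refl_pair.intro refl_pair_axioms.intro N(1))
    show "refl_group scale r b x (GLsub scale G) id RG"
      by (rule refl_group_GLsub[OF assms(7) P G])
    show "refl_group scale r b x ((GLsub scale G)\<lparr>carrier := N\<rparr>) id RN"
      unfolding GN by (rule refl_group_GLsub[OF assms(7) P subN finN N(2,3)])
  qed (use Q in \<open>simp_all add: GN\<close>)
  have actG: "actG = fun_act (GLsub scale G) (fun_act (GLsub scale G) id UNIV) Es"
    by (simp add: actG_def act_E_def)
  have actH: "act_E_coset scale G Es = refl_pair.actH (GLsub scale G) id Es"
    by (intro ext) (simp add: act_E_coset_def act_E_def local.actH_def)
  obtain \<delta> \<kappa> where pos: "\<forall>i<r. \<delta> i > 0 \<and> \<kappa> i > 0" and eqs:
    "degrees scale UNIV KN id = mset (map \<delta> [0..<r])"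
    "degrees scale UNIV KG id = mset (map (\<lambda>i. \<delta> i * \<kappa> i) [0..<r])"
    "degrees fscale E H actH = mset (map \<kappa> [0..<r])"
    "fake_degrees scale UNIV KN id scale UNIV id = mset (map (\<lambda>i. \<delta> i - 1) [0..<r])"
    "fake_degrees scale UNIV KG id scale UNIV id = mset (map (\<lambda>i. \<delta> i * \<kappa> i - 1) [0..<r])"
    "fake_degrees scale UNIV KG id fscale E actG = mset (map (\<lambda>i. \<delta> i * (\<kappa> i - 1)) [0..<r])"
    "fake_degrees fscale E H actH fscale E actH = mset (map (\<lambda>i. \<kappa> i - 1) [0..<r])"
    using simultaneous_indexing unfolding GN actG E_def KG_def KN_def H_def assms(6) actH by blast
  \<comment> \<open>Subtraction is truncated; the identity relies on both numbers being
    positive.\<close>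
  have arith: "\<delta> i - 1 + \<delta> i * (\<kappa> i - 1) = \<delta> i * \<kappa> i - 1" if "i < r" for i
    using pos that by (cases "\<delta> i"; cases "\<kappa> i") auto
  show ?thesis
    unfolding eqs
    by (rule exI[of _ "\<lambda>i. \<delta> (i - 1)"], rule exI[of _ "\<lambda>i. \<delta> (i - 1) * \<kappa> (i - 1)"],
        rule exI[of _ "\<lambda>i. \<kappa> (i - 1)"], rule exI[of _ "\<lambda>i. \<delta> (i - 1) - 1"],
        rule exI[of _ "\<lambda>i. \<delta> (i - 1) * \<kappa> (i - 1) - 1"], rule exI[of _ "\<lambda>i. \<delta> (i - 1) * (\<kappa> (i - 1) - 1)"],
        rule exI[of _ "\<lambda>i. \<kappa> (i - 1) - 1"])
      (use arith image_mset_shift[where r = r] in auto)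
qed

end
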